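(* Let $\varphi \colon \mathbb S \to \mathbb S$ be a homeomorphism of the unit circle onto itself and let $p,q$ be exponents (in $(1,\infty)$). Then $\varphi$ satisfies the $p$-Douglas condition and $\varphi^{-1}$ satisfies the $q$-Douglas condition if and only if $\varphi$ admits a homeomorphic extension $h\colon\overline{\mathbb D}\to\overline{\mathbb D}$ (i.e. a homeomorphism of $\overline{\mathbb D}$ onto itself with $h=\varphi$ on $\mathbb S$) such that $h\in\mathscr W^{1,p}(\mathbb D,\mathbb C)$ and $h^{-1}\in\mathscr W^{1,q}(\mathbb D,\mathbb C)$.
   Context: $\mathbb D$ is the open unit disk in $\mathbb C$ and $\mathbb S=\partial\mathbb D$. A map $\psi\colon\mathbb S\to\mathbb S$ satisfies the $r$-Douglas condition if $\int_{\mathbb S}\int_{\mathbb S} \left|\frac{\psi(\xi)-\psi(\eta)}{\xi-\eta}\right|^r |\mathrm d\xi|\,|\mathrm d\eta|<\infty$, integrals being with respect to arc length. $\mathscr W^{1,p}(\mathbb D,\mathbb C)$ is the Sobolev space of functions in $L^p(\mathbb D)$ with first weak derivatives in $L^p(\mathbb D)$. *)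

theory Defs
  imports "HOL-Analysis.Analysis"
begin

coinductive smooth_fun :: "(complex \<Rightarrow> real) \<Rightarrow> bool" where
  "(\<forall>z. f differentiable (at z)) \<Longrightarrow>
   (\<forall>v. smooth_fun (\<lambda>z. frechet_derivative f (at z) v)) \<Longrightarrow> smooth_fun f"

definition test_fun :: "complex set \<Rightarrow> (complex \<Rightarrow> real) \<Rightarrow> bool" where
  "test_fun U \<phi> \<longleftrightarrow> smooth_fun \<phi> \<and> compact (closure {z. \<phi> z \<noteq> 0})
     \<and> closure {z. \<phi> z \<noteq> 0} \<subseteq> U"

definition Lp_on :: "real \<Rightarrow> complex set \<Rightarrow> (complex \<Rightarrow> complex) \<Rightarrow> bool" where
  "Lp_on p U f \<longleftrightarrow> set_borel_measurable lebesgue U f \<and>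
     (\<integral>\<^sup>+ z\<in>U. ennreal (norm (f z) powr p) \<partial>lebesgue) < \<infinity>"

definition weak_partial :: "complex set \<Rightarrow> complex \<Rightarrow> (complex \<Rightarrow> complex) \<Rightarrow> (complex \<Rightarrow> complex) \<Rightarrow> bool" where
  "weak_partial U v f g \<longleftrightarrow> (\<forall>\<phi>. test_fun U \<phi> \<longrightarrow>
     (LINT z:U|lebesgue. of_real (frechet_derivative \<phi> (at z) v) * f z)
       = - (LINT z:U|lebesgue. of_real (\<phi> z) * g z))"

definition sobolev_W1 :: "real \<Rightarrow> complex set \<Rightarrow> (complex \<Rightarrow> complex) \<Rightarrow> bool" where
  "sobolev_W1 p U f \<longleftrightarrow> Lp_on p U f \<and>
     (\<exists>gx gy. Lp_on p U gx \<and> Lp_on p U gy \<and>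
        weak_partial U 1 f gx \<and> weak_partial U \<i> f gy)"

text \<open>\<open>r\<close>-Douglas condition; arc length on the unit circle is parametrised
  by \<open>t \<mapsto> e\<^sup>i\<^sup>t\<close>, \<open>t \<in> [0,2\<pi>]\<close>, so \<open>|d\<xi>| = dt\<close>.\<close>
definition douglas :: "real \<Rightarrow> (complex \<Rightarrow> complex) \<Rightarrow> bool" where
  "douglas r \<psi> \<longleftrightarrow>
     (\<integral>\<^sup>+ st \<in> {0..2*pi} \<times> {0..2*pi}.
        ennreal (norm ((\<psi> (cis (fst st)) - \<psi> (cis (snd st))) / (cis (fst st) - cis (snd st))) powr r)
      \<partial>lborel) < \<infinity>"

end

theory Submission
  imports Defs
begin

text \<open>The extension is obtained from gradients of convex functions. In the coordinates \<open>w = exp (\<i> z)\<close>,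
  with \<open>z = x + \<i> y\<close>, \<open>y > 0\<close>, let \<open>f\<close> be an increasing lift of the circle homeomorphism and \<open>g\<close> its inverse.
  The map \<open>\<Phi>\<^sub>f (x, y) = 1/2 \<integral>\<^bsub>-1\<^esub>\<^bsup>1\<^esup> f (x + e y) (1, e) de\<close> is the gradient of a convex function, hence
  \<open>F = id + \<Phi>\<^sub>f\<close> is expansive, and so is \<open>G = id + \<Phi>\<^sub>g\<close>. On the real axis \<open>F x = x + f x = G (f x)\<close>, so
  \<open>H = G\<^sup>-\<^sup>1 \<circ> F\<close> extends \<open>f\<close>. Since \<open>G\<^sup>-\<^sup>1\<close> is 1-Lipschitz, \<open>|DH| \<le> |DF| \<lesssim> 1 + (f (x + y) - f (x - y)) / (2 y)\<close>,
  whose \<open>p\<close>-energy is controlled by the Douglas integral of \<open>f\<close>; the inverse \<open>F\<^sup>-\<^sup>1 \<circ> G\<close> is of the same form.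
  The converse is Gagliardo's trace inequality, applied to mollifications.\<close>

section \<open>Monotone extension of a circle homeomorphism\<close>

text \<open>The difficulty is to control the extension and its inverse at once, with unrelated
  exponents: a bound on the derivative of an extension does not by itself bound that of its inverse.
  Factoring through two gradients makes the problem symmetric, since the inverse of either factor is
  1-Lipschitz and only the factor applied first costs a derivative. This is what adding the identity
  buys: monotonicity becomes expansiveness. All maps live on the whole plane, where bijectivity
  follows from invariance of domain. The exponential covering replaces the circle by the line, where
  increasing lifts exist; the price is the puncture 0, where \<open>Im z\<close> tends to infinity.
  There \<open>F\<close> and \<open>G\<close> have the same linear growth \<open>4/3 * Im z\<close>,
  so \<open>Im H - Im z\<close> is bounded; this gives continuity at 0 and a derivative bound near
  it, but 0 itself has to be left out in the weak derivative argument. In the converse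
  \<open>h\<close> has no classical derivative along curves. Its mollifications do, with uniform
  energy on circles of radius below 1; since \<open>h\<close> is continuous on the closed disk,
  Fatou's lemma carries the bound to the boundary.\<close>

lemma int_translate:
  fixes u :: "'a::real_vector \<Rightarrow> 'b::real_vector"
  assumes "\<And>x. u (x + c) = u x + d"
  shows "u (x + of_int n *\<^sub>R c) = u x + of_int n *\<^sub>R d"
proof -
  have nat: "u (x + of_nat n *\<^sub>R c) = u x + of_nat n *\<^sub>R d" for x n
  proof (induction n)
    case (Suc n)
    have "u (x + of_nat (Suc n) *\<^sub>R c) = u ((x + of_nat n *\<^sub>R c) + c)" by (simp add: algebra_simps)
    also have "\<dots> = u x + of_nat (Suc n) *\<^sub>R d" unfolding assms Suc by (simp add: algebra_simps)
    finally show ?case .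
  qed simp
  show ?thesis
  proof (cases "n \<ge> 0")
    case True
    then show ?thesis using nat[of x "nat n"] by simp
  next
    case False
    then show ?thesis using nat[of "x + of_int n *\<^sub>R c" "nat (- n)"] by (simp add: algebra_simps)
  qed
qed

text \<open>For increasing \<open>a\<close> with primitive \<open>G\<close>, the map \<open>(x, y) \<mapsto> (avg0 a x y, avg1 a x y)\<close> is the
  gradient of the convex function \<open>(x, y) \<mapsto> 1/2 \<integral>\<^bsub>-1\<^esub>\<^bsup>1\<^esup> G (x + e y) de\<close>, hence monotone;
  therefore \<open>ext_map a\<close>, the identity plus this gradient, is expansive.\<close>
definition avg0 :: "(real \<Rightarrow> real) \<Rightarrow> real \<Rightarrow> real \<Rightarrow> real" where
  "avg0 a x y = integral {-1..1} (\<lambda>e. a (x + e * y)) / 2"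

definition avg1 :: "(real \<Rightarrow> real) \<Rightarrow> real \<Rightarrow> real \<Rightarrow> real" where
  "avg1 a x y = integral {-1..1} (\<lambda>e. e * a (x + e * y)) / 2"

definition ext_map :: "(real \<Rightarrow> real) \<Rightarrow> complex \<Rightarrow> complex" where
  "ext_map a z = z + Complex (avg0 a (Re z) (Im z)) (avg1 a (Re z) (Im z))"

text \<open>Lifts of orientation-preserving circle maps of degree one; orientation-reversing maps
  enter later through the sign \<open>s\<close>.\<close>

locale circle_lift =
  fixes a :: "real \<Rightarrow> real"
  assumes cont: "continuous_on UNIV a" and mono: "mono a" and per: "a (x + 2 * pi) = a x + 2 * pi"
begin

lemma continuous_a [continuous_intros]: "continuous_on S f \<Longrightarrow> continuous_on S (\<lambda>x. a (f x))"
  using continuous_on_compose2[OF cont] by blast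

lemma integrable_a: "(\<lambda>e. a (x + e * y)) integrable_on {-1..1}" "(\<lambda>e. e * a (x + e * y)) integrable_on {-1..1}"
  by (intro integrable_continuous_interval continuous_intros)+

lemma has_integral_avg:
  "((\<lambda>e. a (x + e * y)) has_integral 2 * avg0 a x y) {-1..1}"
  "((\<lambda>e. e * a (x + e * y)) has_integral 2 * avg1 a x y) {-1..1}"
  using integrable_a[of x y] by (simp_all add: avg0_def avg1_def has_integral_integrable_integral)

lemma continuous_avg: "continuous_on UNIV (\<lambda>z. avg0 a (Re z) (Im z))" "continuous_on UNIV (\<lambda>z. avg1 a (Re z) (Im z))"
proof -
  have "continuous_on UNIV (\<lambda>z. integral (cbox (-1) 1) (\<lambda>e. a (Re z + e * Im z)))"
    by (rule integral_continuous_on_param) (simp add: case_prod_beta', intro continuous_intros)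
  moreover have "continuous_on UNIV (\<lambda>z. integral (cbox (-1) 1) (\<lambda>e. e * a (Re z + e * Im z)))"
    by (rule integral_continuous_on_param) (simp add: case_prod_beta', intro continuous_intros)
  ultimately show "continuous_on UNIV (\<lambda>z. avg0 a (Re z) (Im z))" "continuous_on UNIV (\<lambda>z. avg1 a (Re z) (Im z))"
    by (auto simp: avg0_def avg1_def intro!: continuous_intros)
qed

lemma continuous_ext_map: "continuous_on UNIV (ext_map a)"
  unfolding ext_map_def Complex_eq by (intro continuous_intros continuous_avg)

text \<open>With \<open>u = x + e * y\<close> and \<open>u' = x' + e * y'\<close> the product
  \<open>(a u - a u') * (u - u')\<close> is nonnegative for every \<open>e\<close>. As
  \<open>u - u' = (x - x') + e * (y - y')\<close>, integrating over \<open>e\<close> gives the inner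
  product of the gradient difference with the displacement, without any derivative of
  \<open>a\<close>.\<close>

lemma avg_monotone:
  "(avg0 a x y - avg0 a x' y') * (x - x') + (avg1 a x y - avg1 a x' y') * (y - y') \<ge> 0"
proof -
  have "0 \<le> integral {-1..1} (\<lambda>e. (a (x + e * y) - a (x' + e * y')) * ((x + e * y) - (x' + e * y')))"
  proof (rule integral_nonneg)
    show "(\<lambda>e. (a (x + e * y) - a (x' + e * y')) * ((x + e * y) - (x' + e * y'))) integrable_on {-1..1}"
      by (intro integrable_continuous_interval continuous_intros)
    show "0 \<le> (a (x + e * y) - a (x' + e * y')) * ((x + e * y) - (x' + e * y'))" for e
      using monoD[OF mono, of "x + e * y" "x' + e * y'"] monoD[OF mono, of "x' + e * y'" "x + e * y"]
      by (cases "x + e * y \<le> x' + e * y'") (auto intro: mult_nonneg_nonneg mult_nonpos_nonpos)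
  qed
  also have "\<dots> = integral {-1..1} (\<lambda>e. (a (x + e * y) - a (x' + e * y')) * (x - x') + (e * a (x + e * y) - e * a (x' + e * y')) * (y - y'))"
    by (rule integral_cong) (simp add: algebra_simps)
  also have "\<dots> = (2 * avg0 a x y - 2 * avg0 a x' y') * (x - x') + (2 * avg1 a x y - 2 * avg1 a x' y') * (y - y')"
    by (intro integral_unique has_integral_add has_integral_mult_left has_integral_diff has_integral_avg)
  finally show ?thesis by (simp add: algebra_simps)
qed

text \<open>In the inner product with \<open>z - w\<close> the identity contributes the full square
  and the gradient a nonnegative amount; Cauchy-Schwarz finishes.\<close>

lemma ext_map_expansive: "cmod (z - w) \<le> cmod (ext_map a z - ext_map a w)"
proof (cases "z = w")
  case False
  have "(ext_map a z - ext_map a w) \<bullet> (z - w) = (z - w) \<bullet> (z - w) +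
     ((avg0 a (Re z) (Im z) - avg0 a (Re w) (Im w)) * (Re z - Re w) + (avg1 a (Re z) (Im z) - avg1 a (Re w) (Im w)) * (Im z - Im w))"
    by (simp add: ext_map_def inner_complex_def algebra_simps)
  then have "(z - w) \<bullet> (z - w) \<le> (ext_map a z - ext_map a w) \<bullet> (z - w)"
    using avg_monotone by simp
  also have "\<dots> \<le> cmod (ext_map a z - ext_map a w) * cmod (z - w)"
    by (rule norm_cauchy_schwarz)
  finally have "cmod (z - w) * cmod (z - w) \<le> cmod (ext_map a z - ext_map a w) * cmod (z - w)"
    by (simp add: dot_square_norm power2_eq_square)
  then show ?thesis using False by (auto dest: mult_right_le_imp_le)
qed simp

lemma inj_ext_map: "inj (ext_map a)"
proof (rule injI)
  show "z = w" if "ext_map a z = ext_map a w" for z w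
    using ext_map_expansive[of z w] that by simp
qed

text \<open>The range is open by invariance of domain, and closed because an expansive map pulls
  Cauchy sequences back to Cauchy sequences; the plane is connected.\<close>

lemma surj_ext_map: "surj (ext_map a)"
proof -
  have "open (range (ext_map a))"
    by (rule invariance_of_domain) (auto intro: continuous_ext_map inj_ext_map)
  moreover have "closed (range (ext_map a))"
    unfolding closed_sequential_limits
  proof (intro allI impI, elim conjE)
    fix u l assume u: "\<forall>n. u n \<in> range (ext_map a)" "u \<longlonglongrightarrow> l"
    then have "\<forall>n. \<exists>x. u n = ext_map a x" by auto
    then obtain v where v: "\<And>n. u n = ext_map a (v n)" by metis
    have "Cauchy v"
      unfolding Cauchy_def
    proof (intro allI impI)
      fix e :: real assume "e > 0"
      then obtain M where "\<And>m n. m \<ge> M \<Longrightarrow> n \<ge> M \<Longrightarrow> dist (u m) (u n) < e"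
        using LIMSEQ_imp_Cauchy[OF u(2)] unfolding Cauchy_def by blast
      then show "\<exists>M. \<forall>m\<ge>M. \<forall>n\<ge>M. dist (v m) (v n) < e"
        using le_less_trans[OF ext_map_expansive] unfolding v dist_norm by blast
    qed
    then obtain x where "v \<longlonglongrightarrow> x" using Cauchy_convergent convergent_def by blast
    then have "(\<lambda>n. ext_map a (v n)) \<longlonglongrightarrow> ext_map a x"
      by (rule continuous_on_tendsto_compose[OF continuous_ext_map]) auto
    moreover have "u = (\<lambda>n. ext_map a (v n))" using v by auto
    ultimately have "l = ext_map a x" using u(2) LIMSEQ_unique by blast
    then show "l \<in> range (ext_map a)" by simp
  qed
  ultimately show ?thesis
    using connected_clopen[THEN iffD1, OF connected_UNIV, rule_format, of "range (ext_map a)"] by simp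
qed

lemma inv_ext_map_lipschitz: "cmod (inv (ext_map a) z - inv (ext_map a) w) \<le> cmod (z - w)"
  using ext_map_expansive[of "inv (ext_map a) z" "inv (ext_map a) w"] surj_ext_map by (simp add: surj_f_inv_f)

lemma continuous_inv_ext_map: "continuous_on UNIV (inv (ext_map a))"
proof (rule lipschitz_on_continuous_on[of 1], rule lipschitz_onI)
  show "dist (inv (ext_map a) x) (inv (ext_map a) y) \<le> 1 * dist x y" for x y
    using inv_ext_map_lipschitz by (simp add: dist_norm)
qed simp

text \<open>One period comes from the identity and one from \<open>avg0\<close>; \<open>avg1\<close>
  does not change since \<open>e\<close> has mean zero on [-1, 1]. The doubled period is the same
  for both factors of the extension and cancels there.\<close>

lemma ext_map_shift: "ext_map a (z + of_real (2 * pi)) = ext_map a z + of_real (4 * pi)"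
proof -
  have i: "((\<lambda>e. e) has_integral 0) {-1..1::real}" 
    using ident_has_integral[of "-1" "1::real"] by simp
  have "a (Re z + 2 * pi + e * y) = a (Re z + e * y) + 2 * pi" for e y
    using per[of "Re z + e * y"] by (simp add: algebra_simps)
  moreover have "((\<lambda>e. a (x + e * y) + 2 * pi) has_integral 2 * avg0 a x y + (1 - (-1)) *\<^sub>R (2 * pi)) {-1..1}" for x y
    using has_integral_add[OF has_integral_avg(1) has_integral_const_real[of "2 * pi" "-1" 1]] by simp
  moreover have "((\<lambda>e. e * a (x + e * y) + e * (2 * pi)) has_integral 2 * avg1 a x y + 0 * (2 * pi)) {-1..1}" for x y
    by (intro has_integral_add has_integral_avg has_integral_mult_left i)
  ultimately have
    "((\<lambda>e. a (Re z + 2 * pi + e * Im z)) has_integral 2 * avg0 a (Re z) (Im z) + 4 * pi) {-1..1}"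
    "((\<lambda>e. e * a (Re z + 2 * pi + e * Im z)) has_integral 2 * avg1 a (Re z) (Im z)) {-1..1}"
    by (simp_all add: distrib_left)
  from has_integral_unique[OF has_integral_avg(1) this(1)] has_integral_unique[OF has_integral_avg(2) this(2)]
  have "avg0 a (Re z + 2 * pi) (Im z) = avg0 a (Re z) (Im z) + 2 * pi"
     "avg1 a (Re z + 2 * pi) (Im z) = avg1 a (Re z) (Im z)" by simp_all
  then show ?thesis by (simp add: ext_map_def complex_eq_iff)
qed

lemma ext_map_real: "ext_map a (of_real x) = of_real (x + a x)"
proof -
  have "((\<lambda>e. e) has_integral 0) {-1..1::real}" 
    using ident_has_integral[of "-1" "1::real"] by simp
  then show ?thesis
    by (simp add: ext_map_def avg0_def avg1_def complex_eq_iff integral_unique)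
qed

text \<open>Monotonicity between \<open>(x, y)\<close> and \<open>(x, 0)\<close>, where
  \<open>avg1\<close> vanishes. This is why \<open>ext_map\<close> preserves both
  half-planes.\<close>

lemma avg1_sgn: "avg1 a x y * y \<ge> 0"
  using avg_monotone[of x y x 0] ext_map_real[of x] by (simp add: ext_map_def complex_eq_iff)

lemma Im_ext_map_pos: "Im z > 0 \<Longrightarrow> Im (ext_map a z) > 0"
  using avg1_sgn[of "Re z" "Im z"] by (simp add: ext_map_def zero_le_mult_iff)

lemma Im_ext_map_neg: "Im z < 0 \<Longrightarrow> Im (ext_map a z) < 0"
  using avg1_sgn[of "Re z" "Im z"] by (simp add: ext_map_def zero_le_mult_iff)

lemma Im_ext_map_0: "Im z = 0 \<Longrightarrow> Im (ext_map a z) = 0"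
proof -
  assume "Im z = 0"
  then have "z = of_real (Re z)" by (simp add: complex_eq_iff)
  then have "ext_map a z = of_real (Re z + a (Re z))" using ext_map_real[of "Re z"] by simp
  then show "Im (ext_map a z) = 0" by simp
qed

lemma shift_int: "a (x + 2 * pi * of_int n) = a x + 2 * pi * of_int n"
  using int_translate[of a "2 * pi" "2 * pi" x n] per by (simp add: mult.commute)

text \<open>\<open>a\<close> minus the identity has period \<open>2 * pi\<close>, so it is enough to
  look at the representative \<open>d\<close> in [0, 2 pi], where \<open>a\<close> lies between
  \<open>a 0\<close> and \<open>a 0 + 2 * pi\<close>.\<close>

lemma ex_bound: "\<exists>M. \<forall>x. \<bar>a x - x\<bar> \<le> M"
proof -
  have "\<bar>a x - x\<bar> \<le> \<bar>a 0\<bar> + 2 * pi" for x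
  proof -
    define n where "n = \<lfloor>x / (2 * pi)\<rfloor>"
    define d where "d = x - 2 * pi * of_int n"
    have "of_int n \<le> x / (2 * pi)" "x / (2 * pi) < of_int n + 1"
      unfolding n_def by linarith+
    then have d: "0 \<le> d" "d \<le> 2 * pi"
      unfolding d_def by (auto simp: field_simps)
    have "a x - x = a d - d"
      using shift_int[of d n] by (simp add: d_def)
    moreover have "a 0 \<le> a d" "a d \<le> a 0 + 2 * pi"
      using monoD[OF mono d(1)] monoD[OF mono d(2)] per[of 0] by auto
    ultimately show ?thesis using d by linarith
  qed
  then show ?thesis by blast
qed

text \<open>\<open>y / 3\<close> is \<open>avg1\<close> of the identity, that is, half the integral
  of \<open>e * (x + e * y)\<close>, and \<open>a\<close> stays within \<open>M\<close> of the
  identity. So for every lift the imaginary part of \<open>ext_map\<close> grows like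
  \<open>4/3 * y\<close>.\<close>

lemma avg1_approx:
  assumes "\<And>x. \<bar>a x - x\<bar> \<le> M"
  shows "\<bar>avg1 a x y - y / 3\<bar> \<le> M"
proof -
  have "((\<lambda>e. e * x + e\<^sup>2 * y) has_integral (1\<^sup>2 / 2 * x + 1^3 / 3 * y - ((-1)\<^sup>2 / 2 * x + (-1)^3 / 3 * y))) {-1..1}"
    by (rule fundamental_theorem_of_calculus)
       (auto intro!: derivative_eq_intros simp: has_real_derivative_iff_has_vector_derivative[symmetric] power2_eq_square)
  then have i: "((\<lambda>e. e * (x + e * y)) has_integral 2 * y / 3) {-1..1}"
    by (simp add: algebra_simps power2_eq_square)
  have "avg1 a x y - y / 3 = integral {-1..1} (\<lambda>e. e * a (x + e * y) - e * (x + e * y)) / 2"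
    using integral_diff[OF integrable_a(2) has_integral_integrable[OF i], of x y] integral_unique[OF i]
    by (simp add: avg1_def)
  moreover have "norm (integral {-1..1} (\<lambda>e. e * a (x + e * y) - e * (x + e * y))) \<le> M * (1 - (-1))"
  proof (rule integral_bound)
    show "continuous_on {-1..1} (\<lambda>e. e * a (x + e * y) - e * (x + e * y))"
      by (intro continuous_intros)
    fix e :: real assume e: "e \<in> {-1..1}"
    have "norm (e * a (x + e * y) - e * (x + e * y)) = \<bar>e\<bar> * \<bar>a (x + e * y) - (x + e * y)\<bar>"
      by (simp add: abs_mult[symmetric] right_diff_distrib)
    also have "\<dots> \<le> 1 * M"
      using e assms by (intro mult_mono) auto
    finally show "norm (e * a (x + e * y) - e * (x + e * y)) \<le> M" by simp
  qed simp
  ultimately show ?thesis by simp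
qed

end

section \<open>Derivative of the gradient map in the upper half-plane\<close>

lemma has_derivative_directional:
  fixes f :: "'a::real_normed_vector \<Rightarrow> 'b::real_normed_vector"
  assumes "(f has_derivative D) (at z)"
  shows "((\<lambda>t. (f (z + t *\<^sub>R v) - f z) /\<^sub>R t) \<longlongrightarrow> D v) (at 0)"
proof -
  interpret D: bounded_linear D using assms by (rule has_derivative_bounded_linear)
  have "((\<lambda>t. z + t *\<^sub>R v) has_derivative (\<lambda>t. t *\<^sub>R v)) (at 0)"
    by (auto intro!: derivative_eq_intros)
  from has_derivative_compose[OF this, of f D] assms
  have "((\<lambda>t. f (z + t *\<^sub>R v)) has_derivative (\<lambda>t. D (t *\<^sub>R v))) (at 0)"
    by simp
  then have "((\<lambda>t. norm (f (z + t *\<^sub>R v) - f z - t *\<^sub>R D v) / norm t) \<longlongrightarrow> 0) (at 0)"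
    by (simp add: has_derivative_at D.scaleR)
  moreover have "norm (f (z + t *\<^sub>R v) - f z - t *\<^sub>R D v) / norm t = norm ((f (z + t *\<^sub>R v) - f z) /\<^sub>R t - D v)"
    if "t \<noteq> 0" for t :: real
  proof -
    have "f (z + t *\<^sub>R v) - f z - t *\<^sub>R D v = t *\<^sub>R ((f (z + t *\<^sub>R v) - f z) /\<^sub>R t - D v)"
      using that by (simp add: scaleR_diff_right)
    then show ?thesis using that by simp
  qed
  then have "\<forall>\<^sub>F t in at 0. norm (f (z + t *\<^sub>R v) - f z - t *\<^sub>R D v) / norm t = norm ((f (z + t *\<^sub>R v) - f z) /\<^sub>R t - D v)"
    by (auto simp: eventually_at_filter)
  ultimately have "((\<lambda>t. norm ((f (z + t *\<^sub>R v) - f z) /\<^sub>R t - D v)) \<longlongrightarrow> 0) (at 0)"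
    by (rule Lim_transform_eventually)
  then show ?thesis
    by (simp add: tendsto_norm_zero_iff LIM_zero_iff)
qed

text \<open>This symmetric quotient is the \<open>x\<close>-derivative of \<open>avg0\<close>. It
  dominates the whole Hessian of the convex potential and is later compared with the Douglas
  quotient.\<close>

definition slope :: "(real \<Rightarrow> real) \<Rightarrow> real \<Rightarrow> real \<Rightarrow> real" where
  "slope a x y = (a (x + y) - a (x - y)) / (2 * y)"

context circle_lift
begin

lemma slope_nonneg: "y > 0 \<Longrightarrow> slope a x y \<ge> 0"
  using monoD[OF mono, of "x - y" "x + y"] by (simp add: slope_def)

lemma ex_primitive:
  assumes "continuous_on UNIV f"
  shows "\<exists>G. \<forall>x. (G has_real_derivative f x) (at x)"
proof -
  have "\<exists>G. \<forall>x :: real. -\<infinity> < ereal x \<longrightarrow> ereal x < \<infinity> \<longrightarrow> (G has_vector_derivative f x) (at x)"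
    by (rule einterval_antiderivative) (use assms in \<open>auto simp: continuous_on_eq_continuous_at\<close>)
  then show ?thesis by (simp add: has_real_derivative_iff_has_vector_derivative)
qed

text \<open>\<open>a\<close> need not be differentiable, but for \<open>y > 0\<close> both averages
  are explicit in its first and second primitives \<open>G\<close> and \<open>K\<close>, hence
  differentiable. The upper bound estimates the Hessian entries by \<open>slope\<close>; the lower
  bound is expansiveness in the limit.\<close>

lemma ext_map_has_derivative:
  assumes y: "Im z > 0"
  shows "\<exists>D. (ext_map a has_derivative D) (at z) \<and>
    (\<forall>v. cmod (D v) \<le> (1 + 4 * slope a (Re z) (Im z)) * cmod v) \<and> (\<forall>v. cmod v \<le> cmod (D v))"
proof -
  obtain G where G: "\<And>x. (G has_real_derivative a x) (at x)"
    using ex_primitive[OF cont] by blast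
  then have "continuous_on UNIV G"
    by (meson DERIV_isCont continuous_at_imp_continuous_on)
  from ex_primitive[OF this] obtain K where K: "\<And>x. (K has_real_derivative G x) (at x)"
    by blast
  have avg0: "avg0 a x y = (G (x + y) - G (x - y)) / (2 * y)" if "y > 0" for x y
  proof -
    have "((\<lambda>e. a (x + e * y)) has_integral (G (x + 1 * y) / y - G (x + (-1) * y) / y)) {-1..1}"
    proof (rule fundamental_theorem_of_calculus)
      fix e :: real
      have "((\<lambda>e. G (x + e * y)) has_real_derivative a (x + e * y) * y) (at e within {-1..1})"
        by (rule DERIV_chain2[OF G]) (auto intro!: derivative_eq_intros)
      then show "((\<lambda>e. G (x + e * y) / y) has_vector_derivative a (x + e * y)) (at e within {-1..1})"
        using that by (auto intro!: derivative_eq_intros simp: has_real_derivative_iff_has_vector_derivative[symmetric])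
    qed simp
    from integral_unique[OF this] show ?thesis
      using that by (simp add: avg0_def field_simps)
  qed
  have avg1: "avg1 a x y = (G (x + y) + G (x - y)) / (2 * y) - (K (x + y) - K (x - y)) / (2 * y\<^sup>2)" if "y > 0" for x y
  proof -
    have "((\<lambda>e. e * a (x + e * y)) has_integral ((1 * G (x + 1 * y) / y - K (x + 1 * y) / y\<^sup>2) - ((-1) * G (x + (-1) * y) / y - K (x + (-1) * y) / y\<^sup>2))) {-1..1}"
    proof (rule fundamental_theorem_of_calculus)
      fix e :: real
      have "((\<lambda>e. G (x + e * y)) has_real_derivative a (x + e * y) * y) (at e within {-1..1})"
           "((\<lambda>e. K (x + e * y)) has_real_derivative G (x + e * y) * y) (at e within {-1..1})"
        by (rule DERIV_chain2[OF G] DERIV_chain2[OF K]; auto intro!: derivative_eq_intros)+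
      then show "((\<lambda>e. e * G (x + e * y) / y - K (x + e * y) / y\<^sup>2) has_vector_derivative e * a (x + e * y)) (at e within {-1..1})"
        using that by (auto intro!: derivative_eq_intros simp: has_real_derivative_iff_has_vector_derivative[symmetric] power2_eq_square field_simps)
    qed simp
    from integral_unique[OF this] show ?thesis
      by (simp add: avg1_def add_divide_distrib diff_divide_distrib)
  qed
  \<comment> \<open>A single common denominator, so that the quotient rule is applied once.\<close>
  have avg1': "avg1 a x y = (y * (G (x + y) + G (x - y)) - (K (x + y) - K (x - y))) / (2 * (y * y))" if "y > 0" for x y
    unfolding avg1[OF that] using that by (simp add: field_simps power2_eq_square)
  define x y where "x = Re z" and "y = Im z"
  have y0: "y > 0" using y by (simp add: y_def)
  \<comment> \<open>\<open>p\<close>, \<open>M\<close>, \<open>N\<close> are the entries of the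
    symmetric Hessian: \<open>M\<close> is both the \<open>y\<close>-derivative of
    \<open>avg0\<close> and the \<open>x\<close>-derivative of \<open>avg1\<close>.\<close>
  define p where "p = slope a x y"
  define M where "M = (a (x + y) + a (x - y)) / (2 * y) - avg0 a x y / y"
  define N where "N = p - 2 * avg1 a x y / y"
  have dG: "((\<lambda>z. G (Re z + Im z)) has_derivative (\<lambda>v. (Re v + Im v) * a (x + y))) (at z)"
    "((\<lambda>z. G (Re z - Im z)) has_derivative (\<lambda>v. (Re v - Im v) * a (x - y))) (at z)"
    "((\<lambda>z. K (Re z + Im z)) has_derivative (\<lambda>v. (Re v + Im v) * G (x + y))) (at z)"
    "((\<lambda>z. K (Re z - Im z)) has_derivative (\<lambda>v. (Re v - Im v) * G (x - y))) (at z)"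
    unfolding x_def y_def
    by (rule DERIV_compose_FDERIV[OF G] DERIV_compose_FDERIV[OF K]; auto intro!: derivative_eq_intros)+
  have "((\<lambda>z. (G (Re z + Im z) - G (Re z - Im z)) / (2 * Im z)) has_derivative (\<lambda>v. p * Re v + M * Im v)) (at z)"
    by (rule has_derivative_eq_rhs, rule has_derivative_divide'[OF has_derivative_diff[OF dG(1,2)] has_derivative_mult_right[OF has_derivative_Im[OF has_derivative_ident]]])
       (use y0 in \<open>auto simp: p_def M_def slope_def avg0 fun_eq_iff x_def[symmetric] y_def[symmetric] field_simps\<close>)
  then have d0: "((\<lambda>z. avg0 a (Re z) (Im z)) has_derivative (\<lambda>v. p * Re v + M * Im v)) (at z)"
    by (rule has_derivative_transform_within_open[where s="{z. Im z > 0}"])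
       (use y avg0 in \<open>auto simp: open_halfspace_Im_gt\<close>)
  have "((\<lambda>z. (Im z * (G (Re z + Im z) + G (Re z - Im z)) - (K (Re z + Im z) - K (Re z - Im z))) / (2 * (Im z * Im z)))
      has_derivative (\<lambda>v. M * Re v + N * Im v)) (at z)"
    by (rule has_derivative_eq_rhs, rule has_derivative_divide'[OF has_derivative_diff[OF has_derivative_mult[OF has_derivative_Im[OF has_derivative_ident] has_derivative_add[OF dG(1,2)]] has_derivative_diff[OF dG(3,4)]]
         has_derivative_mult_right[OF has_derivative_mult[OF has_derivative_Im[OF has_derivative_ident] has_derivative_Im[OF has_derivative_ident]]]])
       (use y0 in \<open>auto simp: p_def M_def N_def slope_def avg0 avg1 fun_eq_iff x_def[symmetric] y_def[symmetric] field_simps power2_eq_square\<close>)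
  then have d1: "((\<lambda>z. avg1 a (Re z) (Im z)) has_derivative (\<lambda>v. M * Re v + N * Im v)) (at z)"
    by (rule has_derivative_transform_within_open[where s="{z. Im z > 0}"])
       (use y avg1' in \<open>auto simp: open_halfspace_Im_gt\<close>)
  define D where "D v = v + Complex (p * Re v + M * Im v) (M * Re v + N * Im v)" for v
  have D: "(ext_map a has_derivative D) (at z)"
    unfolding ext_map_def[abs_def] D_def[abs_def] Complex_eq
    by (intro has_derivative_add has_derivative_ident has_derivative_mult_right has_derivative_of_real d0 d1)
  have p0: "p \<ge> 0" using slope_nonneg[OF y0] by (simp add: p_def)
  have am: "a (x - y) \<le> a (x + e * y)" "a (x + e * y) \<le> a (x + y)" if "e \<in> {-1..1}" for e
    using that y0 mult_right_mono[of "-1" e y] mult_right_mono[of e 1 y] by (auto intro!: monoD[OF mono])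
  have b0: "2 * a (x - y) \<le> 2 * avg0 a x y" "2 * avg0 a x y \<le> 2 * a (x + y)"
    using has_integral_le[OF has_integral_const_real[of "a (x - y)" "-1" 1] has_integral_avg(1)[of x y]]
      has_integral_le[OF has_integral_avg(1)[of x y] has_integral_const_real[of "a (x + y)" "-1" 1]] am
    by simp_all
  have "\<bar>(a (x + y) + a (x - y)) / 2 - avg0 a x y\<bar> \<le> (a (x + y) - a (x - y)) / 2"
    using b0 by (intro abs_leI) (simp_all add: field_simps)
  then have "\<bar>(a (x + y) + a (x - y)) / 2 - avg0 a x y\<bar> / y \<le> (a (x + y) - a (x - y)) / 2 / y"
    using y0 by (intro divide_right_mono) auto
  moreover have "M = ((a (x + y) + a (x - y)) / 2 - avg0 a x y) / y"
    by (simp add: M_def diff_divide_distrib)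
  ultimately have "\<bar>M\<bar> \<le> p"
    using y0 by (simp add: p_def slope_def)
  moreover have "\<bar>N\<bar> \<le> p"
  proof -
    have "0 \<le> avg1 a x y" using avg1_sgn[of x y] y0 by (simp add: zero_le_mult_iff)
    moreover have "2 * avg1 a x y \<le> 2 * ((a (x + y) - a (x - y)) / 2)"
    proof -
      \<comment> \<open>Midpoint and half-oscillation of \<open>a\<close> between
        \<open>x - y\<close> and \<open>x + y\<close>. The part \<open>e * m\<close> integrates to
        zero, so comparison with \<open>e * m + r\<close> gives \<open>avg1 <= r = p * y\<close>,
        and \<open>N = p - 2 * avg1 / y\<close> stays between \<open>- p\<close> and
        \<open>p\<close>.\<close>
      define m r where "m = (a (x + y) + a (x - y)) / 2" and "r = (a (x + y) - a (x - y)) / 2"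
      have i: "((\<lambda>e. e * m + r) has_integral 2 * r) {-1..1}"
        using has_integral_add[OF has_integral_mult_left[OF ident_has_integral[of "-1" "1::real"], of m] has_integral_const_real[of r "-1" 1]]
        by simp
      have "e * a (x + e * y) \<le> e * m + r" if e: "e \<in> {-1..1}" for e
      proof -
        have "\<bar>a (x + e * y) - m\<bar> \<le> r"
          using am[OF e] by (intro abs_leI) (simp_all add: m_def r_def field_simps)
        then have "\<bar>e\<bar> * \<bar>a (x + e * y) - m\<bar> \<le> 1 * r"
          using e by (intro mult_mono) auto
        then have "e * (a (x + e * y) - m) \<le> r"
          by (simp add: abs_mult[symmetric] abs_le_iff)
        then show ?thesis by (simp add: right_diff_distrib)
      qed
      from has_integral_le[OF has_integral_avg(2) i this] show ?thesis by (simp add: r_def)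
    qed
    moreover have "p * y = (a (x + y) - a (x - y)) / 2" using y0 by (simp add: p_def slope_def)
    ultimately have "0 \<le> avg1 a x y" "avg1 a x y \<le> p * y" by auto
    then show ?thesis using y0 by (auto simp: N_def abs_le_iff field_simps)
  qed
  ultimately have MN: "\<bar>M\<bar> \<le> p" "\<bar>N\<bar> \<le> p" by auto
  \<comment> \<open>Each of the two components of the Hessian part is at most
    \<open>2 * p * cmod v\<close>; hence the constant 4.\<close>
  have up: "cmod (D v) \<le> (1 + 4 * p) * cmod v" for v
  proof -
    have r: "\<bar>Re v\<bar> \<le> cmod v" "\<bar>Im v\<bar> \<le> cmod v" by (rule abs_Re_le_cmod abs_Im_le_cmod)+
    have "\<bar>p * Re v + M * Im v\<bar> \<le> p * cmod v + p * cmod v"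
      using r MN p0 by (intro order_trans[OF abs_triangle_ineq] add_mono) (auto simp: abs_mult intro!: mult_mono)
    moreover have "\<bar>M * Re v + N * Im v\<bar> \<le> p * cmod v + p * cmod v"
      using r MN p0 by (intro order_trans[OF abs_triangle_ineq] add_mono) (auto simp: abs_mult intro!: mult_mono)
    moreover have "cmod (D v) \<le> cmod v + cmod (Complex (p * Re v + M * Im v) (M * Re v + N * Im v))"
      unfolding D_def by (rule norm_triangle_ineq)
    moreover have "cmod (Complex (p * Re v + M * Im v) (M * Re v + N * Im v)) \<le> \<bar>p * Re v + M * Im v\<bar> + \<bar>M * Re v + N * Im v\<bar>"
      using cmod_le[of "Complex (p * Re v + M * Im v) (M * Re v + N * Im v)"] by simp
    ultimately show ?thesis by (simp add: algebra_simps)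
  qed
  have low: "cmod v \<le> cmod (D v)" for v
  proof (rule tendsto_lowerbound)
    show "((\<lambda>t. norm ((ext_map a (z + t *\<^sub>R v) - ext_map a z) /\<^sub>R t)) \<longlongrightarrow> cmod (D v)) (at 0)"
      by (intro tendsto_norm has_derivative_directional D)
    have "cmod v \<le> norm ((ext_map a (z + t *\<^sub>R v) - ext_map a z) /\<^sub>R t)" if "t \<noteq> 0" for t
    proof -
      have "norm ((ext_map a (z + t *\<^sub>R v) - ext_map a z) /\<^sub>R t) = cmod (ext_map a (z + t *\<^sub>R v) - ext_map a z) / \<bar>t\<bar>"
        by (simp only: norm_scaleR abs_inverse divide_inverse mult.commute)
      then show ?thesis
        using ext_map_expansive[of "z + t *\<^sub>R v" z] that by (simp add: pos_le_divide_eq mult.commute)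
    qed
    then show "\<forall>\<^sub>F t in at 0. cmod v \<le> norm ((ext_map a (z + t *\<^sub>R v) - ext_map a z) /\<^sub>R t)"
      by (auto simp: eventually_at_filter)
  qed simp
  show ?thesis
    using D up low unfolding p_def x_def y_def by blast
qed

end

text \<open>Handles both orientations: for \<open>s = -1\<close> the boundary map reverses the orientation.\<close>
definition link :: "real \<Rightarrow> complex \<Rightarrow> complex" where
  "link s z = Complex (s * Re z) (Im z)"

section \<open>Composition of one gradient map with the inverse of the other\<close>

definition half_map :: "(real \<Rightarrow> real) \<Rightarrow> (real \<Rightarrow> real) \<Rightarrow> real \<Rightarrow> complex \<Rightarrow> complex" where
  "half_map a b s z = inv (ext_map b) (link s (ext_map a z))"

text \<open>The circle map lifts to \<open>s * a\<close> and its inverse to \<open>s * b\<close>.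
  Taking the sign out keeps \<open>a\<close> and \<open>b\<close> increasing; \<open>ba\<close> and
  \<open>ab\<close> say that \<open>s * a\<close> and \<open>s * b\<close> are inverse to each
  other.\<close>

locale lift_pair = A: circle_lift a + B: circle_lift b for a b +
  fixes s :: real
  assumes s: "s = 1 \<or> s = -1" and ba: "b (s * a x) = s * x" and ab: "a (s * b x) = s * x"
begin

lemma swap: "lift_pair b a s"
  by unfold_locales (use s ba ab in auto)

lemma link_link: "link s (link s z) = z"
  using s by (auto simp: link_def complex_eq_iff)

lemma link_norm: "cmod (link s z) = cmod z"
  using s by (auto simp: link_def cmod_def)

lemma continuous_link: "continuous_on S (link s)"
  unfolding link_def Complex_eq by (intro continuous_intros)

lemma link_has_derivative: "(link s has_derivative link s) (at z)"
proof -
  have "bounded_linear (link s)"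
    by (rule bounded_linear_intro[of _ 1]) (auto simp: link_norm, auto simp: link_def complex_eq_iff algebra_simps)
  then show ?thesis by (rule bounded_linear_imp_has_derivative)
qed

lemma ext_half: "ext_map b (half_map a b s z) = link s (ext_map a z)"
  using B.surj_ext_map by (simp add: half_map_def surj_f_inv_f)

text \<open>\<open>ext_map b\<close> is injective, so identities for \<open>half_map\<close> can be
  checked after applying it; this avoids computing with the inverse function.\<close>

lemma half_mapI: "ext_map b w = link s (ext_map a z) \<Longrightarrow> half_map a b s z = w"
  using B.inj_ext_map by (metis half_map_def inv_f_f)

lemma continuous_half: "continuous_on UNIV (half_map a b s)"
  unfolding half_map_def[abs_def]
  by (intro continuous_on_compose2[OF B.continuous_inv_ext_map] continuous_on_compose2[OF continuous_link[of UNIV]] A.continuous_ext_map subset_UNIV)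

lemma half_real: "half_map a b s (of_real x) = of_real (s * a x)"
proof (rule half_mapI)
  have "ext_map b (of_real (s * a x)) = of_real (s * a x + s * x)"
    by (simp only: B.ext_map_real ba)
  then show "ext_map b (of_real (s * a x)) = link s (ext_map a (of_real x))"
    by (simp only: A.ext_map_real) (simp add: link_def complex_eq_iff algebra_simps)
qed

lemma half_shift: "half_map a b s (z + of_real (2 * pi)) = half_map a b s z + of_real (2 * pi * s)"
proof (rule half_mapI)
  have "ext_map b (w + of_real (2 * pi * s)) = ext_map b w + of_real (4 * pi * s)" for w
    using s B.ext_map_shift[of w] B.ext_map_shift[of "w - of_real (2 * pi)"] by auto
  then show "ext_map b (half_map a b s z + of_real (2 * pi * s)) = link s (ext_map a (z + of_real (2 * pi)))"
    by (simp only: ext_half A.ext_map_shift) (simp add: link_def complex_eq_iff algebra_simps)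
qed

lemma half_Im: "Im z \<ge> 0 \<Longrightarrow> Im (half_map a b s z) \<ge> 0"
proof (rule ccontr)
  assume z: "Im z \<ge> 0" and "\<not> Im (half_map a b s z) \<ge> 0"
  then have "Im (link s (ext_map a z)) < 0"
    using B.Im_ext_map_neg[of "half_map a b s z"] ext_half by simp
  moreover have "Im (ext_map a z) \<ge> 0"
    using A.Im_ext_map_pos[of z] A.Im_ext_map_0[of z] z by (cases "Im z = 0") auto
  ultimately show False by (simp add: link_def)
qed

text \<open>Both sides of \<open>ext_half\<close> have imaginary part 4/3 of that of the point, up
  to the errors of \<open>avg1_approx\<close>; equating them bounds the difference.\<close>

lemma half_Im_approx: "\<exists>M. \<forall>z. \<bar>Im (half_map a b s z) - Im z\<bar> \<le> M"
proof -
  obtain M1 M2 where M: "\<And>x. \<bar>a x - x\<bar> \<le> M1" "\<And>x. \<bar>b x - x\<bar> \<le> M2"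
    using A.ex_bound B.ex_bound by blast
  have "\<bar>Im (half_map a b s z) - Im z\<bar> \<le> M1 + M2" for z
  proof -
    let ?w = "half_map a b s z"
    have "Im ?w + avg1 b (Re ?w) (Im ?w) = Im z + avg1 a (Re z) (Im z)"
      using ext_half[of z] by (simp add: ext_map_def link_def complex_eq_iff)
    with A.avg1_approx[OF M(1), of "Re z" "Im z"] B.avg1_approx[OF M(2), of "Re ?w" "Im ?w"]
    show ?thesis by linarith
  qed
  then show ?thesis by blast
qed

text \<open>\<open>link s\<close> is an involution, so exchanging \<open>a\<close> and
  \<open>b\<close> inverts the relation \<open>ext_half\<close>: the inverse map is of the same
  kind.\<close>

lemma half_half: "half_map b a s (half_map a b s z) = z"
proof -
  interpret S: lift_pair b a s by (rule swap)
  show ?thesis by (rule S.half_mapI) (simp add: ext_half link_link)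
qed

text \<open>The derivative \<open>E\<close> of \<open>ext_map b\<close> never shrinks a vector, so
  it is invertible with inverse of norm at most 1. By the chain rule only the slope of
  \<open>a\<close> enters, however steep \<open>b\<close> may be.\<close>

lemma half_has_derivative:
  assumes z: "Im z > 0"
  shows "\<exists>D. (half_map a b s has_derivative D) (at z) \<and> (\<forall>v. cmod (D v) \<le> (1 + 4 * slope a (Re z) (Im z)) * cmod v)"
proof -
  let ?w = "half_map a b s z"
  obtain D where D: "(ext_map a has_derivative D) (at z)" "\<And>v. cmod (D v) \<le> (1 + 4 * slope a (Re z) (Im z)) * cmod v"
    using A.ext_map_has_derivative[OF z] by blast
  have "Im ?w \<noteq> 0"
  proof
    assume "Im ?w = 0"
    then have "Im (link s (ext_map a z)) = 0" using B.Im_ext_map_0[of ?w] ext_half by simp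
    then show False using A.Im_ext_map_pos[OF z] by (simp add: link_def)
  qed
  then have w: "Im ?w > 0" using half_Im[of z] z by simp
  obtain E where E: "(ext_map b has_derivative E) (at ?w)" "\<And>v. cmod v \<le> cmod (E v)"
    using B.ext_map_has_derivative[OF w] by blast
  interpret E: bounded_linear E using E(1) by (rule has_derivative_bounded_linear)
  have "inj E"
  proof (rule injI)
    show "x = y" if "E x = E y" for x y
      using E(2)[of "x - y"] that by (simp add: E.diff)
  qed
  then have "surj E" by (rule linear_injective_imp_surjective[OF E.linear]) (rule refl)
  have EE: "E (inv E v) = v" "inv E (E v) = v" for v
    using \<open>inj E\<close> \<open>surj E\<close> by (auto simp: surj_f_inv_f)
  have lin: "linear (inv E)"
    by (rule inj_linear_imp_inv_linear[OF E.linear \<open>inj E\<close>])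
  have inv_le: "cmod (inv E v) \<le> cmod v" for v
    using E(2)[of "inv E v"] EE by simp
  have "(inv (ext_map b) has_derivative inv E) (at (link s (ext_map a z)))"
  proof (rule has_derivative_inverse_basic[where f="ext_map b" and f'=E and T=UNIV])
    show "(ext_map b has_derivative E) (at (inv (ext_map b) (link s (ext_map a z))))"
      using E(1) by (simp add: half_map_def)
    show "bounded_linear (inv E)" using lin by (simp add: linear_conv_bounded_linear)
    show "continuous (at (link s (ext_map a z))) (inv (ext_map b))"
      using B.continuous_inv_ext_map by (simp add: continuous_on_eq_continuous_at)
  qed (use EE B.surj_ext_map in \<open>auto simp: surj_f_inv_f\<close>)
  from diff_chain_at[OF diff_chain_at[OF D(1) link_has_derivative] this[folded o_apply[of "link s"]]]
  have "(half_map a b s has_derivative inv E \<circ> (link s \<circ> D)) (at z)"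
    by (simp add: half_map_def[abs_def] o_def)
  moreover have "cmod ((inv E \<circ> (link s \<circ> D)) v) \<le> (1 + 4 * slope a (Re z) (Im z)) * cmod v" for v
    using order_trans[OF inv_le[of "link s (D v)"]] D(2)[of v] by (simp add: link_norm)
  ultimately show ?thesis by blast
qed

end

section \<open>Descent from the half-plane to the disk by the exponential covering\<close>

text \<open>The map induced by \<open>H\<close> under the covering \<open>w = exp (i z)\<close>,
  with the puncture filled in by hand.\<close>

definition disk_map :: "(complex \<Rightarrow> complex) \<Rightarrow> complex \<Rightarrow> complex" where
  "disk_map H w = (if w = 0 then 0 else exp (\<i> * H (- \<i> * Ln w)))"

text \<open>\<open>shift\<close> makes \<open>disk_map H\<close> independent of the branch of the
  logarithm; \<open>Im_approx\<close> controls it at the puncture, where \<open>Im z\<close> tends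
  to infinity.\<close>

locale equivariant =
  fixes H :: "complex \<Rightarrow> complex" and s M :: real
  assumes cont: "continuous_on UNIV H" and s: "s = 1 \<or> s = -1"
    and shift: "H (z + of_real (2 * pi)) = H z + of_real (2 * pi * s)"
    and Im_approx: "\<bar>Im (H z) - Im z\<bar> \<le> M"
begin

lemma shift_int: "H (z + of_real (2 * pi * of_int n)) = H z + of_real (2 * pi * s * of_int n)"
  using int_translate[of H "of_real (2 * pi)" "of_real (2 * pi * s)" z n] shift
  by (simp add: scaleR_conv_of_real mult_ac)

lemma exp_shift: "exp (\<i> * H (z + of_real (2 * pi * of_int n))) = exp (\<i> * H z)"
proof -
  obtain m :: int where m: "s * of_int n = of_int m"
    using s by (metis mult_1 mult_minus1 of_int_minus)
  have r: "2 * pi * s * of_int n = 2 * pi * of_int m"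
    using m by (simp add: mult.assoc)
  show ?thesis
    unfolding exp_eq shift_int r by (rule exI[of _ m]) (simp add: algebra_simps)
qed

lemma disk_map_exp: "disk_map H (exp (\<i> * z)) = exp (\<i> * H z)"
proof -
  have "exp (Ln (exp (\<i> * z))) = exp (\<i> * z)" by simp
  then obtain n :: int where n: "Ln (exp (\<i> * z)) = \<i> * z + of_int (2 * n) * pi * \<i>"
    unfolding exp_eq by blast
  have "- \<i> * Ln (exp (\<i> * z)) = z + of_real (2 * pi * of_int n)"
    unfolding n by (simp add: algebra_simps)
  then show ?thesis by (simp only: disk_map_def exp_not_eq_zero if_False exp_shift)
qed

text \<open>For \<open>w\<close> near \<open>w0\<close> the quotient \<open>w / w0\<close> is near
  1, so \<open>Ln (w / w0) + Ln w0\<close> is a logarithm of \<open>w\<close> that is smooth around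
  \<open>w0\<close>, even when \<open>w0\<close> lies on the cut of \<open>Ln\<close>.\<close>

lemma disk_map_branch:
  assumes "w0 \<noteq> 0" "w \<noteq> 0"
  shows "disk_map H w = exp (\<i> * H (- \<i> * (Ln (w / w0) + Ln w0)))"
  using disk_map_exp[of "- \<i> * (Ln (w / w0) + Ln w0)"] assms by (simp add: exp_add)

lemma disk_map_0 [simp]: "disk_map H 0 = 0"
  by (simp add: disk_map_def)

text \<open>The modulus of \<open>exp (i H)\<close> is \<open>exp (- Im H)\<close>, and
  \<open>Im H\<close> is at least \<open>Im z - M\<close>. This gives continuity at the
  puncture.\<close>

lemma norm_disk_map_le: "cmod (disk_map H w) \<le> exp M * cmod w"
proof (cases "w = 0")
  case False
  let ?z = "- \<i> * Ln w"
  have w: "w = exp (\<i> * ?z)" using False by simp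
  have "cmod (disk_map H w) = exp (- Im (H ?z))"
    using disk_map_exp[of ?z] w by (simp add: norm_exp_eq_Re)
  also have "\<dots> \<le> exp (M + - Im ?z)"
    using Im_approx[of ?z] by (intro exp_le_cancel_iff[THEN iffD2]) linarith
  also have "\<dots> = exp M * cmod w"
    using arg_cong[OF w, of cmod] by (simp add: exp_add norm_exp_eq_Re)
  finally show ?thesis .
qed simp

lemma continuous_disk_map: "continuous_on UNIV (disk_map H)"
proof (intro continuous_at_imp_continuous_on ballI)
  fix w0 :: complex
  show "isCont (disk_map H) w0"
  proof (cases "w0 = 0")
    case True
    have "((\<lambda>w. exp M * cmod w) \<longlongrightarrow> 0) (at 0)"
      by (auto intro!: tendsto_eq_intros)
    then have "(disk_map H \<longlongrightarrow> 0) (at 0)"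
      by (rule Lim_null_comparison[rotated]) (simp add: norm_disk_map_le)
    then show ?thesis using True by (simp add: isCont_def)
  next
    case False
    have "isCont (\<lambda>w. H (- \<i> * (Ln (w / w0) + Ln w0))) w0"
    proof (rule isCont_o2[where g=H])
      show "isCont (\<lambda>w. - \<i> * (Ln (w / w0) + Ln w0)) w0"
        using False by (intro continuous_intros) auto
      show "isCont H (- \<i> * (Ln (w0 / w0) + Ln w0))"
        using cont by (simp add: continuous_on_eq_continuous_at)
    qed
    then have "isCont (\<lambda>w. exp (\<i> * H (- \<i> * (Ln (w / w0) + Ln w0)))) w0"
      by (intro continuous_intros)
    moreover have "\<forall>\<^sub>F w in nhds w0. disk_map H w = exp (\<i> * H (- \<i> * (Ln (w / w0) + Ln w0)))"
      using t1_space_nhds[OF False] disk_map_branch[OF False] by (rule eventually_mono) auto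
    ultimately show ?thesis by (simp add: isCont_cong)
  qed
qed

text \<open>The logarithm contributes \<open>1 / cmod w = exp (Im z)\<close> and the outer
  exponential \<open>exp (- Im (H z))\<close>. By \<open>Im_approx\<close> the product is at most
  \<open>exp M\<close>, so the estimate does not degenerate near the puncture.\<close>

lemma disk_map_has_derivative:
  assumes D: "(H has_derivative D) (at z)" "\<And>v. cmod (D v) \<le> c * cmod v"
  shows "\<exists>D'. (disk_map H has_derivative D') (at (exp (\<i> * z))) \<and> (\<forall>v. cmod (D' v) \<le> exp M * c * cmod v)"
proof -
  let ?w0 = "exp (\<i> * z)"
  let ?L = "\<lambda>w. - \<i> * (Ln (w / ?w0) + \<i> * z)"
  have L: "(?L has_derivative (\<lambda>v. (- \<i> / ?w0) * v)) (at ?w0)"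
  proof -
    have "(?L has_field_derivative (- \<i> / ?w0)) (at ?w0)"
      by (auto intro!: derivative_eq_intros simp: complex_nonpos_Reals_iff)
    then show ?thesis by (simp only: has_field_derivative_def)
  qed
  have "?L ?w0 = z" by simp
  then have "(H has_derivative D) (at (?L ?w0))" using D by simp
  from diff_chain_at[OF L this]
  have "((\<lambda>w. H (?L w)) has_derivative (\<lambda>v. D ((- \<i> / ?w0) * v))) (at ?w0)"
    by (simp add: o_def)
  then have d1: "((\<lambda>w. exp (\<i> * H (?L w))) has_derivative (\<lambda>v. exp (\<i> * H (?L ?w0)) * (\<i> * D ((- \<i> / ?w0) * v)))) (at ?w0)"
    using diff_chain_at[OF has_derivative_mult_right[OF _, of "\<lambda>w. H (?L w)" _ _ \<i>] DERIV_exp[unfolded has_field_derivative_def]]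
    by (simp only: o_def)
  have eq: "exp (\<i> * H (?L w)) = disk_map H w" if "w \<in> - {0}" for w
    using disk_map_exp[of "?L w"] that by (simp add: exp_add)
  have "(disk_map H has_derivative (\<lambda>v. exp (\<i> * H (?L ?w0)) * (\<i> * D ((- \<i> / ?w0) * v)))) (at ?w0)"
    by (rule has_derivative_transform_within_open[OF d1, of "- {0}"]) (use eq in auto)
  moreover have "cmod (exp (\<i> * H (?L ?w0)) * (\<i> * D ((- \<i> / ?w0) * v))) \<le> exp M * c * cmod v" for v
  proof -
    have "c \<ge> 0" using order_trans[OF norm_ge_zero D(2)[of 1]] by simp
    have "cmod (exp (\<i> * H (?L ?w0)) * (\<i> * D ((- \<i> / ?w0) * v))) = exp (- Im (H z)) * cmod (D ((- \<i> / ?w0) * v))"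
      by (simp add: norm_mult norm_exp_eq_Re)
    also have "\<dots> \<le> exp (- Im (H z)) * (c * cmod ((- \<i> / ?w0) * v))"
      by (intro mult_left_mono D(2)) simp
    also have "cmod ((- \<i> / ?w0) * v) = exp (Im z) * cmod v"
      by (simp add: norm_mult norm_divide norm_exp_eq_Re exp_minus field_simps)
    also have "exp (- Im (H z)) * (c * (exp (Im z) * cmod v)) = exp (Im z - Im (H z)) * (c * cmod v)"
      by (simp add: exp_diff exp_minus field_simps)
    also have "\<dots> \<le> exp M * (c * cmod v)"
      using Im_approx[of z] \<open>c \<ge> 0\<close> by (intro mult_right_mono) auto
    finally show ?thesis by (simp add: mult_ac)
  qed
  ultimately show ?thesis by blast
qed

end

lemma disk_map_comp:
  assumes "equivariant H s M" "equivariant K s' M'" "\<And>z. H (K z) = z"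
  shows "disk_map H (disk_map K w) = w"
proof (cases "w = 0")
  case True
  then show ?thesis by (simp add: disk_map_def)
next
  case False
  have "disk_map H (disk_map K (exp (\<i> * z))) = exp (\<i> * z)" for z
    by (simp only: equivariant.disk_map_exp[OF assms(2)] equivariant.disk_map_exp[OF assms(1)] assms(3))
  from this[of "- \<i> * Ln w"] False show ?thesis by simp
qed

section \<open>Polar coordinates\<close>

lemma borel_measurable_Complex [measurable (raw)]:
  assumes [measurable]: "f \<in> borel_measurable M" "g \<in> borel_measurable M"
  shows "(\<lambda>x. Complex (f x) (g x)) \<in> borel_measurable M"
  unfolding Complex_eq by measurable

lemma borel_measurable_cis [measurable (raw)]:
  assumes "f \<in> borel_measurable M"
  shows "(\<lambda>x. cis (f x)) \<in> borel_measurable M"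
  using measurable_compose[OF assms borel_measurable_continuous_onI[of cis]] by (simp add: continuous_on_cis continuous_on_id)

lemma borel_measurable_tan [measurable (raw)]:
  assumes [measurable]: "f \<in> borel_measurable M"
  shows "(\<lambda>x. tan (f x :: real)) \<in> borel_measurable M"
  unfolding tan_def by measurable

lemma lborel_complex: "(lborel :: complex measure) = distr (lborel \<Otimes>\<^sub>M lborel) borel (\<lambda>(a, b). Complex a b)"
proof (rule lborel_eqI)
  fix l u :: complex
  assume lu: "\<And>b. b \<in> Basis \<Longrightarrow> l \<bullet> b \<le> u \<bullet> b"
  have le: "Re l \<le> Re u" "Im l \<le> Im u"
    using lu[of 1] lu[of \<i>] by (auto simp: Basis_complex_def)
  have [measurable]: "(\<lambda>(a, b). Complex a b) \<in> borel_measurable (lborel \<Otimes>\<^sub>M lborel)"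
    unfolding case_prod_beta' by measurable
  have "(\<lambda>(a, b). Complex a b) -` box l u = {Re l<..<Re u} \<times> {Im l<..<Im u}"
    by (auto simp: box_def Basis_complex_def)
  then show "emeasure (distr (lborel \<Otimes>\<^sub>M lborel) borel (\<lambda>(a, b). Complex a b)) (box l u) = (\<Prod>b\<in>Basis. (u - l) \<bullet> b)"
    using le by (simp add: emeasure_distr space_pair_measure lborel.emeasure_pair_measure_Times Basis_complex_def ennreal_mult)
qed simp

lemma nn_integral_lborel_complex:
  assumes [measurable]: "k \<in> borel_measurable borel"
  shows "(\<integral>\<^sup>+w. k w \<partial>lborel) = (\<integral>\<^sup>+a. \<integral>\<^sup>+b. k (Complex a b) \<partial>lborel \<partial>lborel)"
proof -
  show ?thesis
    by (subst lborel_complex, subst nn_integral_distr)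
       (simp_all add: case_prod_beta' lborel.nn_integral_fst[symmetric])
qed

text \<open>Substitution \<open>b = a * tan t\<close> on the compact intervals bounded by
  \<open>arctan (n + 1)\<close>, then monotone convergence on both sides. The shift by 1 keeps even
  the first interval nondegenerate.\<close>

lemma nn_integral_tan:
  fixes k :: "real \<Rightarrow> ennreal"
  assumes [measurable]: "k \<in> borel_measurable borel" and a: "a > 0"
  shows "(\<integral>\<^sup>+b. k b \<partial>lborel)
       = (\<integral>\<^sup>+t\<in>{-pi/2<..<pi/2}. k (a * tan t) * ennreal (a / (cos t)\<^sup>2) \<partial>lborel)"
proof -
  let ?c = "\<lambda>n::nat. arctan (real n + 1)"
  define I where "I n = {- (a * (real n + 1)) .. a * (real n + 1)}" for n :: nat
  have [measurable]: "I n \<in> sets borel" for n by (simp add: I_def)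
  have c: "0 < ?c n" "?c n < pi/2" for n
    using arctan_ubound[of "real n + 1"] by auto
  have cos: "cos t \<noteq> 0" if "t \<in> {- ?c n .. ?c n}" for t n
    using cos_gt_zero_pi[of t] c[of n] that by auto
  have eq: "(\<integral>\<^sup>+b. k b * indicator (I n) b \<partial>lborel)
      = (\<integral>\<^sup>+t\<in>{- ?c n .. ?c n}. k (a * tan t) * ennreal (a / (cos t)\<^sup>2) \<partial>lborel)" for n :: nat
  proof -
    have "continuous_on {- ?c n .. ?c n} (\<lambda>t. a / (cos t)\<^sup>2)"
      using cos by (intro continuous_intros) auto
    moreover have "((\<lambda>t. a * tan t) has_real_derivative a / (cos t)\<^sup>2) (at t)" if "t \<in> {- ?c n .. ?c n}" for t
      using cos[OF that] by (auto intro!: derivative_eq_intros simp: field_simps)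
    ultimately have "(\<integral>\<^sup>+b\<in>{a * tan (- ?c n) .. a * tan (?c n)}. k b \<partial>lborel)
      = (\<integral>\<^sup>+t\<in>{- ?c n .. ?c n}. k (a * tan t) * ennreal (a / (cos t)\<^sup>2) \<partial>lborel)"
      using c[of n] a
      by (intro nn_integral_substitution_aux) auto
    then show ?thesis by (simp add: tan_arctan I_def minus_mult_right del: mult_minus_right)
  qed
  have "(\<integral>\<^sup>+b. k b \<partial>lborel) = (\<integral>\<^sup>+b. (SUP n. k b * indicator (I n) b) \<partial>lborel)"
  proof (rule nn_integral_cong)
    fix b :: real
    obtain n :: nat where n: "\<bar>b\<bar> / a \<le> real n" using real_arch_simple by blast
    then have "\<bar>b\<bar> \<le> a * (real n + 1)" using a by (auto simp: divide_le_eq algebra_simps)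
    then have "b \<in> I n" by (simp add: I_def abs_le_iff)
    then have "k b \<le> k b * indicator (I n) b" by (simp add: indicator_def)
    then have "k b \<le> (SUP n. k b * indicator (I n) b)"
      by (rule SUP_upper2[rotated]) simp
    then show "k b = (SUP n. k b * indicator (I n) b)"
      by (intro antisym SUP_least) (auto split: split_indicator)
  qed
  also have "\<dots> = (SUP n. \<integral>\<^sup>+b. k b * indicator (I n) b \<partial>lborel)"
  proof (rule nn_integral_monotone_convergence_SUP)
    have "I m \<subseteq> I n" if "m \<le> n" for m n
    proof -
      have "a * (real m + 1) \<le> a * (real n + 1)" using a that by simp
      then show ?thesis unfolding I_def by (intro atLeastatMost_subset_iff[THEN iffD2] disjI2) linarith
    qed
    then have mono: "indicator (I m) b \<le> (indicator (I n) b :: ennreal)" if "m \<le> n" for m n :: nat and b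
      using that by (auto split: split_indicator)
    then show "incseq (\<lambda>n b. k b * indicator (I n) b)"
      by (intro incseq_SucI le_funI mult_left_mono mono) simp_all
  qed auto
  also have "\<dots> = (SUP n::nat. \<integral>\<^sup>+t. k (a * tan t) * ennreal (a / (cos t)\<^sup>2) * indicator {- ?c n .. ?c n} t \<partial>lborel)"
    by (simp only: eq)
  also have "\<dots> = (\<integral>\<^sup>+t. (SUP n::nat. k (a * tan t) * ennreal (a / (cos t)\<^sup>2) * indicator {- ?c n .. ?c n} t) \<partial>lborel)"
  proof (rule nn_integral_monotone_convergence_SUP[symmetric])
    have "indicator {- ?c m .. ?c m} b \<le> (indicator {- ?c n .. ?c n} b :: ennreal)" if "m \<le> n" for m n :: nat and b
    proof -
      have "?c m \<le> ?c n" using that by (simp add: arctan_le_iff)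
      then show ?thesis by (auto simp: indicator_def)
    qed
    note mono = this
    show "incseq (\<lambda>(n::nat) t. k (a * tan t) * ennreal (a / (cos t)\<^sup>2) * indicator {- ?c n .. ?c n} t)"
      by (intro incseq_SucI le_funI mult_left_mono mono) simp_all
  qed auto
  also have "\<dots> = (\<integral>\<^sup>+t\<in>{-pi/2<..<pi/2}. k (a * tan t) * ennreal (a / (cos t)\<^sup>2) \<partial>lborel)"
  proof (rule nn_integral_cong)
    fix t :: real
    let ?X = "k (a * tan t) * ennreal (a / (cos t)\<^sup>2)"
    have "?X * indicator {-pi/2<..<pi/2} t \<le> (SUP n. ?X * indicator {- ?c n .. ?c n} t)"
    proof (cases "t \<in> {-pi/2<..<pi/2}")
      case True
      obtain n :: nat where n: "\<bar>tan t\<bar> \<le> real n" using real_arch_simple by blast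
      then have "arctan (- real n - 1) \<le> arctan (tan t)" "arctan (tan t) \<le> ?c n"
        by (auto simp: arctan_le_iff)
      moreover have "arctan (tan t) = t" using True by (intro arctan_tan) auto
      moreover have "arctan (- real n - 1) = - ?c n" using arctan_minus[of "real n + 1"] by simp
      ultimately have "t \<in> {- ?c n .. ?c n}" by simp
      then show ?thesis by (intro SUP_upper2[of n]) (auto simp: indicator_def)
    qed auto
    moreover have "(SUP n. ?X * indicator {- ?c n .. ?c n} t) \<le> ?X * indicator {-pi/2<..<pi/2} t"
    proof (intro SUP_least mult_left_mono indicator_leI)
      show "t \<in> {-pi/2<..<pi/2}" if "t \<in> {- ?c n .. ?c n}" for n
        using that c[of n] by auto
    qed simp
    ultimately show "(SUP n. ?X * indicator {- ?c n .. ?c n} t) = ?X * indicator {-pi/2<..<pi/2} t"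
      by (intro antisym)
  qed
  finally show ?thesis .
qed

lemma lborel_complex_uminus: "(lborel :: complex measure) = distr lborel borel uminus"
proof -
  have "(lborel :: complex measure) = density (distr lborel borel (\<lambda>x. 0 + (-1) *\<^sub>R x)) (\<lambda>_. ennreal (\<bar>-1::real\<bar> ^ DIM(complex)))"
    by (rule lborel_affine) simp
  also have "\<dots> = distr lborel borel uminus"
    by (simp add: density_1)
  finally show ?thesis .
qed
lemma nn_integral_complex_uminus:
  fixes k :: "complex \<Rightarrow> ennreal"
  assumes [measurable]: "k \<in> borel_measurable borel"
  shows "(\<integral>\<^sup>+w. k w \<partial>lborel) = (\<integral>\<^sup>+w. k (- w) \<partial>lborel)"
  by (subst lborel_complex_uminus, subst nn_integral_distr) simp_all
text \<open>Two one-dimensional substitutions: \<open>b = a * tan t\<close> on each vertical line,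
  then, after Tonelli, \<open>a = r * cos t\<close> for each angle. The factors
  \<open>a / (cos t)^2\<close> and \<open>cos t\<close> multiply to the Jacobian
  \<open>r\<close>.\<close>

lemma nn_integral_polar_right:
  assumes [measurable]: "k \<in> borel_measurable borel"
  shows "(\<integral>\<^sup>+w. k w * indicator {w. Re w > 0} w \<partial>lborel)
     = (\<integral>\<^sup>+t. \<integral>\<^sup>+r. k (of_real r * cis t) * ennreal r * indicator {0<..} r * indicator {-pi/2<..<pi/2} t \<partial>lborel \<partial>lborel)"
proof -
  let ?I = "indicator {-pi/2<..<pi/2} :: real \<Rightarrow> ennreal"
  have "(\<integral>\<^sup>+w. k w * indicator {w. Re w > 0} w \<partial>lborel)
      = (\<integral>\<^sup>+a. \<integral>\<^sup>+b. k (Complex a b) * indicator {0<..} a \<partial>lborel \<partial>lborel)"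
    by (subst nn_integral_lborel_complex) (auto intro!: nn_integral_cong simp: indicator_def)
  also have "\<dots> = (\<integral>\<^sup>+a. \<integral>\<^sup>+t. k (Complex a (a * tan t)) * ennreal (a / (cos t)\<^sup>2) * ?I t * indicator {0<..} a \<partial>lborel \<partial>lborel)"
  proof (rule nn_integral_cong)
    fix a :: real
    show "(\<integral>\<^sup>+b. k (Complex a b) * indicator {0<..} a \<partial>lborel) =
       (\<integral>\<^sup>+t. k (Complex a (a * tan t)) * ennreal (a / (cos t)\<^sup>2) * ?I t * indicator {0<..} a \<partial>lborel)"
    proof (cases "a > 0")
      case True
      have "(\<lambda>b. k (Complex a b)) \<in> borel_measurable borel" by measurable
      from nn_integral_tan[OF this True] show ?thesis
        using True by simp
    qed simp
  qed
  also have "\<dots> = (\<integral>\<^sup>+t. \<integral>\<^sup>+a. k (Complex a (a * tan t)) * ennreal (a / (cos t)\<^sup>2) * ?I t * indicator {0<..} a \<partial>lborel \<partial>lborel)"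
    by (rule lborel_pair.Fubini'[symmetric]) simp
  also have "\<dots> = (\<integral>\<^sup>+t. \<integral>\<^sup>+r. k (of_real r * cis t) * ennreal r * indicator {0<..} r * ?I t \<partial>lborel \<partial>lborel)"
  proof (rule nn_integral_cong)
    fix t :: real
    show "(\<integral>\<^sup>+a\<in>{0<..}. k (Complex a (a * tan t)) * ennreal (a / (cos t)\<^sup>2) * ?I t \<partial>lborel)
      = (\<integral>\<^sup>+r. k (of_real r * cis t) * ennreal r * indicator {0<..} r * ?I t \<partial>lborel)"
    proof (cases "t \<in> {-pi/2<..<pi/2}")
      case True
      then have c: "cos t > 0" by (intro cos_gt_zero_pi) auto
      have e: "Complex (r * cos t) (r * cos t * tan t) = of_real r * cis t" for r
        using c by (simp add: complex_eq_iff tan_def)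
      have "(\<integral>\<^sup>+a\<in>{0<..}. k (Complex a (a * tan t)) * ennreal (a / (cos t)\<^sup>2) * ?I t \<partial>lborel)
         = ennreal \<bar>cos t\<bar> * (\<integral>\<^sup>+r. k (Complex (r * cos t) (r * cos t * tan t)) * ennreal (r * cos t / (cos t)\<^sup>2) * ?I t * indicator {0<..} (r * cos t) \<partial>lborel)"
        using c by (subst nn_integral_real_affine[where c="cos t" and t=0]) (simp_all add: mult_ac)
      also have "\<dots> = (\<integral>\<^sup>+r. ennreal (cos t) * (k (of_real r * cis t) * ennreal (r * cos t / (cos t)\<^sup>2) * ?I t * indicator {0<..} (r * cos t)) \<partial>lborel)"
        unfolding e using c by (subst nn_integral_cmult) auto
      also have "\<dots> = (\<integral>\<^sup>+r. k (of_real r * cis t) * ennreal r * indicator {0<..} r * ?I t \<partial>lborel)"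
      proof (rule nn_integral_cong)
        fix r :: real
        have "ennreal (cos t) * ennreal (r * cos t / (cos t)\<^sup>2) = ennreal r" 
          using c by (subst ennreal_mult'[symmetric]) (auto simp: power2_eq_square)
        moreover have "indicator {0<..} (r * cos t) = (indicator {0<..} r :: ennreal)"
          using c by (auto simp: indicator_def zero_less_mult_iff)
        moreover have "ennreal (cos t) * (k (of_real r * cis t) * ennreal (r * cos t / (cos t)\<^sup>2) * ?I t * indicator {0<..} (r * cos t))
          = k (of_real r * cis t) * (ennreal (cos t) * ennreal (r * cos t / (cos t)\<^sup>2)) * indicator {0<..} (r * cos t) * ?I t"
          by (simp only: mult_ac)
        ultimately show "ennreal (cos t) * (k (of_real r * cis t) * ennreal (r * cos t / (cos t)\<^sup>2) * ?I t * indicator {0<..} (r * cos t))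
          = k (of_real r * cis t) * ennreal r * indicator {0<..} r * ?I t"
          by simp
      qed
      finally show ?thesis .
    qed simp
  qed
  finally show ?thesis .
qed


lemma nn_integral_real_shift:
  fixes F :: "real \<Rightarrow> ennreal"
  assumes "F \<in> borel_measurable borel"
  shows "(\<integral>\<^sup>+t. F (t + c) \<partial>lborel) = (\<integral>\<^sup>+t. F t \<partial>lborel)"
  using nn_integral_real_affine[OF assms, of 1 c] by (simp add: add.commute)

text \<open>Whole periods replace \<open>c\<close> by some \<open>d\<close> in [0, 2 pi]; the part
  of the interval from \<open>d\<close> to \<open>d + 2 * pi\<close> that lies beyond
  \<open>2 * pi\<close> is then moved back to start at 0.\<close>

lemma nn_integral_periodic:
  fixes F :: "real \<Rightarrow> ennreal"
  assumes [measurable]: "F \<in> borel_measurable borel" and per: "\<And>t. F (t + 2 * pi) = F t"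
  shows "(\<integral>\<^sup>+t\<in>{c..c + 2 * pi}. F t \<partial>lborel) = (\<integral>\<^sup>+t\<in>{0..2 * pi}. F t \<partial>lborel)"
proof -
  \<comment> \<open>\<open>ennreal\<close> is not a real vector space, so
    \<open>int_translate\<close> is applied, with increment 0, to the indicator of the set where
    \<open>F\<close> takes the value \<open>F t\<close>.\<close>
  have perZ: "F (t + 2 * pi * of_int n) = F t" for t and n :: int
    using int_translate[of "\<lambda>x. if F x = F t then 1 else 0 :: real" "2 * pi" 0 t n] per
    by (simp add: mult.commute split: if_splits)
  have closed: "(\<integral>\<^sup>+t\<in>{c..d}. F t \<partial>lborel) = (\<integral>\<^sup>+t\<in>{c..<d}. F t \<partial>lborel)" for c d
    by (intro nn_integral_cong_AE eventually_mono[OF AE_lborel_singleton[of d]]) (auto simp: indicator_def)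
  define n where "n = \<lfloor>c / (2 * pi)\<rfloor>"
  define d where "d = c - 2 * pi * of_int n"
  have "of_int n \<le> c / (2 * pi)" "c / (2 * pi) < of_int n + 1"
    unfolding n_def by linarith+
  then have d: "0 \<le> d" "d \<le> 2 * pi"
    unfolding d_def by (auto simp: field_simps)
  have "(\<integral>\<^sup>+t\<in>{c..<c + 2 * pi}. F t \<partial>lborel) =
      (\<integral>\<^sup>+t. F (t + 2 * pi * of_int n) * indicator {c..<c + 2 * pi} (t + 2 * pi * of_int n) \<partial>lborel)"
    by (rule nn_integral_real_shift[symmetric]) simp
  also have "\<dots> = (\<integral>\<^sup>+t\<in>{d..<d + 2 * pi}. F t \<partial>lborel)"
    unfolding perZ by (intro nn_integral_cong) (auto simp: d_def indicator_def)
  also have "\<dots> = (\<integral>\<^sup>+t. F t * indicator {d..<2 * pi} t + F t * indicator {2 * pi..<d + 2 * pi} t \<partial>lborel)"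
    using d by (intro nn_integral_cong) (auto simp: indicator_def)
  also have "\<dots> = (\<integral>\<^sup>+t\<in>{d..<2 * pi}. F t \<partial>lborel) + (\<integral>\<^sup>+t\<in>{2 * pi..<d + 2 * pi}. F t \<partial>lborel)"
    by (rule nn_integral_add) auto
  also have "(\<integral>\<^sup>+t\<in>{2 * pi..<d + 2 * pi}. F t \<partial>lborel) =
      (\<integral>\<^sup>+t. F (t + 2 * pi) * indicator {2 * pi..<d + 2 * pi} (t + 2 * pi) \<partial>lborel)"
    by (rule nn_integral_real_shift[symmetric]) simp
  also have "\<dots> = (\<integral>\<^sup>+t\<in>{0..<d}. F t \<partial>lborel)"
    unfolding per by (intro nn_integral_cong) (auto simp: indicator_def)
  also have "(\<integral>\<^sup>+t\<in>{d..<2 * pi}. F t \<partial>lborel) + \<dots> = (\<integral>\<^sup>+t. F t * indicator {d..<2 * pi} t + F t * indicator {0..<d} t \<partial>lborel)"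
    by (rule nn_integral_add[symmetric]) auto
  also have "\<dots> = (\<integral>\<^sup>+t\<in>{0..<2 * pi}. F t \<partial>lborel)"
    using d by (intro nn_integral_cong) (auto simp: indicator_def)
  finally show ?thesis by (simp add: closed)
qed

text \<open>The left half-plane is the reflection of the right one in the origin, which shifts the
  angle by \<open>pi\<close>; the imaginary axis is null. The two angular intervals make up one
  period except for finitely many points.\<close>

lemma nn_integral_polar:
  assumes [measurable]: "k \<in> borel_measurable borel"
  shows "(\<integral>\<^sup>+w. k w \<partial>lborel)
     = (\<integral>\<^sup>+t\<in>{0..2 * pi}. (\<integral>\<^sup>+r\<in>{0<..}. k (of_real r * cis t) * ennreal r \<partial>lborel) \<partial>lborel)"
proof -
  have sub [measurable]: "(\<lambda>t. \<integral>\<^sup>+r. k (of_real r * cis t) * ennreal r * indicator {0<..} r \<partial>lborel) \<in> borel_measurable borel"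
    unfolding case_prod_beta' by measurable
  let ?J = "\<lambda>k t. \<integral>\<^sup>+r. k (of_real r * cis t) * ennreal r * indicator {0<..} r \<partial>lborel"
  have right: "(\<integral>\<^sup>+w. k w * indicator {w. Re w > 0} w \<partial>lborel) = (\<integral>\<^sup>+t\<in>{-pi/2<..<pi/2}. ?J k t \<partial>lborel)"
    if [measurable]: "k \<in> borel_measurable borel" for k :: "complex \<Rightarrow> ennreal"
  proof -
    show ?thesis
      by (subst nn_integral_polar_right) (auto simp: nn_integral_multc)
  qed
  have zero: "(\<integral>\<^sup>+w. k w * indicator {w. Re w = 0} w \<partial>lborel) = 0"
  proof -
    have "(\<integral>\<^sup>+w. k w * indicator {w. Re w = 0} w \<partial>lborel) =
      (\<integral>\<^sup>+a. \<integral>\<^sup>+b. k (Complex a b) * indicator {0} a \<partial>lborel \<partial>lborel)"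
      by (subst nn_integral_lborel_complex) (auto intro!: nn_integral_cong simp: indicator_def)
    also have "\<dots> = (\<integral>\<^sup>+a. 0 \<partial>(lborel :: real measure))"
      by (intro nn_integral_cong_AE eventually_mono[OF AE_lborel_singleton[of 0]]) auto
    finally show ?thesis by simp
  qed
  have neg: "(\<integral>\<^sup>+w. k w * indicator {w. Re w < 0} w \<partial>lborel) = (\<integral>\<^sup>+w. k (- w) * indicator {w. Re w > 0} w \<partial>lborel)"
    by (subst nn_integral_complex_uminus) (auto intro!: nn_integral_cong simp: indicator_def)
  have "(\<integral>\<^sup>+w. k w \<partial>lborel) = (\<integral>\<^sup>+w. k w * indicator {w. Re w > 0} w + (k w * indicator {w. Re w < 0} w + k w * indicator {w. Re w = 0} w) \<partial>lborel)"
    by (intro nn_integral_cong) (auto simp: indicator_def)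
  also have "\<dots> = (\<integral>\<^sup>+w. k w * indicator {w. Re w > 0} w \<partial>lborel) + ((\<integral>\<^sup>+w. k w * indicator {w. Re w < 0} w \<partial>lborel) + (\<integral>\<^sup>+w. k w * indicator {w. Re w = 0} w \<partial>lborel))"
    by (simp add: nn_integral_add)
  also have "\<dots> = (\<integral>\<^sup>+t\<in>{-pi/2<..<pi/2}. ?J k t \<partial>lborel) + (\<integral>\<^sup>+t\<in>{-pi/2<..<pi/2}. ?J (\<lambda>w. k (- w)) t \<partial>lborel)"
    unfolding zero neg right[OF assms] by (subst right) simp_all
  also have "(\<integral>\<^sup>+t\<in>{-pi/2<..<pi/2}. ?J (\<lambda>w. k (- w)) t \<partial>lborel)
     = (\<integral>\<^sup>+t. ?J k (t + pi) * indicator {pi/2<..<3*pi/2} (t + pi) \<partial>lborel)"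
  proof (rule nn_integral_cong)
    fix t
    have "cis (t + pi) = - cis t" by (simp add: complex_eq_iff)
    then show "?J (\<lambda>w. k (- w)) t * indicator {-pi/2<..<pi/2} t = ?J k (t + pi) * indicator {pi/2<..<3*pi/2} (t + pi)"
      by (auto simp: indicator_def)
  qed
  also have "\<dots> = (\<integral>\<^sup>+t\<in>{pi/2<..<3*pi/2}. ?J k t \<partial>lborel)"
    by (rule nn_integral_real_shift) simp
  also have "(\<integral>\<^sup>+t\<in>{-pi/2<..<pi/2}. ?J k t \<partial>lborel) + \<dots> =
     (\<integral>\<^sup>+t. ?J k t * indicator {-pi/2<..<pi/2} t + ?J k t * indicator {pi/2<..<3*pi/2} t \<partial>lborel)"
    by (rule nn_integral_add[symmetric]) auto
  also have "\<dots> = (\<integral>\<^sup>+t\<in>{-pi/2..-pi/2 + 2 * pi}. ?J k t \<partial>lborel)"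
  proof (intro nn_integral_cong_AE)
    show "AE t in lborel. ?J k t * indicator {-pi/2<..<pi/2} t + ?J k t * indicator {pi/2<..<3*pi/2} t =
       ?J k t * indicator {-pi/2..-pi/2 + 2 * pi} t"
      using AE_lborel_singleton[of "pi/2"] AE_lborel_singleton[of "-pi/2"] AE_lborel_singleton[of "3*pi/2"]
    proof eventually_elim
      case (elim t)
      have "indicator {-pi/2<..<pi/2} t + indicator {pi/2<..<3*pi/2} t = (indicator {-pi/2..-pi/2 + 2 * pi} t :: ennreal)"
        using elim by (auto split: split_indicator)
      then show ?case by (simp only: distrib_left[symmetric])
    qed
  qed
  also have "\<dots> = (\<integral>\<^sup>+t\<in>{0..2 * pi}. ?J k t \<partial>lborel)"
  proof (rule nn_integral_periodic)
    have "cis (t + 2 * pi) = cis t" for t by (simp add: complex_eq_iff)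
    then show "?J k (t + 2 * pi) = ?J k t" for t by simp
  qed simp
  finally show ?thesis .
qed

section \<open>Weak derivatives of locally Lipschitz maps\<close>

lemma smooth_funD:
  assumes "smooth_fun f"
  shows "f differentiable (at z)" "smooth_fun (\<lambda>z. frechet_derivative f (at z) v)"
  using smooth_fun.cases[OF assms] by blast+

lemma smooth_fun_continuous: "smooth_fun f \<Longrightarrow> continuous_on S f"
  by (meson smooth_funD(1) differentiable_imp_continuous_within continuous_at_imp_continuous_on)

lemma integral_lborel_translate:
  fixes f :: "complex \<Rightarrow> complex"
  assumes [measurable]: "f \<in> borel_measurable borel"
  shows "(LINT z|lborel. f (z + c)) = (LINT z|lborel. f z)"
proof -
  have "(LINT z|lborel. f z) = (LINT z|distr lborel borel ((+) c). f z)"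
    by (simp only: lborel_distr_plus)
  also have "\<dots> = (LINT z|lborel. f (c + z))"
    by (rule integral_distr) auto
  finally show ?thesis by (simp add: add.commute)
qed

text \<open>The limit along \<open>1 / (n + 1)\<close> is Borel measurable on the whole plane as
  soon as \<open>h\<close> is continuous, and wherever \<open>h\<close> is differentiable it is the
  derivative applied to \<open>v\<close>.\<close>

definition dir_deriv :: "(complex \<Rightarrow> complex) \<Rightarrow> complex \<Rightarrow> complex \<Rightarrow> complex" where
  "dir_deriv h v z = lim (\<lambda>n. (h (z + (1 / real (Suc n)) *\<^sub>R v) - h z) /\<^sub>R (1 / real (Suc n)))"

lemma dir_deriv_tendsto:
  assumes "(h has_derivative D) (at z)"
  shows "(\<lambda>n. (h (z + (1 / real (Suc n)) *\<^sub>R v) - h z) /\<^sub>R (1 / real (Suc n))) \<longlonglongrightarrow> D v"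
proof -
  have "filterlim (\<lambda>n. 1 / real (Suc n)) (at 0) sequentially"
    using LIMSEQ_inverse_real_of_nat by (simp add: filterlim_at inverse_eq_divide)
  from filterlim_compose[OF has_derivative_directional[OF assms] this] show ?thesis .
qed

lemma dir_deriv_eq: "(h has_derivative D) (at z) \<Longrightarrow> dir_deriv h v z = D v"
  unfolding dir_deriv_def by (rule limI) (rule dir_deriv_tendsto)

lemma borel_measurable_dir_deriv:
  assumes "continuous_on UNIV h"
  shows "dir_deriv h v \<in> borel_measurable borel"
proof -
  have "(\<lambda>z. (h (z + (1 / real (Suc n)) *\<^sub>R v) - h z) /\<^sub>R (1 / real (Suc n))) \<in> borel_measurable borel" for n
    by (intro borel_measurable_continuous_onI continuous_intros continuous_on_compose2[OF assms] subset_UNIV)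
  then show ?thesis
    unfolding dir_deriv_def[abs_def] by (rule borel_measurable_lim_metric)
qed

text \<open>Both sides of the integration by parts formula are limits of integrals of difference quotients,
  which agree by translation invariance.\<close>
lemma weak_partial_of_lipschitz:
  fixes h :: "complex \<Rightarrow> complex"
  assumes cont: "continuous_on UNIV h"
    and lip: "\<And>R. R < 1 \<Longrightarrow> \<exists>L. \<forall>z w. cmod z \<le> R \<longrightarrow> cmod w \<le> R \<longrightarrow> cmod (h z - h w) \<le> L * cmod (z - w)"
    and diff: "\<And>z. z \<noteq> 0 \<Longrightarrow> cmod z < 1 \<Longrightarrow> h differentiable (at z)"
  shows "weak_partial (ball 0 1) v h (dir_deriv h v)"
  unfolding weak_partial_def
proof (intro allI impI)
  fix \<phi> assume test: "test_fun (ball 0 1) \<phi>"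
  define K where "K = closure {z. \<phi> z \<noteq> 0}"
  have sm: "smooth_fun \<phi>" and K: "compact K" "K \<subseteq> ball 0 1"
    using test by (auto simp: test_fun_def K_def)
  define dv where "dv z = frechet_derivative \<phi> (at z) v" for z
  have zero: "\<phi> z = 0" if "z \<notin> K" for z
    using that closure_subset[of "{z. \<phi> z \<noteq> 0}"] by (auto simp: K_def)
  have dzero: "dv z = 0" if "z \<notin> K" for z
  proof -
    have "((\<lambda>_. 0) has_derivative (\<lambda>_. 0)) (at z)" by simp
    then have "(\<phi> has_derivative (\<lambda>_. 0)) (at z)"
    proof (rule has_derivative_transform_within_open)
      show "open (- K)" using K(1) by (simp add: compact_imp_closed open_Compl)
    qed (use that zero in auto)
    from frechet_derivative_at[OF this, symmetric] show ?thesis by (simp add: dv_def)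
  qed
  have cphi: "continuous_on UNIV \<phi>" and cdv: "continuous_on UNIV dv"
    using smooth_fun_continuous[OF sm] smooth_fun_continuous[OF smooth_funD(2)[OF sm]] by (auto simp: dv_def[abs_def])
  have bounded0: "\<exists>C. \<forall>z. \<bar>f z\<bar> \<le> C" if "continuous_on UNIV f" "\<And>z. z \<notin> K \<Longrightarrow> f z = 0" for f :: "complex \<Rightarrow> real"
  proof -
    have "bounded (f ` K)"
      using that(1) K(1) by (meson compact_continuous_image compact_imp_bounded continuous_on_subset subset_UNIV)
    then obtain C where "\<And>z. z \<in> K \<Longrightarrow> \<bar>f z\<bar> \<le> C" by (auto simp: bounded_iff)
    then have "\<bar>f z\<bar> \<le> max C 0" for z
      using that(2)[of z] by (cases "z \<in> K") (auto simp: max.coboundedI1)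
    then show ?thesis by blast
  qed
  obtain C0 where C0: "\<And>z. \<bar>\<phi> z\<bar> \<le> C0" using bounded0[OF cphi zero] by auto
  obtain C1 where C1: "\<And>z. \<bar>dv z\<bar> \<le> C1" using bounded0[OF cdv dzero] by auto
  have C0n: "0 \<le> C0" and C1n: "0 \<le> C1"
    using order_trans[OF abs_ge_zero C0[of 0]] order_trans[OF abs_ge_zero C1[of 0]] by auto
  have d: "(\<phi> has_derivative frechet_derivative \<phi> (at z)) (at z)" for z
    using smooth_funD(1)[OF sm] by (simp add: frechet_derivative_works)
  have phi_lip: "\<bar>\<phi> (z + t *\<^sub>R v) - \<phi> z\<bar> \<le> C1 * t" if "t > 0" for z t
  proof -
    have "((\<lambda>r. \<phi> (z + r *\<^sub>R v)) has_vector_derivative dv (z + r *\<^sub>R v)) (at r)" for r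
    proof -
      have "((\<lambda>r. z + r *\<^sub>R v) has_derivative (\<lambda>r. r *\<^sub>R v)) (at r)"
        by (auto intro!: derivative_eq_intros)
      from has_derivative_compose[OF this d]
      show ?thesis
        using linear_scale[OF has_derivative_linear[OF d[of "z + r *\<^sub>R v"]]]
        by (simp add: has_vector_derivative_def dv_def)
    qed
    then have "norm (\<phi> (z + t *\<^sub>R v) - \<phi> (z + 0 *\<^sub>R v)) \<le> C1 * t - C1 * 0"
      using that C1 
      by (intro differentiable_bound_general[of 0 t _ "\<lambda>r. C1 * r" "\<lambda>r. dv (z + r *\<^sub>R v)" "\<lambda>_. C1"])
         (auto intro!: continuous_intros continuous_on_compose2[OF cphi] derivative_eq_intros simp: has_real_derivative_iff_has_vector_derivative[symmetric])
    then show ?thesis by simp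
  qed
  obtain R where R: "R < 1" "\<And>z. z \<in> K \<Longrightarrow> cmod z \<le> R" "R \<ge> 0"
  proof (cases "K = {}")
    case True
    then show ?thesis using that[of 0] by simp
  next
    case False
    then obtain z where "z \<in> K" "\<And>w. w \<in> K \<Longrightarrow> cmod w \<le> cmod z"
      using continuous_attains_sup[OF K(1) False, of cmod] by (auto intro: continuous_intros)
    then show ?thesis using that[of "cmod z"] K(2) by auto
  qed
  \<comment> \<open>The support lies in the disk of radius \<open>R\<close>; the larger radius
    \<open>(R + 1) / 2\<close> still contains the shifted points once
    \<open>t n * cmod v < (1 - R) / 2\<close>, which is the role of \<open>n0\<close>.\<close>
  obtain L where L: "\<And>z w. cmod z \<le> (R + 1) / 2 \<Longrightarrow> cmod w \<le> (R + 1) / 2 \<Longrightarrow> cmod (h z - h w) \<le> L * cmod (z - w)"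
    using lip[of "(R + 1) / 2"] R(1) by auto
  have "bounded (h ` cball 0 1)"
    by (meson cont compact_cball compact_continuous_image compact_imp_bounded continuous_on_subset subset_UNIV)
  then obtain Mh where "\<forall>z\<in>cball 0 1. cmod (h z) \<le> Mh" by (auto simp: bounded_iff)
  then have Mh: "cmod (h z) \<le> Mh" if "cmod z \<le> 1" for z using that by simp
  define t where "t n = 1 / real (Suc n)" for n
  have t: "t n > 0" for n by (simp add: t_def)
  have "(\<lambda>n. t n * cmod v) \<longlonglongrightarrow> 0 * cmod v"
    unfolding t_def using LIMSEQ_inverse_real_of_nat by (intro tendsto_mult tendsto_const) (simp add: inverse_eq_divide)
  then have "\<forall>\<^sub>F n in sequentially. t n * cmod v < (1 - R) / 2"
    using R(1) by (intro order_tendstoD) auto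
  then obtain n0 where n0: "\<And>n. n \<ge> n0 \<Longrightarrow> t n * cmod v < (1 - R) / 2"
    by (auto simp: eventually_sequentially)
  have meas [measurable]: "\<phi> \<in> borel_measurable borel" "dv \<in> borel_measurable borel" "h \<in> borel_measurable borel" 
    using cphi cdv cont by (auto intro: borel_measurable_continuous_onI)
  note [measurable] = borel_measurable_dir_deriv[OF cont, of v]
  define X where "X n = (LINT z|lborel. of_real ((\<phi> (z + t (n + n0) *\<^sub>R v) - \<phi> z) / t (n + n0)) * h z)" for n
  have intb: "integrable lborel (\<lambda>z. C * indicator (cball c 1 :: complex set) z)" for C :: real and c
    by (intro integrable_mult_right integrable_real_indicator emeasure_bounded_finite) auto
  have mcd: "(\<lambda>z. of_real (dv z) * h z) \<in> borel_measurable lborel"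
    and mcdn: "(\<lambda>z. of_real ((\<phi> (z + c *\<^sub>R v) - \<phi> z) / c) * h z) \<in> borel_measurable lborel"
    and mddn: "(\<lambda>z. of_real (\<phi> z) * ((h (z + c *\<^sub>R (- v)) - h z) /\<^sub>R c)) \<in> borel_measurable lborel" for c
    unfolding measurable_lborel2 divide_inverse
    by - (intro borel_measurable_continuous_onI continuous_intros continuous_on_compose2[OF cphi] continuous_on_compose2[OF cdv] continuous_on_compose2[OF cont] subset_UNIV)+
  have mdd: "(\<lambda>z. - (of_real (\<phi> z) * dir_deriv h v z)) \<in> borel_measurable lborel"
    by measurable
  have "X \<longlonglongrightarrow> (LINT z|lborel. of_real (dv z) * h z)"
    unfolding X_def
  proof (rule integral_dominated_convergence[where w="\<lambda>z. (C1 * Mh) * indicator (cball 0 1) z"])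
    show "AE z in lborel. (\<lambda>n. of_real ((\<phi> (z + t (n + n0) *\<^sub>R v) - \<phi> z) / t (n + n0)) * h z) \<longlonglongrightarrow> of_real (dv z) * h z"
    proof (intro AE_I2 tendsto_mult tendsto_of_real tendsto_const)
      fix z
      have "filterlim (\<lambda>n. t n) (at 0) sequentially"
        unfolding t_def using LIMSEQ_inverse_real_of_nat by (simp add: filterlim_at inverse_eq_divide)
      from filterlim_compose[OF has_derivative_directional[OF d] this]
      have "(\<lambda>n. (\<phi> (z + t n *\<^sub>R v) - \<phi> z) / t n) \<longlonglongrightarrow> dv z"
        by (simp add: dv_def divide_inverse mult.commute)
      then show "(\<lambda>n. (\<phi> (z + t (n + n0) *\<^sub>R v) - \<phi> z) / t (n + n0)) \<longlonglongrightarrow> dv z"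
        by (rule LIMSEQ_ignore_initial_segment)
    qed
    show "AE z in lborel. norm (of_real ((\<phi> (z + t (n + n0) *\<^sub>R v) - \<phi> z) / t (n + n0)) * h z) \<le> (C1 * Mh) * indicator (cball 0 1) z" for n
    proof (intro AE_I2)
      fix z
      let ?t = "t (n + n0)"
      show "norm (of_real ((\<phi> (z + ?t *\<^sub>R v) - \<phi> z) / ?t) * h z) \<le> (C1 * Mh) * indicator (cball 0 1) z"
      proof (cases "cmod z \<le> 1")
        case True
        have "\<bar>(\<phi> (z + ?t *\<^sub>R v) - \<phi> z) / ?t\<bar> \<le> C1"
          using phi_lip[OF t, of z "n + n0"] t[of "n + n0"] by (simp add: abs_div pos_divide_le_eq)
        then have "\<bar>(\<phi> (z + ?t *\<^sub>R v) - \<phi> z) / ?t\<bar> * cmod (h z) \<le> C1 * Mh"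
          using Mh[OF True] by (intro mult_mono) (auto simp: C0n C1n)
        then show ?thesis using True by (simp add: norm_mult del: of_real_diff of_real_divide times_divide_eq_left)
      next
        \<comment> \<open>Outside the closed unit disk neither \<open>z\<close> nor the shifted
          point meets the support, by the choice of \<open>n0\<close>.\<close>
        case False
        have "cmod z \<le> cmod (z + ?t *\<^sub>R v) + ?t * cmod v"
          using norm_triangle_ineq4[of "z + ?t *\<^sub>R v" "?t *\<^sub>R v"] t[of "n + n0"] by simp
        then have "\<not> cmod (z + ?t *\<^sub>R v) \<le> R" using False n0[of "n + n0"] R(1) by (auto simp: field_simps)
        then have "\<phi> (z + ?t *\<^sub>R v) = 0" using R(2) zero by blast
        moreover have "\<phi> z = 0" using R False zero by force
        ultimately show ?thesis by (simp add: False)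
      qed
    qed
  qed (rule intb mcd mcdn)+
  moreover have "X \<longlonglongrightarrow> (LINT z|lborel. - (of_real (\<phi> z) * dir_deriv h v z))"
  proof -
    \<comment> \<open>Translating the first term by \<open>t * v\<close> moves the quotient onto
      \<open>h\<close> with increment \<open>- v\<close>; this is where the minus sign of the
      formula comes from.\<close>
    have Xeq: "X n = (LINT z|lborel. of_real (\<phi> z) * ((h (z + t (n + n0) *\<^sub>R (- v)) - h z) /\<^sub>R t (n + n0)))" for n
    proof -
      let ?t = "t (n + n0)"
      have i: "integrable lborel (\<lambda>z. of_real (\<phi> (z + c)) * h z)" for c
      proof -
        have "bounded (h ` cball (- c) 1)"
          by (meson cont compact_cball compact_continuous_image compact_imp_bounded continuous_on_subset subset_UNIV)
        then obtain M where M: "\<forall>z\<in>cball (- c) 1. cmod (h z) \<le> M" by (auto simp: bounded_iff)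
        show ?thesis
        proof (rule Bochner_Integration.integrable_bound[where f="\<lambda>z. (C0 * M) * indicator (cball (- c) 1) z :: real"])
          show "integrable lborel (\<lambda>z. (C0 * M) * indicator (cball (- c) 1) z :: real)"
            by (rule intb)
          show "AE z in lborel. cmod (of_real (\<phi> (z + c)) * h z) \<le> norm ((C0 * M) * indicator (cball (- c) 1) z)"
          proof (intro AE_I2)
            fix z show "cmod (of_real (\<phi> (z + c)) * h z) \<le> norm ((C0 * M) * indicator (cball (- c) 1) z)"
            proof (cases "z \<in> cball (- c) 1")
              case True
              have "\<bar>\<phi> (z + c)\<bar> * cmod (h z) \<le> C0 * M"
                using C0[of "z + c"] M[rule_format, OF True] by (intro mult_mono) (auto simp: C0n C1n)
              then show ?thesis using True by (simp add: norm_mult)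
            next
              case False
              then have "z + c \<notin> K" using K(2) by (auto simp: dist_norm norm_minus_commute algebra_simps)
              then show ?thesis using False zero by simp
            qed
          qed
        qed measurable
      qed
      have i2: "integrable lborel (\<lambda>z. of_real (\<phi> z) * h (z - c))" for c
      proof -
        have "integrable (distr lborel borel ((+) (- c))) (\<lambda>z. of_real (\<phi> (z + c)) * h z)"
          using i[of c] by (simp only: lborel_distr_plus)
        then show ?thesis by (subst (asm) integrable_distr_eq) (auto simp: add.commute)
      qed
      have "X n = (LINT z|lborel. (of_real (\<phi> (z + ?t *\<^sub>R v)) * h z - of_real (\<phi> z) * h z) /\<^sub>R ?t)"
        unfolding X_def
        by (rule Bochner_Integration.integral_cong) (simp_all add: scaleR_conv_of_real divide_inverse algebra_simps)
      also have "\<dots> = (LINT z|lborel. of_real (\<phi> (z + ?t *\<^sub>R v)) * h z - of_real (\<phi> z) * h z) /\<^sub>R ?t"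
        by (rule integral_scaleR_right)
      also have "(LINT z|lborel. of_real (\<phi> (z + ?t *\<^sub>R v)) * h z - of_real (\<phi> z) * h z)
          = (LINT z|lborel. of_real (\<phi> (z + ?t *\<^sub>R v)) * h z) - (LINT z|lborel. of_real (\<phi> z) * h z)"
        using i[of 0] by (intro Bochner_Integration.integral_diff i) simp
      also have "(LINT z|lborel. of_real (\<phi> (z + ?t *\<^sub>R v)) * h z) = (LINT z|lborel. of_real (\<phi> z) * h (z - ?t *\<^sub>R v))"
        by (subst integral_lborel_translate[of "\<lambda>z. of_real (\<phi> z) * h (z - ?t *\<^sub>R v)" "?t *\<^sub>R v", symmetric]) auto
      also have "((LINT z|lborel. of_real (\<phi> z) * h (z - ?t *\<^sub>R v)) - (LINT z|lborel. of_real (\<phi> z) * h z)) /\<^sub>R ?t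
          = (LINT z|lborel. of_real (\<phi> z) * h (z - ?t *\<^sub>R v) - of_real (\<phi> z) * h z) /\<^sub>R ?t"
        using i[of 0] by (subst Bochner_Integration.integral_diff[OF i2]) simp_all
      also have "\<dots> = (LINT z|lborel. (of_real (\<phi> z) * h (z - ?t *\<^sub>R v) - of_real (\<phi> z) * h z) /\<^sub>R ?t)"
        by (rule integral_scaleR_right[symmetric])
      also have "\<dots> = (LINT z|lborel. of_real (\<phi> z) * ((h (z + ?t *\<^sub>R (- v)) - h z) /\<^sub>R ?t))"
        by (rule Bochner_Integration.integral_cong) (simp_all add: scaleR_conv_of_real algebra_simps)
      finally show ?thesis .
    qed
    show ?thesis
      unfolding Xeq
    proof (rule integral_dominated_convergence[where w="\<lambda>z. (C0 * (L * cmod v)) * indicator (cball 0 1) z"])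
      show "AE z in lborel. (\<lambda>n. of_real (\<phi> z) * ((h (z + t (n + n0) *\<^sub>R (- v)) - h z) /\<^sub>R t (n + n0))) \<longlonglongrightarrow> - (of_real (\<phi> z) * dir_deriv h v z)"
      \<comment> \<open>The origin is discarded as a null set, since differentiability is assumed
        only away from it.\<close>
      proof (rule eventually_mono[OF AE_lborel_singleton[of 0]])
        fix z :: complex assume z: "z \<noteq> 0"
        show "(\<lambda>n. of_real (\<phi> z) * ((h (z + t (n + n0) *\<^sub>R (- v)) - h z) /\<^sub>R t (n + n0))) \<longlonglongrightarrow> - (of_real (\<phi> z) * dir_deriv h v z)"
        proof (cases "cmod z < 1")
          case True
          then obtain D where D: "(h has_derivative D) (at z)"
            using diff[OF z] by (auto simp: differentiable_def)
          have A: "(\<lambda>n. (h (z + t n *\<^sub>R (- v)) - h z) /\<^sub>R t n) \<longlonglongrightarrow> D (- v)"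
            unfolding t_def by (rule dir_deriv_tendsto[OF D])
          have B: "D (- v) = - dir_deriv h v z"
            using dir_deriv_eq[OF D] linear_neg[OF has_derivative_linear[OF D]] by simp
          from LIMSEQ_ignore_initial_segment[OF A, of n0]
          have "(\<lambda>n. (h (z + t (n + n0) *\<^sub>R (- v)) - h z) /\<^sub>R t (n + n0)) \<longlonglongrightarrow> - dir_deriv h v z"
            unfolding B .
          from tendsto_mult[OF tendsto_const this] show ?thesis by simp
        next
          case False
          then have "\<phi> z = 0" using R zero by force
          then show ?thesis by simp
        qed
      qed
      show "AE z in lborel. norm (of_real (\<phi> z) * ((h (z + t (n + n0) *\<^sub>R (- v)) - h z) /\<^sub>R t (n + n0))) \<le> (C0 * (L * cmod v)) * indicator (cball 0 1) z" for n
      proof (intro AE_I2)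
        fix z
        let ?t = "t (n + n0)"
        show "norm (of_real (\<phi> z) * ((h (z + ?t *\<^sub>R (- v)) - h z) /\<^sub>R ?t)) \<le> (C0 * (L * cmod v)) * indicator (cball 0 1) z"
        proof (cases "z \<in> K")
          case True
          then have zR: "cmod z \<le> R" by (rule R(2))
          have "cmod (z + ?t *\<^sub>R (- v)) \<le> R + ?t * cmod v"
            using norm_triangle_ineq[of z "?t *\<^sub>R (- v)"] t[of "n + n0"] zR by simp
          then have "cmod (h (z + ?t *\<^sub>R (- v)) - h z) \<le> L * cmod (z + ?t *\<^sub>R (- v) - z)"
            using n0[of "n + n0"] zR R(1) by (intro L) (auto simp: field_simps)
          then have "cmod (h (z + ?t *\<^sub>R (- v)) - h z) \<le> (L * cmod v) * ?t"
            using t[of "n + n0"] by (simp add: mult_ac)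
          then have "cmod ((h (z + ?t *\<^sub>R (- v)) - h z) /\<^sub>R ?t) \<le> L * cmod v"
            using t[of "n + n0"] by (simp add: pos_divide_le_eq divide_inverse[symmetric] mult.commute[of "inverse _"])
          then have "\<bar>\<phi> z\<bar> * cmod ((h (z + ?t *\<^sub>R (- v)) - h z) /\<^sub>R ?t) \<le> C0 * (L * cmod v)"
            using C0[of z] by (intro mult_mono) (auto simp: C0n C1n)
          then show ?thesis using zR R(1) by (simp add: norm_mult mult.left_commute)
        next
          case False
          then have "\<phi> z = 0" by (rule zero)
          moreover have "0 \<le> C0" using C0[of 0] by simp
          moreover have "0 \<le> L * cmod v"
            using order_trans[OF norm_ge_zero L[of "of_real ((R+1)/2)" 0]] R(1,3) by (auto simp: zero_le_mult_iff)
          ultimately show ?thesis by simp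
        qed
      qed
    qed (rule intb mdd mddn)+
  qed
  ultimately have main: "(LINT z|lborel. of_real (dv z) * h z) = - (LINT z|lborel. of_real (\<phi> z) * dir_deriv h v z)"
    using LIMSEQ_unique by fastforce
  have "(LINT z:ball 0 1|lebesgue. of_real (frechet_derivative \<phi> (at z) v) * h z) = (LINT z|lebesgue. of_real (dv z) * h z)"
    unfolding set_lebesgue_integral_def
  proof (rule Bochner_Integration.integral_cong)
    show "indicator (ball 0 1) z *\<^sub>R (of_real (frechet_derivative \<phi> (at z) v) * h z) = of_real (dv z) * h z" for z
      using dzero[of z] subsetD[OF K(2), of z] by (cases "z \<in> K") (auto simp: dv_def)
  qed simp
  moreover have "(LINT z:ball 0 1|lebesgue. of_real (\<phi> z) * dir_deriv h v z) = (LINT z|lebesgue. of_real (\<phi> z) * dir_deriv h v z)"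
    unfolding set_lebesgue_integral_def
  proof (rule Bochner_Integration.integral_cong)
    show "indicator (ball 0 1) z *\<^sub>R (of_real (\<phi> z) * dir_deriv h v z) = of_real (\<phi> z) * dir_deriv h v z" for z
      using zero[of z] subsetD[OF K(2), of z] by (cases "z \<in> K") auto
  qed simp
  ultimately show "(LINT z:ball 0 1|lebesgue. of_real (frechet_derivative \<phi> (at z) v) * h z)
       = - (LINT z:ball 0 1|lebesgue. of_real (\<phi> z) * dir_deriv h v z)"
    using main by (simp add: integral_completion)
qed

text \<open>The mean value inequality uses derivatives only in the interior of a segment, so a
  segment through 0 is cut there. On such a segment \<open>cmod z\<close> and \<open>cmod w\<close>
  add up to the length, and no constant is lost.\<close>

lemma lipschitz_of_derivative_bound:
  fixes h :: "complex \<Rightarrow> complex"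
  assumes cont: "continuous_on UNIV h"
    and der: "\<And>z. z \<noteq> 0 \<Longrightarrow> cmod z \<le> R \<Longrightarrow> \<exists>D. (h has_derivative D) (at z) \<and> (\<forall>v. cmod (D v) \<le> C * cmod v)"
    and z: "cmod z \<le> R" and w: "cmod w \<le> R"
  shows "cmod (h z - h w) \<le> C * cmod (z - w)"
proof -
  have seg: "cmod (h w - h z) \<le> C * cmod (w - z)" if z: "cmod z \<le> R" and w: "cmod w \<le> R" and 0: "0 \<notin> open_segment z w" for z w
  proof (cases "z = w")
    case False
    define \<gamma> where "\<gamma> t = z + t *\<^sub>R (w - z)" for t
    have in_seg: "\<gamma> t \<in> open_segment z w" if "0 < t" "t < 1" for t
      using that False by (auto simp: in_segment \<gamma>_def algebra_simps intro!: exI[of _ t])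
    have "\<exists>D. (h has_derivative D) (at (\<gamma> t)) \<and> (\<forall>v. cmod (D v) \<le> C * cmod v)" if "0 < t" "t < 1" for t
    proof (rule der)
      show "\<gamma> t \<noteq> 0" using in_seg[OF that] 0 by auto
      have "\<gamma> t \<in> cball 0 R"
        using in_seg[OF that] z w closed_segment_subset[of z "cball 0 R" w] by (auto simp: open_segment_def)
      then show "cmod (\<gamma> t) \<le> R" by simp
    qed
    then obtain D where D: "\<And>t. 0 < t \<Longrightarrow> t < 1 \<Longrightarrow> (h has_derivative D t) (at (\<gamma> t))"
      "\<And>t v. 0 < t \<Longrightarrow> t < 1 \<Longrightarrow> cmod (D t v) \<le> C * cmod v" by metis
    have "norm (h (\<gamma> 1) - h (\<gamma> 0)) \<le> C * cmod (w - z) * 1 - C * cmod (w - z) * 0"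
    proof (rule differentiable_bound_general)
      show "continuous_on {0..1} (\<lambda>t. h (\<gamma> t))"
        unfolding \<gamma>_def by (intro continuous_on_compose2[OF cont] continuous_intros) auto
      show "((\<lambda>t. C * cmod (w - z) * t) has_vector_derivative C * cmod (w - z)) (at t)" for t
        by (auto intro!: derivative_eq_intros simp: has_real_derivative_iff_has_vector_derivative[symmetric])
      show "((\<lambda>t. h (\<gamma> t)) has_vector_derivative D t (w - z)) (at t)" if "0 < t" "t < 1" for t
      proof -
        have "(\<gamma> has_derivative (\<lambda>r. r *\<^sub>R (w - z))) (at t)"
          unfolding \<gamma>_def by (auto intro!: derivative_eq_intros)
        from has_derivative_compose[OF this D(1)[OF that]]
        show ?thesis
          using linear_scale[OF has_derivative_linear[OF D(1)[OF that]]]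
          by (simp add: has_vector_derivative_def)
      qed
    qed (use D(2) in \<open>auto intro!: continuous_intros\<close>)
    then show ?thesis by (simp add: \<gamma>_def)
  qed simp
  show ?thesis
  proof (cases "0 \<in> open_segment z w")
    case False
    then show ?thesis using seg[OF z w] by (simp add: norm_minus_commute)
  next
    case True
    have R: "0 \<le> R" using z norm_ge_zero order_trans by blast
    have "dist z w = dist z 0 + dist 0 w"
      using True by (auto simp: open_segment_def between_mem_segment[symmetric] between)
    then have zw: "cmod (z - w) = cmod z + cmod w" by (simp add: dist_norm)
    have "cmod (h z - h w) \<le> cmod (h z - h 0) + cmod (h 0 - h w)"
      using norm_triangle_ineq[of "h z - h 0" "h 0 - h w"] by simp
    also have "\<dots> \<le> C * cmod z + C * cmod w"
      using seg[of 0 z] seg[of w 0] z w R by (intro add_mono) (auto simp: open_segment_def)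
    finally show ?thesis by (simp add: zw algebra_simps)
  qed
qed

lemma Lp_on_I:
  assumes [measurable]: "f \<in> borel_measurable borel"
    and "(\<integral>\<^sup>+z\<in>ball 0 1. ennreal (norm (f z) powr p) \<partial>lborel) < \<infinity>"
  shows "Lp_on p (ball 0 1) f"
proof -
  have "set_borel_measurable lebesgue (ball 0 1) f"
    unfolding set_borel_measurable_def
    by (intro measurable_completion borel_measurable_scaleR borel_measurable_indicator) auto
  then show ?thesis using assms(2) by (simp add: Lp_on_def nn_integral_completion)
qed

text \<open>Since \<open>B\<close> is bounded on smaller disks, \<open>h\<close> is locally
  Lipschitz and its pointwise derivative is a weak one; the \<open>p\<close>-integral of
  \<open>B\<close> then bounds that derivative. The origin is exempt because it is the puncture of
  \<open>disk_map\<close>.\<close>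

lemma sobolev_of_derivative_bound:
  fixes h :: "complex \<Rightarrow> complex"
  assumes cont: "continuous_on UNIV h" and p: "p > 0"
    and der: "\<And>z. z \<noteq> 0 \<Longrightarrow> cmod z < 1 \<Longrightarrow> \<exists>D. (h has_derivative D) (at z) \<and> (\<forall>v. cmod (D v) \<le> B z * cmod v)"
    and loc: "\<And>R. R < 1 \<Longrightarrow> \<exists>C. \<forall>z. z \<noteq> 0 \<longrightarrow> cmod z \<le> R \<longrightarrow> B z \<le> C"
    and fin: "(\<integral>\<^sup>+z\<in>ball 0 1. ennreal (B z powr p) \<partial>lborel) < \<infinity>"
  shows "sobolev_W1 p (ball 0 1) h"
proof -
  have [measurable]: "h \<in> borel_measurable borel"
    using cont by (rule borel_measurable_continuous_onI)
  have "weak_partial (ball 0 1) v h (dir_deriv h v)" for v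
  proof (rule weak_partial_of_lipschitz[OF cont])
    fix R :: real assume R: "R < 1"
    obtain C where C: "\<And>z. z \<noteq> 0 \<Longrightarrow> cmod z \<le> R \<Longrightarrow> B z \<le> C" using loc[OF R] by auto
    have "cmod (h z - h w) \<le> C * cmod (z - w)" if "cmod z \<le> R" "cmod w \<le> R" for z w
    proof (rule lipschitz_of_derivative_bound[OF cont _ that])
      fix z :: complex assume z: "z \<noteq> 0" "cmod z \<le> R"
      then obtain D where "(h has_derivative D) (at z)" "\<And>v. cmod (D v) \<le> B z * cmod v"
        using der[of z] R by auto
      moreover have "B z * cmod v \<le> C * cmod v" for v
        by (intro mult_right_mono C z) simp
      ultimately show "\<exists>D. (h has_derivative D) (at z) \<and> (\<forall>v. cmod (D v) \<le> C * cmod v)"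
        using order_trans by blast
    qed
    then show "\<exists>L. \<forall>z w. cmod z \<le> R \<longrightarrow> cmod w \<le> R \<longrightarrow> cmod (h z - h w) \<le> L * cmod (z - w)" by blast
  next
    show "h differentiable (at z)" if "z \<noteq> 0" "cmod z < 1" for z
      using der[OF that] by (auto simp: differentiable_def)
  qed
  moreover have "Lp_on p (ball 0 1) (dir_deriv h v)" if v: "cmod v = 1" for v
  proof (rule Lp_on_I)
    show "dir_deriv h v \<in> borel_measurable borel" by (rule borel_measurable_dir_deriv[OF cont])
    have "(\<integral>\<^sup>+z\<in>ball 0 1. ennreal (norm (dir_deriv h v z) powr p) \<partial>lborel) \<le> (\<integral>\<^sup>+z\<in>ball 0 1. ennreal (B z powr p) \<partial>lborel)"
    proof (intro nn_integral_mono_AE eventually_mono[OF AE_lborel_singleton[of 0]])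
      fix z :: complex assume z: "z \<noteq> 0"
      show "ennreal (norm (dir_deriv h v z) powr p) * indicator (ball 0 1) z \<le> ennreal (B z powr p) * indicator (ball 0 1) z"
      proof (cases "cmod z < 1")
        case True
        then obtain D where D: "(h has_derivative D) (at z)" "\<And>v. cmod (D v) \<le> B z * cmod v"
          using der[OF z] by auto
        then have "norm (dir_deriv h v z) \<le> B z"
          using D(2)[of v] v dir_deriv_eq[OF D(1), of v] by simp
        then show ?thesis
          using p by (intro mult_right_mono ennreal_leI powr_mono2) auto
      qed simp
    qed
    then show "(\<integral>\<^sup>+z\<in>ball 0 1. ennreal (norm (dir_deriv h v z) powr p) \<partial>lborel) < \<infinity>"
      using fin le_less_trans by blast
  qed
  moreover have "Lp_on p (ball 0 1) h"
  proof (rule Lp_on_I)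
    have "bounded (h ` cball 0 1)"
      by (meson cont compact_cball compact_continuous_image compact_imp_bounded continuous_on_subset subset_UNIV)
    then obtain M where M: "\<forall>z\<in>cball 0 1. cmod (h z) \<le> M" by (auto simp: bounded_iff)
    have "(\<integral>\<^sup>+z\<in>ball 0 1. ennreal (norm (h z) powr p) \<partial>lborel) \<le> (\<integral>\<^sup>+z. ennreal (M powr p) * indicator (ball 0 1) (z :: complex) \<partial>lborel)"
      using M p by (intro nn_integral_mono) (auto simp: indicator_def intro!: ennreal_leI powr_mono2)
    also have "\<dots> = ennreal (M powr p) * emeasure lborel (ball 0 1 :: complex set)"
      by (rule nn_integral_cmult_indicator) simp
    also have "\<dots> < \<infinity>"
      using emeasure_bounded_finite[of "ball 0 1 :: complex set"] by (simp add: ennreal_mult_less_top)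
    finally show "(\<integral>\<^sup>+z\<in>ball 0 1. ennreal (norm (h z) powr p) \<partial>lborel) < \<infinity>" .
  qed simp
  ultimately show ?thesis
    unfolding sobolev_W1_def by (metis norm_one norm_ii)
qed

section \<open>Energy of the extension\<close>

text \<open>The integrand of \<open>douglas\<close> as a function of the two angles. On the diagonal
  it is 0, because \<open>x / 0 = 0\<close> and \<open>0 powr r = 0\<close>.\<close>

definition dquot :: "real \<Rightarrow> (complex \<Rightarrow> complex) \<Rightarrow> real \<Rightarrow> real \<Rightarrow> ennreal" where
  "dquot r \<psi> s t = ennreal (norm ((\<psi> (cis s) - \<psi> (cis t)) / (cis s - cis t)) powr r)"

lemma borel_measurable_dquot:
  assumes m: "(\<lambda>s. \<psi> (cis s)) \<in> borel_measurable borel" and [measurable]: "f \<in> borel_measurable M" "g \<in> borel_measurable M"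
  shows "(\<lambda>x. dquot r \<psi> (f x) (g x)) \<in> borel_measurable M"
proof -
  have [measurable]: "(\<lambda>x. \<psi> (cis (f x))) \<in> borel_measurable M" "(\<lambda>x. \<psi> (cis (g x))) \<in> borel_measurable M"
    using measurable_compose[OF assms(2) m] measurable_compose[OF assms(3) m] by auto
  show ?thesis unfolding dquot_def by measurable
qed

lemma cis_2pi: "cis (t + 2 * pi) = cis t"
  by (simp add: complex_eq_iff)

lemma dquot_periodic: "dquot r \<psi> (s + 2 * pi) t = dquot r \<psi> s t" "dquot r \<psi> s (t + 2 * pi) = dquot r \<psi> s t"
  by (simp_all add: dquot_def cis_2pi)

lemma dquot_sym: "dquot r \<psi> s t = dquot r \<psi> t s"
  by (simp add: dquot_def norm_divide norm_minus_commute)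

lemma douglas_iterated:
  assumes m: "(\<lambda>s. \<psi> (cis s)) \<in> borel_measurable borel"
  shows "douglas r \<psi> \<longleftrightarrow> (\<integral>\<^sup>+s\<in>{0..2 * pi}. (\<integral>\<^sup>+t\<in>{0..2 * pi}. dquot r \<psi> s t \<partial>lborel) \<partial>lborel) < \<infinity>"
proof -
  note [measurable] = borel_measurable_dquot[OF m]
  have "(\<integral>\<^sup>+st\<in>{0..2*pi} \<times> {0..2*pi}. dquot r \<psi> (fst st) (snd st) \<partial>lborel)
     = (\<integral>\<^sup>+st. dquot r \<psi> (fst st) (snd st) * indicator {0..2*pi} (snd st) * indicator {0..2*pi} (fst st) \<partial>(lborel \<Otimes>\<^sub>M lborel))"
    unfolding lborel_prod by (intro nn_integral_cong) (auto simp: indicator_def mem_Times_iff)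
  also have "\<dots> = (\<integral>\<^sup>+s. \<integral>\<^sup>+t. dquot r \<psi> s t * indicator {0..2*pi} t * indicator {0..2*pi} s \<partial>lborel \<partial>lborel)"
    by (subst lborel.nn_integral_fst[symmetric]) auto
  also have "\<dots> = (\<integral>\<^sup>+s\<in>{0..2 * pi}. (\<integral>\<^sup>+t\<in>{0..2 * pi}. dquot r \<psi> s t \<partial>lborel) \<partial>lborel)"
    by (intro nn_integral_cong nn_integral_multc) auto
  finally show ?thesis by (simp add: douglas_def dquot_def)
qed

lemma cis_dist: "cmod (cis u - cis v) = 2 * \<bar>sin ((u - v) / 2)\<bar>"
proof -
  have "cis u - cis v = cis ((u + v) / 2) * (cis ((u - v) / 2) - cis (- ((u - v) / 2)))"
    by (simp add: right_diff_distrib cis_mult add_divide_distrib[symmetric] diff_divide_distrib[symmetric])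
  also have "cis ((u - v) / 2) - cis (- ((u - v) / 2)) = 2 * \<i> * of_real (sin ((u - v) / 2))"
    by (simp add: complex_eq_iff)
  finally show ?thesis by (simp add: norm_mult)
qed

text \<open>Jordan's inequality: by concavity the graph of \<open>sin\<close> lies above its chord
  from 0 to \<open>pi / 2\<close>. It turns chord lengths into arc lengths below.\<close>

lemma jordan_sin:
  fixes x :: real
  assumes "0 \<le> x" "x \<le> pi / 2"
  shows "2 / pi * x \<le> sin x"
proof -
  have cv: "concave_on {0..pi} sin"
    unfolding concave_on_def
  proof (rule f''_ge0_imp_convex)
    show "((\<lambda>x. - sin x) has_real_derivative - cos x) (at x)" for x :: real
      by (auto intro!: derivative_eq_intros)
    show "((\<lambda>x. - cos x) has_real_derivative sin x) (at x)" for x :: real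
      by (auto intro!: derivative_eq_intros)
  qed (auto intro: sin_ge_zero)
  have "(1 - 2 * x / pi) * sin 0 + (2 * x / pi) * sin (pi / 2) \<le> sin ((1 - 2 * x / pi) *\<^sub>R 0 + (2 * x / pi) *\<^sub>R (pi / 2))"
    using assms by (intro concave_onD[OF cv]) (auto simp: field_simps)
  then show ?thesis by (simp add: field_simps)
qed

text \<open>In the coordinates \<open>s = t + y\<close>, \<open>u = t - y\<close> the energy of \<open>slope\<close> is a part of the Douglas integral.\<close>
lemma douglas_strip:
  assumes m: "(\<lambda>s. \<psi> (cis s)) \<in> borel_measurable borel" and d: "douglas r \<psi>" and c: "c \<le> pi"
  shows "(\<integral>\<^sup>+t\<in>{0..2 * pi}. (\<integral>\<^sup>+y\<in>{0..c}. dquot r \<psi> (t + y) (t - y) \<partial>lborel) \<partial>lborel) < \<infinity>"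
proof -
  note [measurable] = borel_measurable_dquot[OF m]
  have "(\<integral>\<^sup>+t\<in>{0..2 * pi}. (\<integral>\<^sup>+y\<in>{0..c}. dquot r \<psi> (t + y) (t - y) \<partial>lborel) \<partial>lborel)
     = (\<integral>\<^sup>+t. \<integral>\<^sup>+y. dquot r \<psi> (t + y) (t - y) * indicator {0..c} y * indicator {0..2 * pi} t \<partial>lborel \<partial>lborel)"
    by (intro nn_integral_cong nn_integral_multc[symmetric]) auto
  also have "\<dots> = (\<integral>\<^sup>+y. \<integral>\<^sup>+t. dquot r \<psi> (t + y) (t - y) * indicator {0..c} y * indicator {0..2 * pi} t \<partial>lborel \<partial>lborel)"
    by (rule lborel_pair.Fubini') (simp add: case_prod_beta')
  also have "\<dots> = (\<integral>\<^sup>+y. \<integral>\<^sup>+u. dquot r \<psi> (u + 2 * y) u * indicator {0..c} y * indicator {0..2 * pi} u \<partial>lborel \<partial>lborel)"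
  \<comment> \<open>For fixed \<open>y\<close> the integrand has period \<open>2 * pi\<close> in
    \<open>t\<close>, so the interval may be moved to start at \<open>y\<close>; then
    \<open>u = t - y\<close> runs over [0, 2 pi] again.\<close>
  proof (rule nn_integral_cong)
    fix y :: real
    have "(\<integral>\<^sup>+t\<in>{0..2 * pi}. dquot r \<psi> (t + y) (t - y) * indicator {0..c} y \<partial>lborel)
      = (\<integral>\<^sup>+t\<in>{y..y + 2 * pi}. dquot r \<psi> (t + y) (t - y) * indicator {0..c} y \<partial>lborel)"
    proof (rule nn_integral_periodic[of "\<lambda>t. dquot r \<psi> (t + y) (t - y) * indicator {0..c} y" y, symmetric])
      fix t
      have "t + 2 * pi + y = (t + y) + 2 * pi" "t + 2 * pi - y = (t - y) + 2 * pi" by simp_all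
      then show "dquot r \<psi> (t + 2 * pi + y) (t + 2 * pi - y) * indicator {0..c} y = dquot r \<psi> (t + y) (t - y) * indicator {0..c} y"
        by (simp only: dquot_periodic)
    qed simp
    also have "\<dots> = (\<integral>\<^sup>+u. dquot r \<psi> (u + y + y) (u + y - y) * indicator {0..c} y * indicator {y..y + 2 * pi} (u + y) \<partial>lborel)"
      by (intro nn_integral_real_shift[symmetric]) simp
    also have "\<dots> = (\<integral>\<^sup>+u\<in>{0..2 * pi}. dquot r \<psi> (u + 2 * y) u * indicator {0..c} y \<partial>lborel)"
      by (intro nn_integral_cong) (auto simp: indicator_def algebra_simps)
    finally show "(\<integral>\<^sup>+t\<in>{0..2 * pi}. dquot r \<psi> (t + y) (t - y) * indicator {0..c} y \<partial>lborel) = \<dots>" .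
  qed
  also have "\<dots> = (\<integral>\<^sup>+u. \<integral>\<^sup>+y. dquot r \<psi> (u + 2 * y) u * indicator {0..c} y * indicator {0..2 * pi} u \<partial>lborel \<partial>lborel)"
    by (rule lborel_pair.Fubini'[symmetric]) (simp add: case_prod_beta')
  also have "\<dots> = (\<integral>\<^sup>+u\<in>{0..2 * pi}. (\<integral>\<^sup>+y\<in>{0..c}. dquot r \<psi> (u + 2 * y) u \<partial>lborel) \<partial>lborel)"
    by (intro nn_integral_cong nn_integral_multc) auto
  also have "\<dots> \<le> (\<integral>\<^sup>+u\<in>{0..2 * pi}. (\<integral>\<^sup>+t\<in>{0..2 * pi}. dquot r \<psi> u t \<partial>lborel) \<partial>lborel)"
  proof (rule nn_integral_mono, rule mult_right_mono)
    fix u :: real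
    have "(\<integral>\<^sup>+y\<in>{0..c}. dquot r \<psi> (u + 2 * y) u \<partial>lborel)
        \<le> (\<integral>\<^sup>+y. dquot r \<psi> (u + 2 * y) u * indicator {u..u + 2 * pi} (u + 2 * y) \<partial>lborel)"
      using c by (intro nn_integral_mono mult_left_mono) (auto simp: indicator_def)
    \<comment> \<open>The factor 2 is the Jacobian of \<open>s = u + 2 * y\<close>, inserted freely
      since only an upper bound is wanted. The increments \<open>2 * y\<close> fit into one period
      because \<open>c <= pi\<close>.\<close>
    also have "\<dots> \<le> ennreal 2 * \<dots>"
      using mult_right_mono[of 1 "ennreal 2" "\<integral>\<^sup>+y. dquot r \<psi> (u + 2 * y) u * indicator {u..u + 2 * pi} (u + 2 * y) \<partial>lborel"] by simp
    also have "\<dots> = (\<integral>\<^sup>+s\<in>{u..u + 2 * pi}. dquot r \<psi> s u \<partial>lborel)"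
      by (subst (2) nn_integral_real_affine[where c=2 and t=u]) auto
    also have "\<dots> = (\<integral>\<^sup>+s\<in>{0..2 * pi}. dquot r \<psi> s u \<partial>lborel)"
      by (rule nn_integral_periodic) (simp_all add: dquot_periodic)
    finally show "(\<integral>\<^sup>+y\<in>{0..c}. dquot r \<psi> (u + 2 * y) u \<partial>lborel) \<le> (\<integral>\<^sup>+t\<in>{0..2 * pi}. dquot r \<psi> u t \<partial>lborel)"
      by (simp add: dquot_sym[of r \<psi> u])
  qed simp
  also have "\<dots> < \<infinity>" using d douglas_iterated[OF m] by simp
  finally show ?thesis .
qed

text \<open>\<open>Ln\<close> jumps across the negative axis, so it is assembled from three Borel
  pieces: the slit plane, where it is continuous, the negative axis, where its imaginary part is
  \<open>pi\<close>, and the origin.\<close>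

lemma borel_measurable_Ln: "Ln \<in> borel_measurable borel"
proof -
  let ?A = "- \<real>\<^sub>\<le>\<^sub>0 :: complex set"
  have A: "?A \<in> sets borel" by simp
  have "continuous_on ?A Ln" by (intro continuous_intros) auto
  then have 1: "(\<lambda>z. indicator ?A z *\<^sub>R Ln z) \<in> borel_measurable borel"
    by (rule borel_measurable_continuous_on_indicator[OF A])
  have "(\<lambda>z. of_real (ln (cmod z)) + \<i> * of_real pi) \<in> borel_measurable (borel :: complex measure)"
    by measurable
  then have "(\<lambda>z. indicator ?A z *\<^sub>R Ln z + indicator (\<real>\<^sub>\<le>\<^sub>0 - {0}) z *\<^sub>R (of_real (ln (cmod z)) + \<i> * of_real pi) + indicator {0} z *\<^sub>R Ln 0) \<in> borel_measurable borel"
    by (intro borel_measurable_add 1 borel_measurable_scaleR borel_measurable_indicator sets.Diff borel_closed) auto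
  moreover have "(\<lambda>z. indicator ?A z *\<^sub>R Ln z + indicator (\<real>\<^sub>\<le>\<^sub>0 - {0}) z *\<^sub>R (of_real (ln (cmod z)) + \<i> * of_real pi) + indicator {0} z *\<^sub>R Ln 0) = Ln"
  proof
    fix z
    show "indicator ?A z *\<^sub>R Ln z + indicator (\<real>\<^sub>\<le>\<^sub>0 - {0}) z *\<^sub>R (of_real (ln (cmod z)) + \<i> * of_real pi) + indicator {0} z *\<^sub>R Ln 0 = Ln z"
    proof (cases "z \<in> \<real>\<^sub>\<le>\<^sub>0 - {0}")
      case True
      then have "Re z < 0" "Im z = 0" by (auto simp: complex_nonpos_Reals_iff complex_eq_iff)
      then have "Im (Ln z) = pi" using True by (simp add: Im_Ln_eq_pi)
      then show ?thesis using True by (auto simp: complex_eq_iff)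
    next
      case False
      then show ?thesis by (cases "z = 0") (simp_all add: indicator_def)
    qed
  qed
  ultimately show ?thesis by (simp only:)
qed

text \<open>\<open>slope\<close> in disk coordinates: under \<open>w = exp (i z)\<close> the real
  part of \<open>z\<close> is the argument of \<open>w\<close> up to periods, which do not affect
  the slope of a lift, and \<open>Im z = - ln (cmod w)\<close>.\<close>

definition slope_at :: "(real \<Rightarrow> real) \<Rightarrow> complex \<Rightarrow> real" where
  "slope_at a z = slope a (Im (Ln z)) (- ln (cmod z))"

context circle_lift
begin

lemma slope_shift: "slope a (x + 2 * pi * of_int n) y = slope a x y"
  using shift_int[of "x + y" n] shift_int[of "x - y" n]
  by (simp add: slope_def algebra_simps)

lemma slope_at_exp: "slope_at a (exp (\<i> * z)) = slope a (Re z) (Im z)"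
proof -
  have "exp (Ln (exp (\<i> * z))) = exp (\<i> * z)" by simp
  then obtain n :: int where n: "Ln (exp (\<i> * z)) = \<i> * z + of_int (2 * n) * pi * \<i>"
    unfolding exp_eq by blast
  then have "Im (Ln (exp (\<i> * z))) = Re z + 2 * pi * of_int n" by simp
  then show ?thesis by (simp add: slope_at_def slope_shift norm_exp_eq_Re)
qed

lemma slope_at_polar: "r > 0 \<Longrightarrow> slope_at a (of_real r * cis t) = slope a t (- ln r)"
  using slope_at_exp[of "Complex t (- ln r)"]
  by (simp add: Complex_eq algebra_simps exp_add cis_conv_exp exp_of_real mult.commute)

text \<open>As \<open>a\<close> stays within \<open>M\<close> of the identity, its increment over
  length \<open>2 * y\<close> is at most \<open>2 * y + 2 * M\<close>. So the slope is bounded away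
  from the circle, and only a collar of the circle needs the Douglas integral.\<close>

lemma slope_le:
  assumes "\<And>x. \<bar>a x - x\<bar> \<le> M" "0 < c" "c \<le> y"
  shows "slope a x y \<le> 1 + M / c"
proof -
  have M: "0 \<le> M" using order_trans[OF abs_ge_zero assms(1)[of 0]] .
  have "a (x + y) - a (x - y) \<le> 2 * y + 2 * M"
    using assms(1)[of "x + y"] assms(1)[of "x - y"] by linarith
  then have "slope a x y \<le> (2 * y + 2 * M) / (2 * y)"
    unfolding slope_def using assms by (intro divide_right_mono) auto
  also have "\<dots> = 1 + M / y" using assms by (simp add: field_simps)
  also have "\<dots> \<le> 1 + M / c" using assms M by (intro add_left_mono divide_left_mono) auto
  finally show ?thesis .
qed

lemma borel_measurable_a [measurable (raw)]: "f \<in> borel_measurable N \<Longrightarrow> (\<lambda>x. a (f x)) \<in> borel_measurable N"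
  using measurable_compose[OF _ borel_measurable_continuous_onI[OF cont]] .

lemma borel_measurable_slope_at: "slope_at a \<in> borel_measurable borel"
proof -
  note [measurable] = borel_measurable_Ln
  show ?thesis unfolding slope_at_def[abs_def] slope_def by measurable
qed

text \<open>Uniform continuity on a compact interval. The bound \<open>pi\<close> makes chords
  comparable to arcs, as half of the oscillation must not exceed \<open>pi / 2\<close> in
  \<open>jordan_sin\<close>; \<open>c <= 1\<close> serves to keep \<open>sin y\<close>
  positive.\<close>

lemma small_oscillation: "\<exists>c>0. c \<le> 1 \<and> (\<forall>x y. 0 \<le> x \<longrightarrow> x \<le> 2 * pi \<longrightarrow> 0 \<le> y \<longrightarrow> y \<le> c \<longrightarrow> a (x + y) - a (x - y) \<le> pi)"
proof -
  have "uniformly_continuous_on {-1..2 * pi + 1} a"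
    by (intro compact_uniformly_continuous continuous_on_subset[OF cont]) auto
  then obtain d where d: "d > 0" "\<And>x y. x \<in> {-1..2 * pi + 1} \<Longrightarrow> y \<in> {-1..2 * pi + 1} \<Longrightarrow> dist y x < d \<Longrightarrow> dist (a y) (a x) < pi"
    unfolding uniformly_continuous_on_def using pi_gt_zero by meson
  have "a (x + y) - a (x - y) \<le> pi" if "0 \<le> x" "x \<le> 2 * pi" "0 \<le> y" "y \<le> min 1 (d / 4)" for x y
    using d(2)[of "x - y" "x + y"] d(1) that by (auto simp: dist_real_def)
  then show ?thesis using d(1) by (intro exI[of _ "min 1 (d / 4)"]) auto
qed

text \<open>If \<open>d\<close> is the oscillation, the chord of the images is at least
  \<open>2 * d / pi\<close> by Jordan's inequality, while the chord of the arguments,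
  \<open>2 * sin y\<close>, is at most \<open>2 * y\<close>. Only moduli of differences of
  \<open>\<psi>\<close> enter, so reflected maps are covered too.\<close>

lemma slope_le_dquot:
  assumes psi: "\<And>x y. cmod (\<psi> (cis x) - \<psi> (cis y)) = cmod (cis (a x) - cis (a y))"
    and y: "0 \<le> y" "y \<le> 1" and osc: "a (t + y) - a (t - y) \<le> pi" and p: "p > 0"
  shows "ennreal (slope a t y powr p) \<le> ennreal ((pi / 2) powr p) * dquot p \<psi> (t + y) (t - y)"
proof (cases "y = 0")
  case True
  then show ?thesis using p by (simp add: slope_def)
next
  case False
  then have y0: "y > 0" using y by simp
  define d where "d = a (t + y) - a (t - y)"
  have d: "0 \<le> d" "d \<le> pi"
    using monoD[OF mono, of "t - y" "t + y"] y osc by (auto simp: d_def)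
  have sy: "0 < sin y" using y0 y pi_gt3 by (intro sin_gt_zero) auto
  have "2 / pi * (d / 2) \<le> sin (d / 2)" using d by (intro jordan_sin) auto
  then have num: "d \<le> pi / 2 * cmod (\<psi> (cis (t + y)) - \<psi> (cis (t - y)))"
    unfolding psi cis_dist using sin_ge_zero[of "d / 2"] d
    by (simp add: d_def[symmetric] field_simps)
  have den: "0 < cmod (cis (t + y) - cis (t - y))" "cmod (cis (t + y) - cis (t - y)) \<le> 2 * y"
    unfolding cis_dist using sy sin_x_le_x[of y] y by simp_all
  have "slope a t y = d / (2 * y)" by (simp add: slope_def d_def)
  also have "\<dots> \<le> (pi / 2 * cmod (\<psi> (cis (t + y)) - \<psi> (cis (t - y)))) / cmod (cis (t + y) - cis (t - y))"
    using num den d by (intro frac_le) auto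
  finally have "slope a t y \<le> pi / 2 * norm ((\<psi> (cis (t + y)) - \<psi> (cis (t - y))) / (cis (t + y) - cis (t - y)))"
    by (simp add: norm_divide)
  then have "slope a t y powr p \<le> (pi / 2 * norm ((\<psi> (cis (t + y)) - \<psi> (cis (t - y))) / (cis (t + y) - cis (t - y)))) powr p"
    using p slope_nonneg[OF y0] by (intro powr_mono2) auto
  also have "\<dots> = (pi / 2) powr p * norm ((\<psi> (cis (t + y)) - \<psi> (cis (t - y))) / (cis (t + y) - cis (t - y))) powr p"
    by (rule powr_mult)
  finally show ?thesis
    unfolding dquot_def by (simp add: ennreal_mult[symmetric] ennreal_leI)
qed

text \<open>Polar coordinates with \<open>r = exp (- y)\<close>: for \<open>y > c\<close> the slope
  is bounded, for \<open>y <= c\<close> it is dominated by the Douglas quotient, and the remaining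
  integral in \<open>t\<close> and \<open>y\<close> is that of \<open>douglas_strip\<close>.\<close>

lemma energy_finite:
  assumes psi: "\<And>x y. cmod (\<psi> (cis x) - \<psi> (cis y)) = cmod (cis (a x) - cis (a y))"
    and m: "(\<lambda>s. \<psi> (cis s)) \<in> borel_measurable borel" and d: "douglas p \<psi>" and p: "p > 0" and K: "K \<ge> 0"
  shows "(\<integral>\<^sup>+z\<in>ball 0 1. ennreal ((K * (1 + 4 * slope_at a z)) powr p) \<partial>lborel) < \<infinity>"
proof -
  note [measurable] = borel_measurable_slope_at borel_measurable_dquot[OF m]
  obtain M where M: "\<And>x. \<bar>a x - x\<bar> \<le> M" using ex_bound by blast
  obtain c where c: "c > 0" "c \<le> 1"
    and osc: "\<And>x y. 0 \<le> x \<Longrightarrow> x \<le> 2 * pi \<Longrightarrow> 0 \<le> y \<Longrightarrow> y \<le> c \<Longrightarrow> a (x + y) - a (x - y) \<le> pi"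
    using small_oscillation by blast
  \<comment> \<open>The constants of \<open>split\<close>: \<open>1 + 4 * x\<close> is at most 2 if
    \<open>4 * x <= 1\<close>, and at most \<open>8 * x\<close> otherwise.\<close>
  define A A' where "A = (2 * K) powr p" and "A' = (8 * K) powr p"
  define C where "C = A + A' * (1 + M / c) powr p"
  have A: "0 \<le> A" "0 \<le> A'" "0 \<le> C" by (auto simp: A_def A'_def C_def)
  have split: "(K * (1 + 4 * x)) powr p \<le> A + A' * x powr p" if "x \<ge> 0" for x
  proof (cases "4 * x \<le> 1")
    case True
    have "(K * (1 + 4 * x)) powr p \<le> (2 * K) powr p"
      using True that K p mult_left_mono[OF True K] by (intro powr_mono2) (auto simp: algebra_simps)
    then show ?thesis by (simp add: A_def A'_def add_increasing2)
  next
    case False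
    have "(K * (1 + 4 * x)) powr p \<le> (8 * K * x) powr p"
      using False that K p mult_left_mono[of 1 "4 * x" K] by (intro powr_mono2) (auto simp: algebra_simps)
    also have "\<dots> = A' * x powr p" using K that by (simp add: A'_def powr_mult)
    finally show ?thesis by (simp add: A_def add_increasing)
  qed
  \<comment> \<open>The collar part. Its outer radius 1 is written \<open>exp 0\<close> to match the
    substitution \<open>r = exp x\<close>.\<close>
  define S where "S t r = ennreal (slope a t (- ln r) powr p) * ennreal r * indicator {exp (- c)..exp 0} r" for t r
  have inner: "(\<integral>\<^sup>+r\<in>{0<..}. ennreal ((K * (1 + 4 * slope_at a (of_real r * cis t))) powr p) * indicator (ball 0 1) (of_real r * cis t) * ennreal r \<partial>lborel)
      \<le> ennreal C + ennreal A' * (ennreal ((pi / 2) powr p) * (\<integral>\<^sup>+y\<in>{0..c}. dquot p \<psi> (t + y) (t - y) \<partial>lborel))"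
    if t: "t \<in> {0..2 * pi}" for t
  proof -
    have pt: "ennreal ((K * (1 + 4 * slope_at a (of_real r * cis t))) powr p) * indicator (ball 0 1) (of_real r * cis t) * ennreal r * indicator {0<..} r
        \<le> ennreal C * indicator {0..1} r + ennreal A' * S t r" for r
    proof (cases "0 < r \<and> r < 1")
      case True
      then have y: "- ln r > 0" by simp
      have s0: "slope a t (- ln r) \<ge> 0" by (rule slope_nonneg[OF y])
      have "(K * (1 + 4 * slope a t (- ln r))) powr p * r \<le> (A + A' * slope a t (- ln r) powr p) * r"
        using True by (intro mult_right_mono split s0) auto
      also have "\<dots> \<le> C + A' * (slope a t (- ln r) powr p * r * indicator {exp (- c)..exp 0} r)"
      proof (cases "r \<ge> exp (- c)")
        case True': True
        have "A * r \<le> C" using mult_left_mono[of r 1 A] A True by (simp add: C_def add_increasing2)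
        then show ?thesis using True' True by (simp add: algebra_simps)
      next
        case False
        then have "ln r < ln (exp (- c))" using True by (subst ln_less_cancel_iff) auto
        then have "slope a t (- ln r) \<le> 1 + M / c" by (intro slope_le M c) auto
        then have "slope a t (- ln r) powr p \<le> (1 + M / c) powr p" using s0 p by (intro powr_mono2) auto
        then have "A + A' * slope a t (- ln r) powr p \<le> C"
          using A by (simp add: C_def mult_left_mono)
        then have "(A + A' * slope a t (- ln r) powr p) * r \<le> C * 1"
          using True A by (intro mult_mono) auto
        then show ?thesis using False by simp
      qed
      finally have "ennreal ((K * (1 + 4 * slope a t (- ln r))) powr p * r) \<le> ennreal (C + A' * (slope a t (- ln r) powr p * r * indicator {exp (- c)..exp 0} r))"
        by (rule ennreal_leI)
      also have "\<dots> = ennreal C + ennreal A' * S t r"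
        using A True by (simp add: S_def ennreal_mult indicator_def)
      finally show ?thesis
        using True by (simp add: slope_at_polar norm_mult ennreal_mult)
    qed (auto simp: norm_mult indicator_def)
    have "(\<integral>\<^sup>+r. S t r \<partial>lborel) = (\<integral>\<^sup>+x\<in>{- c..0}. (ennreal (slope a t (- ln (exp x)) powr p) * ennreal (exp x)) * ennreal (exp x) \<partial>lborel)"
      unfolding S_def using c
      by (intro nn_integral_substitution_aux) (auto intro!: DERIV_exp continuous_intros simp: slope_def)
    \<comment> \<open>One factor \<open>exp x\<close> stems from the area element, the other from
      the substitution; both are at most 1 for \<open>x <= 0\<close>.\<close>
    also have "\<dots> \<le> (\<integral>\<^sup>+x\<in>{- c..0}. ennreal (slope a t (- x) powr p) \<partial>lborel)"
    proof (rule nn_integral_mono)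
      fix x :: real
      show "(ennreal (slope a t (- ln (exp x)) powr p) * ennreal (exp x)) * ennreal (exp x) * indicator {- c..0} x \<le> ennreal (slope a t (- x) powr p) * indicator {- c..0} x"
      proof (cases "x \<le> 0")
        case True
        have "ennreal (exp x) * ennreal (exp x) \<le> 1"
          using True by (simp add: ennreal_mult[symmetric] mult_le_one)
        then show ?thesis
          using mult_left_mono[of "ennreal (exp x) * ennreal (exp x)" 1 "ennreal (slope a t (- x) powr p)"]
          by (auto simp: indicator_def mult.assoc)
      qed simp
    qed
    also have "\<dots> = (\<integral>\<^sup>+y\<in>{0..c}. ennreal (slope a t y powr p) \<partial>lborel)"
      unfolding slope_def by (subst nn_integral_real_affine[where c="-1" and t=0]) (auto intro!: nn_integral_cong simp: indicator_def)
    also have "\<dots> \<le> (\<integral>\<^sup>+y. ennreal ((pi / 2) powr p) * (dquot p \<psi> (t + y) (t - y) * indicator {0..c} y) \<partial>lborel)"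
    proof (rule nn_integral_mono)
      fix y :: real
      show "ennreal (slope a t y powr p) * indicator {0..c} y \<le> ennreal ((pi / 2) powr p) * (dquot p \<psi> (t + y) (t - y) * indicator {0..c} y)"
        using slope_le_dquot[OF psi, of y t p] osc[of t y] t c p by (auto simp: indicator_def)
    qed
    also have "\<dots> = ennreal ((pi / 2) powr p) * (\<integral>\<^sup>+y\<in>{0..c}. dquot p \<psi> (t + y) (t - y) \<partial>lborel)"
      by (rule nn_integral_cmult) simp
    finally have S: "(\<integral>\<^sup>+r. S t r \<partial>lborel) \<le> ennreal ((pi / 2) powr p) * (\<integral>\<^sup>+y\<in>{0..c}. dquot p \<psi> (t + y) (t - y) \<partial>lborel)" .
    have [measurable]: "S t \<in> borel_measurable borel" unfolding S_def slope_def by measurable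
    have "(\<integral>\<^sup>+r\<in>{0<..}. ennreal ((K * (1 + 4 * slope_at a (of_real r * cis t))) powr p) * indicator (ball 0 1) (of_real r * cis t) * ennreal r \<partial>lborel)
        \<le> (\<integral>\<^sup>+r. ennreal C * indicator {0..1} r + ennreal A' * S t r \<partial>lborel)"
      by (rule nn_integral_mono) (rule pt)
    also have "\<dots> = ennreal C + ennreal A' * (\<integral>\<^sup>+r. S t r \<partial>lborel)"
      by (simp add: nn_integral_add nn_integral_cmult nn_integral_cmult_indicator)
    also have "\<dots> \<le> ennreal C + ennreal A' * (ennreal ((pi / 2) powr p) * (\<integral>\<^sup>+y\<in>{0..c}. dquot p \<psi> (t + y) (t - y) \<partial>lborel))"
      by (intro add_left_mono mult_left_mono S) simp
    finally show ?thesis .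
  qed
  have "(\<integral>\<^sup>+z\<in>ball 0 1. ennreal ((K * (1 + 4 * slope_at a z)) powr p) \<partial>lborel)
     = (\<integral>\<^sup>+t\<in>{0..2 * pi}. (\<integral>\<^sup>+r\<in>{0<..}. ennreal ((K * (1 + 4 * slope_at a (of_real r * cis t))) powr p) * indicator (ball 0 1) (of_real r * cis t) * ennreal r \<partial>lborel) \<partial>lborel)"
  proof (rule nn_integral_polar)
    have [measurable]: "ball 0 1 \<in> sets (borel :: complex measure)" by simp
    show "(\<lambda>z. ennreal ((K * (1 + 4 * slope_at a z)) powr p) * indicator (ball 0 1) z) \<in> borel_measurable borel"
      by measurable
  qed
  also have "\<dots> \<le> (\<integral>\<^sup>+t. ennreal C * indicator {0..2 * pi} t + (ennreal A' * ennreal ((pi / 2) powr p)) * ((\<integral>\<^sup>+y\<in>{0..c}. dquot p \<psi> (t + y) (t - y) \<partial>lborel) * indicator {0..2 * pi} t) \<partial>lborel)"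
  proof (rule nn_integral_mono)
    fix t :: real
    show "(\<integral>\<^sup>+r\<in>{0<..}. ennreal ((K * (1 + 4 * slope_at a (of_real r * cis t))) powr p) * indicator (ball 0 1) (of_real r * cis t) * ennreal r \<partial>lborel) * indicator {0..2 * pi} t
        \<le> ennreal C * indicator {0..2 * pi} t + (ennreal A' * ennreal ((pi / 2) powr p)) * ((\<integral>\<^sup>+y\<in>{0..c}. dquot p \<psi> (t + y) (t - y) \<partial>lborel) * indicator {0..2 * pi} t)"
      using inner[of t] by (cases "t \<in> {0..2 * pi}") (simp_all add: mult.assoc)
  qed
  also have "\<dots> = ennreal C * emeasure lborel {0..2 * pi} + (ennreal A' * ennreal ((pi / 2) powr p)) * (\<integral>\<^sup>+t\<in>{0..2 * pi}. (\<integral>\<^sup>+y\<in>{0..c}. dquot p \<psi> (t + y) (t - y) \<partial>lborel) \<partial>lborel)"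
    by (subst nn_integral_add) (auto simp: nn_integral_cmult nn_integral_cmult_indicator)
  also have "\<dots> < \<infinity>"
    using douglas_strip[OF m d, of c] c pi_gt3 by (auto simp: ennreal_mult_less_top ennreal_add_less_top)
  finally show ?thesis .
qed

end

section \<open>The extension on the closed disk and its Sobolev class\<close>

context lift_pair
begin

lemma half_equivariant: "\<exists>M. equivariant (half_map a b s) s M"
proof -
  obtain M where "\<And>z. \<bar>Im (half_map a b s z) - Im z\<bar> \<le> M" using half_Im_approx by blast
  then show ?thesis
    by (intro exI[of _ M] equivariant.intro continuous_half s half_shift)
qed

lemma disk_map_sphere: "disk_map (half_map a b s) (cis x) = cis (s * a x)"
proof -
  obtain M where "equivariant (half_map a b s) s M" using half_equivariant by blast
  from equivariant.disk_map_exp[OF this, of "of_real x"] show ?thesis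
    by (simp add: half_real cis_conv_exp)
qed

lemma disk_map_cball: "cmod w \<le> 1 \<Longrightarrow> cmod (disk_map (half_map a b s) w) \<le> 1"
proof (cases "w = 0")
  case True
  then show ?thesis by (simp add: disk_map_def)
next
  case False
  assume "cmod w \<le> 1"
  then have "Im (- \<i> * Ln w) \<ge> 0" using False by (simp add: ln_le_zero_iff)
  from half_Im[OF this] show ?thesis using False by (simp add: disk_map_def norm_exp_eq_Re)
qed

text \<open>The slope bound of the half-plane map descends to the disk with the extra factor
  \<open>exp M\<close>; this is \<open>B\<close>. \<open>energy_finite\<close> integrates its
  \<open>p\<close>-th power, and \<open>slope_le\<close> bounds it on smaller disks.\<close>

lemma disk_map_sobolev:
  assumes phi: "\<And>x. \<phi> (cis x) = cis (s * a x)" and d: "douglas p \<phi>" and p: "p > 0"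
  shows "sobolev_W1 p (ball 0 1) (disk_map (half_map a b s))"
proof -
  obtain M where "equivariant (half_map a b s) s M" using half_equivariant by blast
  then interpret equivariant "half_map a b s" s M .
  obtain M' where M': "\<And>x. \<bar>a x - x\<bar> \<le> M'" using A.ex_bound by blast
  define B where "B z = exp M * (1 + 4 * slope_at a z)" for z
  show ?thesis
  proof (rule sobolev_of_derivative_bound[OF continuous_disk_map p, where B=B])
    fix z :: complex assume z: "z \<noteq> 0" "cmod z < 1"
    define z0 where "z0 = - \<i> * Ln z"
    have ez: "z = exp (\<i> * z0)" using z by (simp add: z0_def)
    have "Im z0 > 0" using z by (simp add: z0_def)
    then obtain D where D: "(half_map a b s has_derivative D) (at z0)" "\<And>v. cmod (D v) \<le> (1 + 4 * slope a (Re z0) (Im z0)) * cmod v"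
      using half_has_derivative by blast
    have "slope a (Re z0) (Im z0) = slope_at a z" using A.slope_at_exp[of z0] ez by simp
    with disk_map_has_derivative[OF D] ez
    show "\<exists>D. (disk_map (half_map a b s) has_derivative D) (at z) \<and> (\<forall>v. cmod (D v) \<le> B z * cmod v)"
      unfolding B_def by simp
  next
    fix R :: real assume R: "R < 1"
    show "\<exists>C. \<forall>z. z \<noteq> 0 \<longrightarrow> cmod z \<le> R \<longrightarrow> B z \<le> C"
    proof (intro exI allI impI)
      fix z :: complex assume z: "z \<noteq> 0" "cmod z \<le> R"
      then have "R > 0" using order_less_le_trans[of 0 "cmod z" R] by simp
      then have "slope_at a z \<le> 1 + M' / (- ln R)"
        unfolding slope_at_def using z R by (intro A.slope_le M') auto
      then show "B z \<le> exp M * (1 + 4 * (1 + M' / (- ln R)))" by (simp add: B_def)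
    qed
  next
    have "continuous_on UNIV (\<lambda>x. cis (s * a x))"
      by (intro continuous_intros A.continuous_a)
    then have "(\<lambda>x. \<phi> (cis x)) \<in> borel_measurable borel"
      unfolding phi by (rule borel_measurable_continuous_onI)
    moreover have "cmod (\<phi> (cis x) - \<phi> (cis y)) = cmod (cis (a x) - cis (a y))" for x y
    proof (cases "s = 1")
      \<comment> \<open>Here \<open>s = -1\<close>, and reversing both angles is complex
        conjugation.\<close>
      case False
      then have "\<phi> (cis x) - \<phi> (cis y) = cnj (cis (a x) - cis (a y))"
        using s by (auto simp: phi cis_cnj)
      then show ?thesis by (metis complex_mod_cnj)
    qed (simp add: phi)
    ultimately show "(\<integral>\<^sup>+z\<in>ball 0 1. ennreal (B z powr p) \<partial>lborel) < \<infinity>"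
      unfolding B_def by (intro A.energy_finite[where \<psi>=\<phi>]) (use d p in auto)
  qed
qed

lemma disk_map_inverse: "disk_map (half_map b a s) (disk_map (half_map a b s) w) = w"
proof -
  obtain M where M: "equivariant (half_map a b s) s M" using half_equivariant by blast
  obtain M' where M': "equivariant (half_map b a s) s M'" using lift_pair.half_equivariant[OF swap] by blast
  show ?thesis by (rule disk_map_comp[OF M' M half_half])
qed

lemma disk_map_homeomorphism:
  "homeomorphism (cball 0 1) (cball 0 1) (disk_map (half_map a b s)) (disk_map (half_map b a s))"
proof -
  obtain M where M: "equivariant (half_map a b s) s M" using half_equivariant by blast
  obtain M' where M': "equivariant (half_map b a s) s M'" using lift_pair.half_equivariant[OF swap] by blast
  show ?thesis
  proof (rule homeomorphismI)
    show "continuous_on (cball 0 1) (disk_map (half_map a b s))" "continuous_on (cball 0 1) (disk_map (half_map b a s))"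
      using equivariant.continuous_disk_map[OF M] equivariant.continuous_disk_map[OF M'] continuous_on_subset by blast+
  qed (use disk_map_cball lift_pair.disk_map_cball[OF swap] disk_map_inverse lift_pair.disk_map_inverse[OF swap] in auto)
qed

end

section \<open>Increasing lifts of a circle homeomorphism and its inverse\<close>

text \<open>The line is contractible, so \<open>\<phi> (cis x)\<close> has a continuous logarithm.
  Its real part vanishes since the modulus is 1, and its imaginary part is the lift.\<close>

lemma circle_lift_exists:
  fixes \<phi> :: "complex \<Rightarrow> complex"
  assumes "continuous_on (sphere 0 1) \<phi>" "\<phi> ` sphere 0 1 \<subseteq> sphere 0 1"
  shows "\<exists>f. continuous_on UNIV f \<and> (\<forall>x. \<phi> (cis x) = cis (f x))"
proof -
  have "continuous_on UNIV (\<lambda>x. \<phi> (cis x))"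
    by (rule continuous_on_compose2[OF assms(1)]) (auto intro: continuous_intros)
  moreover have n: "cmod (\<phi> (cis x)) = 1" for x
    using assms(2) by (metis dist_0_norm image_subset_iff mem_sphere norm_cis)
  ultimately obtain g where g: "continuous_on UNIV g" "\<And>x. \<phi> (cis x) = exp (g x)"
    using continuous_logarithm_on_contractible[of UNIV "\<lambda>x. \<phi> (cis x)"] n by (metis UNIV_I contractible_UNIV norm_zero zero_neq_one)
  have "cis (Im (g x)) = \<phi> (cis x)" for x
    using n[of x] unfolding g(2) by (simp add: norm_exp_eq_Re complex_eq_iff Re_exp Im_exp)
  moreover have "continuous_on UNIV (\<lambda>x. Im (g x))" by (intro continuous_intros g)
  ultimately show ?thesis by metis
qed

lemma cis_eq_iff: "cis x = cis y \<longleftrightarrow> (\<exists>n::int. x = y + 2 * pi * of_int n)"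
proof -
  have "cis x = cis y \<longleftrightarrow> exp (\<i> * of_real x) = exp (\<i> * of_real y)" by (simp add: cis_conv_exp)
  also have "\<dots> \<longleftrightarrow> (\<exists>n::int. x = y + 2 * pi * of_int n)"
    unfolding exp_eq by (auto simp: complex_eq_iff algebra_simps)
  finally show ?thesis .
qed

text \<open>Distinct values are at least \<open>2 * pi\<close> apart, so a continuous function on
  the connected line attains only one.\<close>

lemma continuous_int_multiple_constant:
  assumes "continuous_on UNIV (f :: real \<Rightarrow> real)" "\<And>x. \<exists>n::int. f x = 2 * pi * of_int n"
  shows "\<exists>n::int. \<forall>x. f x = 2 * pi * of_int n"
proof -
  have "f constant_on UNIV"
  proof (rule continuous_discrete_range_constant[OF connected_UNIV assms(1)])
    fix x :: real
    have "2 * pi \<le> norm (f y - f x)" if ne: "f y \<noteq> f x" for y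
    proof -
      obtain m n :: int where mn: "f y = 2 * pi * of_int m" "f x = 2 * pi * of_int n" using assms(2) by metis
      then have "1 \<le> \<bar>m - n\<bar>" using ne by auto
      then have "(1::real) \<le> \<bar>of_int m - of_int n\<bar>" by (metis of_int_1_le_iff of_int_abs of_int_diff)
      then show ?thesis unfolding mn by (simp add: right_diff_distrib[symmetric] abs_mult)
    qed
    then show "\<exists>e>0. \<forall>y. y \<in> UNIV \<and> f y \<noteq> f x \<longrightarrow> e \<le> norm (f y - f x)"
      using pi_gt_zero by (intro exI[of _ "2 * pi"]) auto
  qed
  then show ?thesis using assms(2) by (metis UNIV_I constant_on_def)
qed

text \<open>Lifts of the two maps compose to the identity up to a constant multiple of
  \<open>2 * pi\<close>, which is absorbed into one of them. The degrees multiply to 1, so both are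
  1 or both are -1; multiplying by this sign makes both lifts increasing.\<close>

lemma circle_lift_pair_exists:
  assumes "homeomorphism (sphere 0 1) (sphere 0 1) \<phi> \<psi>"
  shows "\<exists>a b s. lift_pair a b s \<and> (\<forall>x. \<phi> (cis x) = cis (s * a x)) \<and> (\<forall>x. \<psi> (cis x) = cis (s * b x))"
proof -
  note hom = assms[unfolded homeomorphism_def]
  obtain f where f: "continuous_on UNIV f" "\<And>x. \<phi> (cis x) = cis (f x)"
    using circle_lift_exists[of \<phi>] hom by auto
  obtain g0 where g0: "continuous_on UNIV g0" "\<And>x. \<psi> (cis x) = cis (g0 x)"
    using circle_lift_exists[of \<psi>] hom by auto
  have "\<psi> (\<phi> (cis x)) = cis x" for x using hom by simp
  then have "cis (g0 (f x)) = cis x" for x by (simp add: f g0)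
  then have mult: "\<exists>n::int. g0 (f x) - x = 2 * pi * of_int n" for x
    unfolding cis_eq_iff by (metis add_diff_cancel_left')
  have "continuous_on UNIV (\<lambda>x. g0 (f x) - x)"
    by (intro continuous_intros continuous_on_compose2[OF g0(1)] f) auto
  from continuous_int_multiple_constant[OF this mult]
  obtain k :: int where k: "\<And>x. g0 (f x) - x = 2 * pi * of_int k" by blast
  define g where "g x = g0 x - 2 * pi * of_int k" for x
  have g: "continuous_on UNIV g" "\<psi> (cis x) = cis (g x)" for x
  proof -
    show "continuous_on UNIV g" unfolding g_def by (intro continuous_intros g0)
    have "cis (g x) = cis (g0 x)"
      unfolding cis_eq_iff g_def by (rule exI[of _ "- k"]) simp
    then show "\<psi> (cis x) = cis (g x)" by (simp add: g0)
  qed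
  have gf: "g (f x) = x" for x using k[of x] by (simp add: g_def)
  have "\<phi> (\<psi> (cis x)) = cis x" for x using hom by simp
  then have "cis (f (g x)) = cis x" for x by (simp add: f g)
  then have mult': "\<exists>n::int. f (g x) - x = 2 * pi * of_int n" for x
    unfolding cis_eq_iff by (metis add_diff_cancel_left')
  have "continuous_on UNIV (\<lambda>x. f (g x) - x)"
    by (intro continuous_intros continuous_on_compose2[OF f(1)] g) auto
  from continuous_int_multiple_constant[OF this mult']
  obtain l :: int where l: "\<And>x. f (g x) - x = 2 * pi * of_int l" by blast
  \<comment> \<open>No second correction arises: since \<open>g (f 0) = 0\<close>, evaluation at
    \<open>f 0\<close> shows that the constant is zero.\<close>
  have "2 * pi * of_int l = (0::real)" using l[of "f 0"] gf[of 0] by simp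
  then have fg: "f (g x) = x" for x using l[of x] by simp
  have degree: "\<exists>d::int. \<forall>x. u (x + 2 * pi) = u x + 2 * pi * of_int d"
    if u: "continuous_on UNIV u" "\<And>x. \<theta> (cis x) = cis (u x)" for u :: "real \<Rightarrow> real" and \<theta>
  proof -
    have "cis (u (x + 2 * pi)) = cis (u x)" for x
      using u(2)[of "x + 2 * pi"] u(2)[of x] by (simp add: cis_2pi)
    then have mult: "\<exists>n::int. u (x + 2 * pi) - u x = 2 * pi * of_int n" for x
      unfolding cis_eq_iff by (metis add_diff_cancel_left')
    have "continuous_on UNIV (\<lambda>x. u (x + 2 * pi) - u x)"
      by (intro continuous_intros continuous_on_compose2[OF u(1)]) auto
    from continuous_int_multiple_constant[OF this mult]
    obtain d :: int where "\<And>x. u (x + 2 * pi) - u x = 2 * pi * of_int d" by blast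
    then show ?thesis by (metis add.commute diff_add_cancel)
  qed
  obtain d :: int where d: "\<And>x. f (x + 2 * pi) = f x + 2 * pi * of_int d" using degree[OF f] by auto
  obtain e :: int where e: "\<And>x. g (x + 2 * pi) = g x + 2 * pi * of_int e" using degree[OF g] by auto
  have eZ: "g (x + 2 * pi * of_int n) = g x + 2 * pi * of_int e * of_int n" for x and n :: int
    using int_translate[of g "2 * pi" "2 * pi * of_int e" x n] e by (simp add: mult_ac)
  \<comment> \<open>Degrees are multiplicative: one period, sent through \<open>f\<close> and then
    \<open>g\<close>, becomes \<open>e * d\<close> periods.\<close>
  have "2 * pi = g (f (0 + 2 * pi)) - g (f 0)" by (simp add: gf)
  also have "\<dots> = 2 * pi * of_int (e * d)" unfolding d eZ by simp
  finally have "of_int (e * d) = (1 :: real)" by simp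
  then have "e * d = 1" by (simp only: of_int_eq_1_iff)
  then have ed: "(e = 1 \<and> d = 1) \<or> (e = -1 \<and> d = -1)"
    by (simp add: zmult_eq_1_iff)
  have injf: "inj f" and injg: "inj g" using gf fg by (metis injI)+
  \<comment> \<open>An injective continuous lift is strictly monotone; comparing its values at 0 and
    \<open>2 * pi\<close> identifies the direction with the sign of the degree.\<close>
  have monotone: "mono (\<lambda>x. of_int d * u x)" if "continuous_on UNIV u" "inj u" "\<And>x. u (x + 2 * pi) = u x + 2 * pi * of_int d"
    for u :: "real \<Rightarrow> real"
  proof -
    have "strict_mono_on UNIV u \<or> strict_antimono_on UNIV u"
      using injective_eq_monotone_map[of UNIV u] that by simp
    then show ?thesis
    proof
      assume u: "strict_mono_on UNIV u"
      then have "u 0 < u (0 + 2 * pi)" using pi_gt_zero by (intro strict_mono_onD[OF u]) auto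
      then have "d = 1" using ed unfolding that(3) by auto
      then show ?thesis using u by (auto intro!: monoI simp: strict_mono_on_leD)
    next
      assume u: "strict_antimono_on UNIV u"
      then have "u 0 > u (0 + 2 * pi)" using pi_gt_zero by (auto simp: monotone_on_def)
      then have "d = -1" using ed unfolding that(3) by auto
      then show ?thesis using u by (auto intro!: monoI simp: monotone_on_def order_le_less)
    qed
  qed
  have "e = d" using ed by auto
  define s :: real where "s = of_int d"
  have s: "s = 1 \<or> s = -1" "s * s = 1" using ed by (auto simp: s_def)
  have "lift_pair (\<lambda>x. s * f x) (\<lambda>x. s * g x) s"
  proof unfold_locales
    show "continuous_on UNIV (\<lambda>x. s * f x)" "continuous_on UNIV (\<lambda>x. s * g x)"
      by (intro continuous_intros f g)+
    show "mono (\<lambda>x. s * f x)" "mono (\<lambda>x. s * g x)"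
      unfolding s_def using monotone[OF f(1) injf d] monotone[OF g(1) injg] e \<open>e = d\<close> by auto
    show "s * f (x + 2 * pi) = s * f x + 2 * pi" "s * g (x + 2 * pi) = s * g x + 2 * pi" for x
      using s \<open>e = d\<close> unfolding d e by (auto simp: s_def[symmetric])
    show "s = 1 \<or> s = -1" by fact
    have "s * (s * x) = x" for x using s(2) by (simp add: mult.assoc[symmetric])
    then show "s * g (s * (s * f x)) = s * x" "s * f (s * (s * g x)) = s * x" for x
      by (simp_all only: gf fg)
  qed
  moreover have ss: "s * (s * x) = x" for x using s(2) by (simp add: mult.assoc[symmetric])
  have "\<forall>x. \<phi> (cis x) = cis (s * (s * f x))" "\<forall>x. \<psi> (cis x) = cis (s * (s * g x))"
    by (simp_all only: ss f(2) g(2) simp_thms)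
  ultimately show ?thesis by blast
qed

theorem extension_exists:
  assumes "homeomorphism (sphere 0 1) (sphere 0 1) \<phi> \<phi>inv" and "p > 0" and "q > 0"
    and "douglas p \<phi>" "douglas q \<phi>inv"
  shows "\<exists>h hinv. homeomorphism (cball 0 1) (cball 0 1) h hinv \<and> (\<forall>z\<in>sphere 0 1. h z = \<phi> z) \<and>
       sobolev_W1 p (ball 0 1) h \<and> sobolev_W1 q (ball 0 1) hinv"
proof -
  obtain a b s where l: "lift_pair a b s" and ab: "\<And>x. \<phi> (cis x) = cis (s * a x)" "\<And>x. \<phi>inv (cis x) = cis (s * b x)"
    using circle_lift_pair_exists[OF assms(1)] by blast
  have "disk_map (half_map a b s) z = \<phi> z" if "z \<in> sphere 0 1" for z
  proof -
    have "z = cis (Arg z)" using that Arg_eq[of z] by (force simp: cis_conv_exp)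
    then show ?thesis using lift_pair.disk_map_sphere[OF l, of "Arg z"] ab(1)[of "Arg z"] by simp
  qed
  moreover have "sobolev_W1 p (ball 0 1) (disk_map (half_map a b s))"
    by (rule lift_pair.disk_map_sobolev[OF l ab(1)]) (use assms in auto)
  moreover have "sobolev_W1 q (ball 0 1) (disk_map (half_map b a s))"
    by (rule lift_pair.disk_map_sobolev[OF lift_pair.swap[OF l] ab(2)]) (use assms in auto)
  ultimately show ?thesis using lift_pair.disk_map_homeomorphism[OF l] by blast
qed

section \<open>The trace inequality\<close>

text \<open>The powers \<open>j\<close> make the family closed under differentiation.\<close>
definition exp_cut :: "nat \<Rightarrow> real \<Rightarrow> real" where
  "exp_cut j x = (if x > 0 then exp (- 1 / x) / x ^ j else 0)"

lemma exp_cut_nonneg [simp]: "exp_cut j x \<ge> 0"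
  by (simp add: exp_cut_def)

text \<open>A single term of the series bounds \<open>exp (1 / x)\<close> below by
  \<open>(1 / x) ^ (j + 2) / fact (j + 2)\<close>. The two spare powers make the difference quotient
  at 0 tend to 0, which gives differentiability there.\<close>

lemma exp_cut_le_square: "\<bar>exp_cut j x\<bar> \<le> fact (j + 2) * x\<^sup>2"
proof (cases "x > 0")
  case True
  have "exp_cut j x \<ge> 0" by simp
  have "(1/x) ^ (j+2) / fact (j+2) \<le> exp (1/x)"
  proof -
    have s: "(\<lambda>n. (1/x) ^ n /\<^sub>R fact n) sums exp (1/x)"
      by (rule exp_converges)
    have "sum (\<lambda>n. (1/x) ^ n /\<^sub>R fact n) {j+2} \<le> exp (1/x)"
      by (rule sum_le_suminf[of "\<lambda>n. (1/x) ^ n /\<^sub>R fact n" "{j+2}", unfolded sums_unique[OF s, symmetric]])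
         (use True sums_summable[OF s] in auto)
    then show ?thesis by (simp add: divide_inverse mult.commute)
  qed
  moreover have "x ^ (j+2) * fact (j+2) > 0"
    using True by simp
  ultimately have "1 \<le> fact (j+2) * exp (1/x) * x ^ (j+2)"
    by (simp add: power_one_over divide_le_eq mult_ac del: fact_Suc add_2_eq_Suc')
  then have "exp (-1/x) \<le> fact (j+2) * x ^ (j+2)"
    by (simp add: exp_minus inverse_eq_divide divide_le_eq mult_ac del: fact_Suc add_2_eq_Suc')
  then have "exp (-1/x) / x ^ j \<le> fact (j+2) * x\<^sup>2"
    using True by (simp add: divide_le_eq power_add mult_ac del: fact_Suc add_2_eq_Suc')
  then show ?thesis using True by (simp add: exp_cut_def)
qed (simp add: exp_cut_def)

lemma exp_cut_deriv:
  "(exp_cut j has_real_derivative exp_cut (j+2) x - real j * exp_cut (j+1) x) (at x)"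
proof (cases x "0::real" rule: linorder_cases)
  case less
  have "((\<lambda>_. 0) has_real_derivative 0) (at x)" by simp
  then have "(exp_cut j has_real_derivative 0) (at x)"
  proof (rule has_field_derivative_transform_within_open[where S="{..<0}"])
  qed (use less in \<open>auto simp: exp_cut_def\<close>)
  then show ?thesis using less by (simp add: exp_cut_def)
next
  case equal
  have "((\<lambda>h. exp_cut j h / h) \<longlongrightarrow> 0) (at 0)"
  proof (rule Lim_null_comparison[where g="\<lambda>h. fact (j+2) * \<bar>h\<bar>"])
    have "norm (exp_cut j h / h) \<le> fact (j + 2) * \<bar>h\<bar>" if "h \<noteq> 0" for h
    proof -
      have "\<bar>exp_cut j h\<bar> \<le> fact (j+2) * \<bar>h\<bar> * \<bar>h\<bar>"
        using exp_cut_le_square[of j h] by (simp add: power2_eq_square mult.assoc abs_mult[symmetric])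
      then show ?thesis using that by (simp add: abs_div pos_divide_le_eq)
    qed
    then show "\<forall>\<^sub>F h in at 0. norm (exp_cut j h / h) \<le> fact (j + 2) * \<bar>h\<bar>"
      by (auto simp: eventually_at_filter)
    show "((\<lambda>h. fact (j + 2) * \<bar>h\<bar>) \<longlongrightarrow> 0) (at (0::real))"
      by (rule tendsto_eq_intros refl | simp)+
  qed
  then have "(exp_cut j has_real_derivative 0) (at 0)"
    by (simp add: has_field_derivative_iff exp_cut_def[of j 0])
  then show ?thesis using equal by (simp add: exp_cut_def)
next
  case greater
  have "((\<lambda>x. exp (- 1 / x) / x ^ j) has_real_derivative exp_cut (j+2) x - real j * exp_cut (j+1) x) (at x)"
    using greater
    apply (auto intro!: derivative_eq_intros simp: exp_cut_def)
    apply (cases j)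
    apply (auto simp: field_simps power2_eq_square)
    done
  then show ?thesis
  proof (rule has_field_derivative_transform_within_open[where S="{0<..}"])
  qed (use greater in \<open>auto simp: exp_cut_def\<close>)
qed

text \<open>The invariant for proving \<open>smooth_fun\<close> by coinduction.\<close>
inductive bump_algebra :: "(complex \<Rightarrow> real) \<Rightarrow> bool" where
  const: "bump_algebra (\<lambda>z. c)"
| Re: "bump_algebra Re"
| Im: "bump_algebra Im"
| cut: "bump_algebra (\<lambda>z. exp_cut j (e - ((Re z - a)\<^sup>2 + (Im z - b)\<^sup>2)))"
| add: "bump_algebra f \<Longrightarrow> bump_algebra g \<Longrightarrow> bump_algebra (\<lambda>z. f z + g z)"
| mult: "bump_algebra f \<Longrightarrow> bump_algebra g \<Longrightarrow> bump_algebra (\<lambda>z. f z * g z)"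

text \<open>Differentiating a cut-off only raises its index by 1 or 2 and multiplies by polynomials
  in the coordinates, so every directional derivative stays in the algebra.\<close>

lemma bump_algebra_deriv:
  assumes "bump_algebra f"
  shows "\<exists>f'. (\<forall>z. (f has_derivative f' z) (at z)) \<and> (\<forall>v. bump_algebra (\<lambda>z. f' z v))"
  using assms
proof induction
  case (const c)
  show ?case by (rule exI[of _ "\<lambda>z v. 0"]) (auto intro: bump_algebra.const)
next
  case Re
  show ?case by (rule exI[of _ "\<lambda>z v. Re v"]) (auto intro: bump_algebra.const has_derivative_Re[OF has_derivative_ident, simplified])
next
  case Im
  show ?case by (rule exI[of _ "\<lambda>z v. Im v"]) (auto intro: bump_algebra.const has_derivative_Im[OF has_derivative_ident, simplified])
next
  case (cut j e a b)
  let ?q = "\<lambda>z. e - ((Re z - a)\<^sup>2 + (Im z - b)\<^sup>2)"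
  let ?D = "\<lambda>z v. (exp_cut (j+2) (?q z) + (- real j) * exp_cut (j+1) (?q z)) *
                    ((-2 * Re v) * (Re z + (-a)) + (-2 * Im v) * (Im z + (-b)))"
  have "((\<lambda>z. exp_cut j (?q z)) has_derivative ?D z) (at z)" for z
  proof -
    have "(?q has_derivative (\<lambda>v. -2 * Re v * (Re z - a) + -2 * Im v * (Im z - b))) (at z)"
      by (auto intro!: derivative_eq_intros)
    from diff_chain_at[OF this exp_cut_deriv[of j "?q z", unfolded has_field_derivative_def]]
    show ?thesis by (simp add: o_def algebra_simps)
  qed
  moreover have "bump_algebra (\<lambda>z. ?D z v)" for v
    by (intro bump_algebra.intros)
  ultimately show ?case by (intro exI[of _ ?D]) blast
next
  case (add f g)
  then obtain f' g' where *: "\<And>z. (f has_derivative f' z) (at z)" "\<And>z. (g has_derivative g' z) (at z)"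
    "\<And>v. bump_algebra (\<lambda>z. f' z v)" "\<And>v. bump_algebra (\<lambda>z. g' z v)" by blast
  then show ?case
    by (intro exI[of _ "\<lambda>z v. f' z v + g' z v"]) (auto intro!: bump_algebra.add has_derivative_add)
next
  case (mult f g)
  then obtain f' g' where *: "\<And>z. (f has_derivative f' z) (at z)" "\<And>z. (g has_derivative g' z) (at z)"
    "\<And>v. bump_algebra (\<lambda>z. f' z v)" "\<And>v. bump_algebra (\<lambda>z. g' z v)" by blast
  then show ?case
    by (intro exI[of _ "\<lambda>z v. f z * g' z v + f' z v * g z"])
       (auto intro!: bump_algebra.add bump_algebra.mult has_derivative_mult mult.hyps)
qed

lemma bump_algebra_smooth: "bump_algebra f \<Longrightarrow> smooth_fun f"
proof (coinduction arbitrary: f)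
  case smooth_fun
  from bump_algebra_deriv[OF this] obtain f' where
    f': "\<And>z. (f has_derivative f' z) (at z)" "\<And>v. bump_algebra (\<lambda>z. f' z v)" by blast
  have "frechet_derivative f (at z) = f' z" for z
    using frechet_derivative_at[OF f'(1)] by simp
  then show ?case using f' by (auto simp: differentiable_def)
qed

definition bump :: "real \<Rightarrow> complex \<Rightarrow> real" where
  "bump e z = exp_cut 0 (e\<^sup>2 - (cmod z)\<^sup>2)"

text \<open>The partial derivatives of \<open>bump e\<close> are \<open>bump_x e\<close> and
  \<open>bump_y e\<close>; the index 2 appears because \<open>exp_cut 0\<close> has derivative
  \<open>exp_cut 2\<close>.\<close>

definition bump_x :: "real \<Rightarrow> complex \<Rightarrow> real" where
  "bump_x e z = - 2 * Re z * exp_cut 2 (e\<^sup>2 - (cmod z)\<^sup>2)"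

definition bump_y :: "real \<Rightarrow> complex \<Rightarrow> real" where
  "bump_y e z = - 2 * Im z * exp_cut 2 (e\<^sup>2 - (cmod z)\<^sup>2)"

lemma exp_cut_continuous: "continuous_on S (exp_cut j)"
  using exp_cut_deriv by (meson DERIV_isCont continuous_at_imp_continuous_on)

lemma bump_nonneg [simp]: "bump e z \<ge> 0"
  by (simp add: bump_def)

lemma bump_minus: "bump e (z - w) = bump e (w - z)"
  by (simp add: bump_def norm_minus_commute)

lemma bump_pos: "cmod z < e \<Longrightarrow> bump e z > 0"
  using power_strict_mono[of "cmod z" e 2] by (simp add: bump_def exp_cut_def)

lemma bump_eq_0: "e \<le> cmod z \<Longrightarrow> 0 < e \<Longrightarrow> bump e z = 0"
  by (force simp: bump_def exp_cut_def dest: power2_less_imp_less)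

lemma continuous_bump [continuous_intros]:
  assumes "continuous_on S f"
  shows "continuous_on S (\<lambda>x. bump e (f x))" "continuous_on S (\<lambda>x. bump_x e (f x))"
    "continuous_on S (\<lambda>x. bump_y e (f x))"
  unfolding bump_def bump_x_def bump_y_def
  by (intro continuous_intros continuous_on_compose2[OF exp_cut_continuous[of UNIV]] assms; simp)+

lemma bump_has_derivative:
  "(bump e has_derivative (\<lambda>v. Re v * bump_x e z + Im v * bump_y e z)) (at z)"
proof -
  have "((\<lambda>z. e\<^sup>2 - ((Re z)\<^sup>2 + (Im z)\<^sup>2)) has_derivative (\<lambda>v. -2 * Re v * Re z + -2 * Im v * Im z)) (at z)"
    by (auto intro!: derivative_eq_intros)
  from diff_chain_at[OF this exp_cut_deriv[of 0 "e\<^sup>2 - ((Re z)\<^sup>2 + (Im z)\<^sup>2)", unfolded has_field_derivative_def]]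
  show ?thesis
    by (simp add: o_def algebra_simps bump_def[abs_def] bump_x_def bump_y_def cmod_power2 del: add_2_eq_Suc')
qed

lemma bump_test_fun:
  assumes "e > 0" "cmod z + e < 1"
  shows "test_fun (ball 0 1) (\<lambda>w. bump e (z - w))"
proof -
  have "bump_algebra (\<lambda>w. exp_cut 0 (e\<^sup>2 - ((Re w - Re z)\<^sup>2 + (Im w - Im z)\<^sup>2)))"
    by (rule bump_algebra.cut)
  then have "smooth_fun (\<lambda>w. bump e (z - w))"
    using bump_algebra_smooth by (simp add: bump_def cmod_power2 power2_commute)
  moreover have sub: "closure {w. bump e (z - w) \<noteq> 0} \<subseteq> cball z e"
  proof (rule closure_minimal)
    show "{w. bump e (z - w) \<noteq> 0} \<subseteq> cball z e"
      using bump_eq_0[of e] assms(1) by (force simp: dist_norm)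
  qed simp
  moreover have "cball z e \<subseteq> ball 0 1"
  proof
    fix w assume "w \<in> cball z e"
    then have "cmod w \<le> cmod z + e"
      using norm_triangle_ineq2[of w z] by (auto simp: dist_norm norm_minus_commute)
    then show "w \<in> ball 0 1" using assms by simp
  qed
  moreover have "compact (closure {w. bump e (z - w) \<noteq> 0})"
    using sub by (metis bounded_cball bounded_subset closed_closure compact_eq_bounded_closed)
  ultimately show ?thesis by (auto simp: test_fun_def)
qed

section \<open>Jensen's and Hardy's inequalities for powers\<close>

text \<open>The graph of the convex function \<open>x powr p\<close> lies above its tangent at
  \<open>X\<close>. The terms are arranged so that no power is subtracted, which suits
  \<open>ennreal\<close> integrals.\<close>

lemma powr_tangent:
  fixes X y p :: real
  assumes p: "p > 1" and X: "X > 0" and y: "y \<ge> 0"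
  shows "p * X powr (p - 1) * y \<le> y powr p + (p - 1) * X powr p"
proof (cases "y = 0")
  case True
  then show ?thesis using p by simp
next
  case False
  have "p * X powr (p - 1) * (y - X) \<le> y powr p - X powr p"
  proof (rule convex_on_imp_above_tangent)
    show "convex_on {0<..} (\<lambda>x. x powr p)" using p by (intro powr_convex) simp
    show "((\<lambda>x. x powr p) has_field_derivative p * X powr (p - 1)) (at X within {0<..})"
      by (rule has_field_derivative_at_within[OF has_real_derivative_powr[OF X]])
  qed (use X y False in \<open>auto simp: interior_open\<close>)
  moreover have "p * X powr (p - 1) * (y - X) = p * X powr (p - 1) * y - p * (X powr (p - 1) * X)"
    by (simp add: algebra_simps)
  moreover have "X powr (p - 1) * X = X powr p" using X by (simp add: powr_diff)
  ultimately show ?thesis by (simp add: left_diff_distrib)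
qed

text \<open>Integrate \<open>powr_tangent\<close> at \<open>X\<close> against the probability
  density \<open>k\<close> and cancel the finite term \<open>(p - 1) * X powr p\<close>. Asking
  \<open>X\<close> to be at most the mean allows the mean to be infinite.\<close>

lemma jensen_powr:
  assumes [measurable]: "k \<in> borel_measurable M" "f \<in> borel_measurable M"
    and k: "(\<integral>\<^sup>+w. k w \<partial>M) = 1" and f: "\<And>w. w \<in> space M \<Longrightarrow> f w \<ge> 0" and p: "p > 1"
    and X: "X \<ge> 0" "ennreal X \<le> (\<integral>\<^sup>+w. k w * ennreal (f w) \<partial>M)"
  shows "ennreal (X powr p) \<le> (\<integral>\<^sup>+w. k w * ennreal (f w powr p) \<partial>M)"
proof (cases "X = 0")
  case True
  then show ?thesis using p by simp
next
  case False
  then have X0: "X > 0" using X by simp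
  have XX: "X powr (p - 1) * X = X powr p" using X0 by (simp add: powr_diff)
  have "ennreal (X powr p) + ennreal ((p - 1) * X powr p) = ennreal (p * X powr (p - 1) * X)"
  proof -
    have "X powr p + (p - 1) * X powr p = p * X powr (p - 1) * X"
      using XX by (simp add: algebra_simps)
    then show ?thesis using p by (subst ennreal_plus[symmetric]) auto
  qed
  also have "\<dots> = ennreal (p * X powr (p - 1)) * ennreal X"
    using p X by (simp add: ennreal_mult)
  also have "\<dots> \<le> ennreal (p * X powr (p - 1)) * (\<integral>\<^sup>+w. k w * ennreal (f w) \<partial>M)"
    by (intro mult_left_mono X) simp
  also have "\<dots> = (\<integral>\<^sup>+w. ennreal (p * X powr (p - 1)) * (k w * ennreal (f w)) \<partial>M)"
    by (rule nn_integral_cmult[symmetric]) simp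
  also have "\<dots> \<le> (\<integral>\<^sup>+w. k w * ennreal (f w powr p) + ennreal ((p - 1) * X powr p) * k w \<partial>M)"
  proof (rule nn_integral_mono)
    fix w assume "w \<in> space M"
    then have f0: "f w \<ge> 0" by (rule f)
    have "ennreal (p * X powr (p - 1)) * (k w * ennreal (f w)) = k w * ennreal (p * X powr (p - 1) * f w)"
      using p f0 by (simp add: ennreal_mult mult_ac)
    also have "\<dots> \<le> k w * ennreal (f w powr p + (p - 1) * X powr p)"
      by (intro mult_left_mono ennreal_leI powr_tangent p X0 f0) simp
    also have "\<dots> = k w * ennreal (f w powr p) + ennreal ((p - 1) * X powr p) * k w"
      using p by (simp add: ennreal_plus distrib_left mult.commute)
    finally show "ennreal (p * X powr (p - 1)) * (k w * ennreal (f w)) \<le> \<dots>" .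
  qed
  also have "\<dots> = (\<integral>\<^sup>+w. k w * ennreal (f w powr p) \<partial>M) + ennreal ((p - 1) * X powr p)"
    using k by (simp add: nn_integral_add nn_integral_cmult)
  finally show ?thesis
    by (simp add: ennreal_add_left_cancel_le add.commute)
qed

text \<open>Weighted Jensen's inequality for each \<open>t\<close>, then Tonelli. \<open>X\<close>
  stands for any increment bounded by the integral of \<open>f\<close>, here that of a function
  along a radius.\<close>

lemma hardy:
  fixes f :: "real \<Rightarrow> real"
  assumes [measurable]: "f \<in> borel_measurable borel" "X \<in> borel_measurable borel"
    and f: "\<And>t. f t \<ge> 0" and X: "\<And>t. 0 < t \<Longrightarrow> t \<le> c \<Longrightarrow> X t \<ge> 0"
      "\<And>t. 0 < t \<Longrightarrow> t \<le> c \<Longrightarrow> ennreal (X t) \<le> (\<integral>\<^sup>+s\<in>{0..t}. ennreal (f s) \<partial>lborel)"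
    and p: "p > 1"
  shows "(\<integral>\<^sup>+t\<in>{0<..c}. ennreal ((X t / t) powr p) \<partial>lborel)
      \<le> ennreal (2 powr p / (p - 1)) * (\<integral>\<^sup>+s\<in>{0..c}. ennreal (f s powr p) \<partial>lborel)"
proof -
  \<comment> \<open>With the uniform density \<open>1 / t\<close> the \<open>t\<close>-integral
    after Tonelli would be logarithmic in \<open>s\<close>. A density proportional to
    \<open>s powr (-1/2)\<close> leaves \<open>t powr (-(p + 1) / 2)\<close> instead, which is
    integrable at infinity because \<open>p > 1\<close>.\<close>
  define k where "k t s = (if 0 \<le> s \<and> s \<le> t then ennreal (s powr (-1/2) / (2 * sqrt t)) else 0)" for t s
  have kmeas [measurable]: "(\<lambda>z. k (g z) (h z)) \<in> borel_measurable N"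
    if [measurable]: "g \<in> borel_measurable N" "h \<in> borel_measurable N" for g h :: "_ \<Rightarrow> real" and N
    unfolding k_def by measurable
  have k1: "(\<integral>\<^sup>+s. k t s \<partial>lborel) = 1" if t: "t > 0" for t
  proof -
    have "((\<lambda>s. s powr (-1/2) / (2 * sqrt t)) has_integral (t powr (-1/2 + 1) / (-1/2 + 1)) / (2 * sqrt t)) {0..t}"
      using t by (intro has_integral_divide has_integral_powr_from_0) auto
    moreover have "(t powr (-1/2 + 1) / (-1/2 + 1)) / (2 * sqrt t) = 1"
      using t by (simp add: powr_half_sqrt)
    ultimately have "(\<integral>\<^sup>+s\<in>{0..t}. ennreal (s powr (-1/2) / (2 * sqrt t)) \<partial>lborel) = 1"
      using t by (subst nn_integral_has_integral_lebesgue'[where I=1]) auto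
    moreover have "k t s = ennreal (s powr (-1/2) / (2 * sqrt t)) * indicator {0..t} s" for s
      by (simp add: k_def indicator_def)
    ultimately show ?thesis by simp
  qed
  have pt: "ennreal ((X t / t) powr p) \<le> (\<integral>\<^sup>+s. k t s * ennreal ((2 * sqrt \<bar>s\<bar> / sqrt t * f s) powr p) \<partial>lborel)"
    if t: "0 < t" "t \<le> c" for t
  proof (rule jensen_powr)
    have "ennreal (X t / t) = ennreal (1 / t) * ennreal (X t)"
      using t X(1)[OF t] by (simp add: ennreal_mult[symmetric])
    also have "\<dots> \<le> ennreal (1 / t) * (\<integral>\<^sup>+s\<in>{0..t}. ennreal (f s) \<partial>lborel)"
      by (intro mult_left_mono X t) simp
    also have "\<dots> = (\<integral>\<^sup>+s. ennreal (1 / t) * (ennreal (f s) * indicator {0..t} s) \<partial>lborel)"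
      by (rule nn_integral_cmult[symmetric]) simp
    also have "\<dots> = (\<integral>\<^sup>+s. k t s * ennreal (2 * sqrt \<bar>s\<bar> / sqrt t * f s) \<partial>lborel)"
    proof (intro nn_integral_cong_AE eventually_mono[OF AE_lborel_singleton[of 0]])
      fix s :: real assume s: "s \<noteq> 0"
      show "ennreal (1 / t) * (ennreal (f s) * indicator {0..t} s) = k t s * ennreal (2 * sqrt \<bar>s\<bar> / sqrt t * f s)"
      proof (cases "s \<in> {0..t}")
        case True
        then have s0: "s > 0" using s by auto
        have "s powr (-1/2) * sqrt s = s powr (-1/2 + 1/2)"
          using s0 by (subst powr_add) (simp add: powr_half_sqrt)
        then have "s powr (-1/2) * sqrt s = 1" using s0 by simp
        moreover have "sqrt t * sqrt t = t" using t by simp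
        moreover have "s powr (-1/2) / (2 * sqrt t) * (2 * sqrt s / sqrt t * f s) = (s powr (-1/2) * sqrt s) * f s / (sqrt t * sqrt t)"
          by simp
        ultimately have eq: "s powr (-1/2) / (2 * sqrt t) * (2 * sqrt s / sqrt t * f s) = 1 / t * f s"
          by simp
        have "k t s * ennreal (2 * sqrt \<bar>s\<bar> / sqrt t * f s) = ennreal (s powr (-1/2) / (2 * sqrt t)) * ennreal (2 * sqrt s / sqrt t * f s)"
          using True s0 by (simp add: k_def)
        also have "\<dots> = ennreal (s powr (-1/2) / (2 * sqrt t) * (2 * sqrt s / sqrt t * f s))"
          by (rule ennreal_mult[symmetric]) (use f[of s] t s0 in auto)
        also have "\<dots> = ennreal (1 / t) * ennreal (f s)"
          unfolding eq by (rule ennreal_mult) (use f[of s] t in auto)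
        finally show ?thesis using True by simp
      qed (auto simp: k_def indicator_def)
    qed
    finally show "ennreal (X t / t) \<le> (\<integral>\<^sup>+s. k t s * ennreal (2 * sqrt \<bar>s\<bar> / sqrt t * f s) \<partial>lborel)" .
    show "(\<integral>\<^sup>+s. k t s \<partial>lborel) = 1" by (rule k1[OF t(1)])
    show "0 \<le> X t / t" using X(1)[OF t] t by simp
    show "0 \<le> 2 * sqrt \<bar>s\<bar> / sqrt t * f s" for s using f[of s] t by simp
  qed (measurable, rule p)
  define g where "g s = ennreal (f s powr p) * indicator {0..c} s" for s
  have [measurable]: "g \<in> borel_measurable borel" unfolding g_def by measurable
  \<comment> \<open>The \<open>t\<close>-dependent factor, extended to all \<open>t >= s\<close>.
    Its integral is \<open>2 / (p - 1)\<close> times a power of \<open>s\<close> that cancels the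
    one in \<open>kt\<close>; with the factor \<open>2 powr (p - 1)\<close> there this yields the
    final constant.\<close>
  define T where "T s t = (if 0 < s \<and> s \<le> t then ennreal (t powr (-(p + 1) / 2)) else 0)" for s t :: real
  have [measurable]: "(\<lambda>z. T (g z) (h z)) \<in> borel_measurable N"
    if [measurable]: "g \<in> borel_measurable N" "h \<in> borel_measurable N" for g h :: "_ \<Rightarrow> real" and N
    unfolding T_def by measurable
  have T: "(\<integral>\<^sup>+t. T s t \<partial>lborel) = ennreal (s powr (- (p - 1) / 2) * (2 / (p - 1)))" if s: "s > 0" for s
  proof -
    have e: "-(p + 1) / 2 + 1 = - (p - 1) / 2" by (simp add: field_simps)
    have "((\<lambda>t. t powr (-(p + 1) / 2)) has_integral - (s powr (-(p + 1) / 2 + 1)) / (-(p + 1) / 2 + 1)) {s..}"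
      using s p by (intro has_integral_powr_to_inf) auto
    from nn_integral_has_integral_lebesgue'[OF _ this[unfolded e]]
    have "(\<integral>\<^sup>+t\<in>{s..}. ennreal (t powr (-(p + 1) / 2)) \<partial>lborel) = ennreal (- (s powr (- (p - 1) / 2)) / (- (p - 1) / 2))"
      by simp
    moreover have "T s t = ennreal (t powr (-(p + 1) / 2)) * indicator {s..} t" for t
      using s by (simp add: T_def indicator_def)
    moreover have "- (s powr (- (p - 1) / 2)) / (- (p - 1) / 2) = s powr (- (p - 1) / 2) * (2 / (p - 1))"
      using p by (simp add: field_simps)
    ultimately show ?thesis by simp
  qed
  have kt: "k t s * ennreal ((2 * sqrt \<bar>s\<bar> / sqrt t * f s) powr p) * indicator {0<..c} t
      \<le> g s * ennreal (2 powr (p - 1) * s powr ((p - 1) / 2)) * T s t" if "s \<noteq> 0" for s t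
  proof (cases "0 < s \<and> s \<le> t \<and> t \<le> c")
    case True
    then have pos: "0 < s" "0 < t" by auto
    have "s powr (-1/2) / (2 * sqrt t) * (2 * sqrt s / sqrt t * f s) powr p
       = s powr (-1/2) / (2 * t powr (1/2)) * (2 powr p * (s powr (1/2)) powr p / (t powr (1/2)) powr p * f s powr p)"
      using pos f[of s] by (simp add: powr_mult powr_divide powr_half_sqrt)
    also have "\<dots> = f s powr p * ((2 powr p / 2) * (s powr (-1/2) * s powr (p / 2)) * (1 / (t powr (1/2) * t powr (p / 2))))"
      by (simp add: powr_powr field_simps)
    also have "s powr (-1/2) * s powr (p / 2) = s powr ((p - 1) / 2)"
      by (simp add: powr_add[symmetric] diff_divide_distrib)
    also have "t powr (1/2) * t powr (p / 2) = t powr ((p + 1) / 2)"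
      by (simp add: powr_add[symmetric] add_divide_distrib add.commute)
    also have "1 / t powr ((p + 1) / 2) = t powr (-(p + 1) / 2)"
      by (simp only: minus_divide_left[symmetric] powr_minus_divide)
    also have "2 powr p / 2 = 2 powr (p - 1)" by (simp add: powr_diff)
    finally have eq: "s powr (-1/2) / (2 * sqrt t) * (2 * sqrt s / sqrt t * f s) powr p
       = f s powr p * (2 powr (p - 1) * s powr ((p - 1) / 2)) * t powr (-(p + 1) / 2)" by (simp add: mult.assoc)
    have "k t s * ennreal ((2 * sqrt \<bar>s\<bar> / sqrt t * f s) powr p) * indicator {0<..c} t = ennreal (s powr (-1/2) / (2 * sqrt t) * (2 * sqrt s / sqrt t * f s) powr p)"
      using True pos by (simp add: k_def ennreal_mult[symmetric])
    also have "\<dots> = g s * ennreal (2 powr (p - 1) * s powr ((p - 1) / 2)) * T s t"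
      unfolding eq using True pos by (simp add: g_def T_def ennreal_mult)
    finally show ?thesis by simp
  next
    case False
    then have "k t s * indicator {0<..c} t = 0" using that by (auto simp: k_def indicator_def)
    moreover have "k t s * ennreal ((2 * sqrt \<bar>s\<bar> / sqrt t * f s) powr p) * indicator {0<..c} t
        = (k t s * indicator {0<..c} t) * ennreal ((2 * sqrt \<bar>s\<bar> / sqrt t * f s) powr p)"
      by (simp only: mult_ac)
    ultimately show ?thesis by (simp only: mult_zero_left zero_le)
  qed
  have "(\<integral>\<^sup>+t\<in>{0<..c}. ennreal ((X t / t) powr p) \<partial>lborel)
      \<le> (\<integral>\<^sup>+t\<in>{0<..c}. (\<integral>\<^sup>+s. k t s * ennreal ((2 * sqrt \<bar>s\<bar> / sqrt t * f s) powr p) \<partial>lborel) \<partial>lborel)"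
  proof (rule nn_integral_mono)
    fix t :: real
    show "ennreal ((X t / t) powr p) * indicator {0<..c} t
        \<le> (\<integral>\<^sup>+s. k t s * ennreal ((2 * sqrt \<bar>s\<bar> / sqrt t * f s) powr p) \<partial>lborel) * indicator {0<..c} t"
      using pt[of t] by (cases "t \<in> {0<..c}") simp_all
  qed
  also have "\<dots> = (\<integral>\<^sup>+t. \<integral>\<^sup>+s. k t s * ennreal ((2 * sqrt \<bar>s\<bar> / sqrt t * f s) powr p) * indicator {0<..c} t \<partial>lborel \<partial>lborel)"
    by (intro nn_integral_cong nn_integral_multc[symmetric]) measurable
  also have "\<dots> = (\<integral>\<^sup>+s. \<integral>\<^sup>+t. k t s * ennreal ((2 * sqrt \<bar>s\<bar> / sqrt t * f s) powr p) * indicator {0<..c} t \<partial>lborel \<partial>lborel)"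
    by (rule lborel_pair.Fubini') (simp add: case_prod_beta')
  also have "\<dots> \<le> (\<integral>\<^sup>+s. ennreal (2 powr p / (p - 1)) * g s \<partial>lborel)"
  proof (intro nn_integral_mono_AE eventually_mono[OF AE_lborel_singleton[of 0]])
    fix s :: real assume s: "s \<noteq> 0"
    have "(\<integral>\<^sup>+t\<in>{0<..c}. k t s * ennreal ((2 * sqrt \<bar>s\<bar> / sqrt t * f s) powr p) \<partial>lborel)
        \<le> (\<integral>\<^sup>+t. g s * ennreal (2 powr (p - 1) * s powr ((p - 1) / 2)) * T s t \<partial>lborel)"
      by (rule nn_integral_mono) (rule kt[OF s])
    also have "\<dots> = g s * ennreal (2 powr (p - 1) * s powr ((p - 1) / 2)) * (\<integral>\<^sup>+t. T s t \<partial>lborel)"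
      by (rule nn_integral_cmult) measurable
    also have "\<dots> \<le> ennreal (2 powr p / (p - 1)) * g s"
    proof (cases "s > 0")
      case True
      have "s powr ((p - 1) / 2) * s powr (- (p - 1) / 2) = s powr ((p - 1) / 2 + - (p - 1) / 2)"
        by (rule powr_add[symmetric])
      also have "(p - 1) / 2 + - (p - 1) / 2 = 0" by (simp add: field_simps)
      also have "s powr 0 = 1" using True by simp
      finally have "(2 powr (p - 1) * s powr ((p - 1) / 2)) * (s powr (- (p - 1) / 2) * (2 / (p - 1))) = 2 powr (p - 1) * 2 / (p - 1)"
        by simp
      also have "\<dots> = 2 powr p / (p - 1)" by (simp add: powr_diff)
      finally have "ennreal (2 powr (p - 1) * s powr ((p - 1) / 2)) * ennreal (s powr (- (p - 1) / 2) * (2 / (p - 1))) = ennreal (2 powr p / (p - 1))"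
        using p by (subst ennreal_mult[symmetric]) auto
      then show ?thesis
        unfolding T[OF True] by (simp only: mult.assoc) (simp only: mult.commute order_refl)
    next
      case False
      then show ?thesis using s by (simp add: T_def)
    qed
    finally show "(\<integral>\<^sup>+t\<in>{0<..c}. k t s * ennreal ((2 * sqrt \<bar>s\<bar> / sqrt t * f s) powr p) \<partial>lborel) \<le> ennreal (2 powr p / (p - 1)) * g s" .
  qed
  also have "\<dots> = ennreal (2 powr p / (p - 1)) * (\<integral>\<^sup>+s. g s \<partial>lborel)"
    by (rule nn_integral_cmult) measurable
  finally show ?thesis by (simp add: g_def)
qed

section \<open>Mollification and the energy of the mollified gradient\<close>

lemma bump_xy_eq_0: "e \<le> cmod z \<Longrightarrow> 0 < e \<Longrightarrow> bump_x e z = 0" "e \<le> cmod z \<Longrightarrow> 0 < e \<Longrightarrow> bump_y e z = 0"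
  by (auto simp: bump_x_def bump_y_def exp_cut_def dest: power2_less_imp_less)

lemma borel_measurable_bump [measurable (raw)]:
  "f \<in> borel_measurable M \<Longrightarrow> (\<lambda>x. bump e (f x)) \<in> borel_measurable M"
  using measurable_compose[OF _ borel_measurable_continuous_onI[OF continuous_bump(1)[OF continuous_on_id]]] .

lemma nn_integral_complex_translate:
  fixes k :: "complex \<Rightarrow> ennreal"
  assumes [measurable]: "k \<in> borel_measurable borel"
  shows "(\<integral>\<^sup>+w. k (w - z) \<partial>lborel) = (\<integral>\<^sup>+w. k w \<partial>lborel)"
proof -
  have "(\<integral>\<^sup>+w. k w \<partial>lborel) = (\<integral>\<^sup>+w. k w \<partial>distr lborel borel ((+) (- z)))"
    by (simp only: lborel_distr_plus)
  also have "\<dots> = (\<integral>\<^sup>+w. k (- z + w) \<partial>lborel)" by (rule nn_integral_distr) auto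
  finally show ?thesis by simp
qed

text \<open>The normalising constant of the mollifier. It is never computed; positivity and
  finiteness suffice.\<close>

definition bump_mass :: "real \<Rightarrow> ennreal" where
  "bump_mass e = (\<integral>\<^sup>+w. ennreal (bump e w) \<partial>lborel)"

lemma bump_mass_translate: "(\<integral>\<^sup>+w. ennreal (bump e (z - w)) \<partial>lborel) = bump_mass e" "(\<integral>\<^sup>+w. ennreal (bump e (w - z)) \<partial>lborel) = bump_mass e"
  using nn_integral_complex_translate[of "\<lambda>w. ennreal (bump e w)" z] by (simp_all add: bump_mass_def bump_minus[of e z])

lemma bump_mass_pos: assumes "e > 0" shows "bump_mass e > 0"
proof (rule ccontr)
  assume "\<not> bump_mass e > 0"
  then have "(\<integral>\<^sup>+w. ennreal (bump e w) \<partial>lborel) = 0" by (simp add: bump_mass_def)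
  then have "AE w in lborel. ennreal (bump e w) = 0"
    by (subst (asm) nn_integral_0_iff_AE) auto
  then have "AE w :: complex in lborel. w \<notin> ball 0 e"
  proof (rule eventually_mono)
    show "w \<notin> ball 0 e" if "ennreal (bump e w) = 0" for w
      using that bump_pos[of w e] by (auto simp: ennreal_eq_0_iff)
  qed
  then have "emeasure lborel (ball (0::complex) e) = 0"
    by (subst (asm) AE_iff_measurable[where N="ball 0 e"]) auto
  then show False using content_ball_pos[OF assms, of "0::complex"] by (simp add: measure_def)
qed

lemma bump_mass_finite: assumes "e > 0" shows "bump_mass e < \<infinity>"
proof -
  have "bounded (bump e ` cball 0 e)"
    by (intro compact_imp_bounded compact_continuous_image continuous_bump continuous_on_id) auto
  then obtain C where C: "\<forall>w\<in>cball 0 e. \<bar>bump e w\<bar> \<le> C" by (auto simp: bounded_iff)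
  have "bump_mass e \<le> (\<integral>\<^sup>+w. ennreal C * indicator (cball 0 e) (w :: complex) \<partial>lborel)"
    unfolding bump_mass_def
  proof (rule nn_integral_mono)
    fix w show "ennreal (bump e w) \<le> ennreal C * indicator (cball 0 e) w"
      using C bump_eq_0[of e w] assms by (cases "w \<in> cball 0 e") (auto intro: ennreal_leI)
  qed
  also have "\<dots> = ennreal C * emeasure lborel (cball (0::complex) e)"
    by (rule nn_integral_cmult_indicator) simp
  also have "\<dots> < \<infinity>"
    using emeasure_bounded_finite[of "cball (0::complex) e"] by (simp add: ennreal_mult_less_top)
  finally show ?thesis .
qed

text \<open>Convolution over a fixed box, so that continuity and differentiation in the parameter
  follow from theorems on compact boxes. For a kernel supported in radius \<open>e\<close> and
  \<open>cmod z + e <= 2\<close> it is the full convolution.\<close>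

definition conv :: "(complex \<Rightarrow> real) \<Rightarrow> (complex \<Rightarrow> complex) \<Rightarrow> complex \<Rightarrow> complex" where
  "conv k h z = integral (cbox (Complex (-2) (-2)) (Complex 2 2)) (\<lambda>w. of_real (k (z - w)) * h w)"

lemma conv_eq_LINT:
  assumes k: "continuous_on UNIV k" "\<And>w. e \<le> cmod w \<Longrightarrow> k w = 0" and h: "continuous_on UNIV h"
    and z: "cmod z + e \<le> 2"
  shows "conv k h z = (LINT w|lborel. of_real (k (z - w)) * h w)"
proof -
  let ?Q = "cbox (Complex (-2) (-2)) (Complex 2 2)"
  have c: "continuous_on UNIV (\<lambda>w. of_real (k (z - w)) * h w)"
    by (intro continuous_intros continuous_on_compose2[OF k(1)] h) auto
  have "set_integrable lborel ?Q (\<lambda>w. of_real (k (z - w)) * h w)"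
    unfolding set_integrable_def by (intro borel_integrable_compact compact_cbox continuous_on_subset[OF c]) auto
  from set_borel_integral_eq_integral(2)[OF this]
  have "conv k h z = (LINT w:?Q|lborel. of_real (k (z - w)) * h w)" by (simp add: conv_def)
  also have "\<dots> = (LINT w|lborel. of_real (k (z - w)) * h w)"
    unfolding set_lebesgue_integral_def
  proof (rule Bochner_Integration.integral_cong)
    fix w
    show "indicator ?Q w *\<^sub>R (of_real (k (z - w)) * h w) = of_real (k (z - w)) * h w"
    proof (cases "w \<in> ?Q")
      case False
      then have "2 < \<bar>Re w\<bar> \<or> 2 < \<bar>Im w\<bar>" by (auto simp: in_cbox_complex_iff)
      then have "2 < cmod w" using abs_Re_le_cmod[of w] abs_Im_le_cmod[of w] by linarith
      then have "e \<le> cmod (z - w)" using z norm_triangle_ineq2[of w z] by (simp add: norm_minus_commute)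
      then show ?thesis using k(2) by simp
    qed simp
  qed simp
  finally show ?thesis .
qed

lemma continuous_conv:
  assumes "continuous_on UNIV k" "continuous_on UNIV h"
  shows "continuous_on UNIV (conv k h)"
  unfolding conv_def[abs_def]
  by (rule integral_continuous_on_param)
     (auto simp: case_prod_beta' intro!: continuous_intros continuous_on_compose2[OF assms(1)] continuous_on_compose2[OF assms(2)])

text \<open>Leibniz rule: the derivative falls on the smooth kernel, so continuity of
  \<open>h\<close> suffices.\<close>

lemma conv_has_vector_derivative:
  assumes h: "continuous_on UNIV h" and g: "\<And>t. (g has_vector_derivative g' t) (at t)" "continuous_on UNIV g'"
  shows "((\<lambda>t. conv (bump e) h (g t)) has_vector_derivative
     of_real (Re (g' t)) * conv (bump_x e) h (g t) + of_real (Im (g' t)) * conv (bump_y e) h (g t)) (at t)"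
proof -
  let ?a = "Complex (-2) (-2)" and ?b = "Complex 2 2"
  have gc: "continuous_on UNIV g"
    using g(1) by (meson continuous_at_imp_continuous_on has_vector_derivative_continuous)
  let ?D = "\<lambda>t w. of_real (Re (g' t) * bump_x e (g t - w) + Im (g' t) * bump_y e (g t - w)) * h w"
  have "((\<lambda>t. integral (cbox ?a ?b) (\<lambda>w. of_real (bump e (g t - w)) * h w)) has_vector_derivative
      integral (cbox ?a ?b) (?D t)) (at t within UNIV)"
  proof (rule leibniz_rule_vector_derivative)
    fix t w
    have "((\<lambda>t. g t - w) has_derivative (\<lambda>r. r *\<^sub>R g' t)) (at t)"
      using g(1)[of t] unfolding has_vector_derivative_def by (auto intro!: derivative_eq_intros)
    from has_derivative_compose[OF this bump_has_derivative]
    have "((\<lambda>t. bump e (g t - w)) has_vector_derivative (Re (g' t) * bump_x e (g t - w) + Im (g' t) * bump_y e (g t - w))) (at t)"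
      by (simp add: has_vector_derivative_def algebra_simps)
    then show "((\<lambda>t. of_real (bump e (g t - w)) * h w) has_vector_derivative ?D t w) (at t within UNIV)"
      by (intro has_vector_derivative_mult_left has_vector_derivative_of_real) (simp add: has_real_derivative_iff_has_vector_derivative)
  next
    show "(\<lambda>w. of_real (bump e (g t - w)) * h w) integrable_on cbox ?a ?b" for t
      by (intro integrable_continuous continuous_intros continuous_on_subset[OF h]) auto
    show "continuous_on (UNIV \<times> cbox ?a ?b) (\<lambda>(t, w). ?D t w)"
      by (auto simp: case_prod_beta' intro!: continuous_intros continuous_on_compose2[OF gc] continuous_on_compose2[OF g(2)] continuous_on_compose2[OF h])
  qed auto
  moreover have "integral (cbox ?a ?b) (?D t) = of_real (Re (g' t)) * conv (bump_x e) h (g t) + of_real (Im (g' t)) * conv (bump_y e) h (g t)"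
  proof -
    have i: "(\<lambda>w. of_real (bump_x e (g t - w)) * h w) integrable_on cbox ?a ?b" "(\<lambda>w. of_real (bump_y e (g t - w)) * h w) integrable_on cbox ?a ?b"
      by (intro integrable_continuous continuous_intros continuous_on_subset[OF h]; simp)+
    have "integral (cbox ?a ?b) (?D t) = integral (cbox ?a ?b) (\<lambda>w. of_real (Re (g' t)) * (of_real (bump_x e (g t - w)) * h w) + of_real (Im (g' t)) * (of_real (bump_y e (g t - w)) * h w))"
      by (rule integral_cong) (simp add: algebra_simps)
    also have "\<dots> = of_real (Re (g' t)) * conv (bump_x e) h (g t) + of_real (Im (g' t)) * conv (bump_y e) h (g t)"
      unfolding conv_def using i by (subst integral_add) (auto intro: integrable_on_mult_right)
    finally show ?thesis .
  qed
  ultimately show ?thesis by (simp add: conv_def)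
qed

text \<open>If \<open>f\<close> is not integrable, its Bochner integral is 0 by convention, so the
  bound holds without an integrability condition.\<close>

lemma norm_integral_le_nn_integral:
  fixes f :: "'a \<Rightarrow> 'b :: {banach, second_countable_topology}"
  shows "ennreal (norm (integral\<^sup>L M f)) \<le> (\<integral>\<^sup>+x. ennreal (norm (f x)) \<partial>M)"
  by (cases "integrable M f") (auto simp: integral_norm_bound_ennreal not_integrable_integral_eq)

definition moll :: "(complex \<Rightarrow> complex) \<Rightarrow> real \<Rightarrow> complex \<Rightarrow> complex" where
  "moll h e z = conv (bump e) h z / of_real (enn2real (bump_mass e))"

text \<open>The sum of the moduli of the two partial derivatives of \<open>moll h e\<close>, which
  dominates its rate of change in every unit direction.\<close>

definition moll_grad :: "(complex \<Rightarrow> complex) \<Rightarrow> real \<Rightarrow> complex \<Rightarrow> real" where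
  "moll_grad h e z = (cmod (conv (bump_x e) h z) + cmod (conv (bump_y e) h z)) / enn2real (bump_mass e)"

lemma moll_grad_nonneg: "moll_grad h e z \<ge> 0"
  by (simp add: moll_grad_def)

lemma continuous_moll_grad: "continuous_on UNIV h \<Longrightarrow> continuous_on UNIV (moll_grad h e)"
  unfolding moll_grad_def divide_inverse
  by (intro continuous_intros continuous_conv) auto

lemma continuous_moll: "continuous_on UNIV h \<Longrightarrow> continuous_on UNIV (moll h e)"
  unfolding moll_def divide_inverse
  by (intro continuous_intros continuous_conv) auto

lemma mass_real: "e > 0 \<Longrightarrow> 0 < enn2real (bump_mass e)" "e > 0 \<Longrightarrow> ennreal (enn2real (bump_mass e)) = bump_mass e"
  using bump_mass_pos[of e] bump_mass_finite[of e] by (auto simp: enn2real_positive_iff)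

text \<open>The fundamental theorem of calculus along the curve: \<open>moll_grad\<close> is an
  upper gradient of the mollification. This is the form in which the trace estimate consumes
  it.\<close>

lemma moll_curve:
  assumes h: "continuous_on UNIV h" and e: "e > 0"
    and g: "\<And>t. (g has_vector_derivative g' t) (at t)" "continuous_on UNIV g'"
    and b: "\<And>t. a \<le> t \<Longrightarrow> t \<le> b \<Longrightarrow> cmod (g' t) \<le> 1" and ab: "a \<le> b"
  shows "ennreal (cmod (moll h e (g b) - moll h e (g a))) \<le> (\<integral>\<^sup>+t\<in>{a..b}. ennreal (moll_grad h e (g t)) \<partial>lborel)"
proof -
  let ?c = "enn2real (bump_mass e)"
  have c: "?c > 0" using mass_real[OF e] by simp
  have gc: "continuous_on S g" for S
    using g(1) by (meson continuous_at_imp_continuous_on has_vector_derivative_continuous)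
  let ?K = "\<lambda>t. of_real (Re (g' t)) * conv (bump_x e) h (g t) + of_real (Im (g' t)) * conv (bump_y e) h (g t)"
  have hx: "continuous_on UNIV (conv (bump_x e) h)" "continuous_on UNIV (conv (bump_y e) h)"
    by (intro continuous_conv continuous_intros h)+
  have K: "(?K has_integral (conv (bump e) h (g b) - conv (bump e) h (g a))) {a..b}"
    by (rule fundamental_theorem_of_calculus[OF ab]) (rule has_vector_derivative_at_within[OF conv_has_vector_derivative[OF h g]])
  have cN: "continuous_on {a..b} (\<lambda>t. moll_grad h e (g t))"
    by (rule continuous_on_compose2[OF continuous_moll_grad[OF h] gc]) auto
  have N: "((\<lambda>t. moll_grad h e (g t)) has_integral integral {a..b} (\<lambda>t. moll_grad h e (g t))) {a..b}"
    using integrable_continuous_interval[OF cN] by (rule integrable_integral)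
  have "cmod (integral {a..b} ?K) \<le> integral {a..b} (\<lambda>t. ?c * moll_grad h e (g t))"
  proof (rule integral_norm_bound_integral)
    show "?K integrable_on {a..b}" using K by blast
    show "(\<lambda>t. ?c * moll_grad h e (g t)) integrable_on {a..b}"
      by (intro integrable_continuous_interval continuous_intros cN)
    fix t assume t: "t \<in> {a..b}"
    have r: "\<bar>Re (g' t)\<bar> \<le> 1" "\<bar>Im (g' t)\<bar> \<le> 1"
      using b[of t] t abs_Re_le_cmod[of "g' t"] abs_Im_le_cmod[of "g' t"] by auto
    have "cmod (?K t) \<le> \<bar>Re (g' t)\<bar> * cmod (conv (bump_x e) h (g t)) + \<bar>Im (g' t)\<bar> * cmod (conv (bump_y e) h (g t))"
      by (rule order_trans[OF norm_triangle_ineq]) (simp add: norm_mult)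
    also have "\<dots> \<le> 1 * cmod (conv (bump_x e) h (g t)) + 1 * cmod (conv (bump_y e) h (g t))"
      by (intro add_mono mult_right_mono r) auto
    also have "\<dots> = ?c * moll_grad h e (g t)" using c by (simp add: moll_grad_def)
    finally show "cmod (?K t) \<le> ?c * moll_grad h e (g t)" .
  qed
  then have "cmod (conv (bump e) h (g b) - conv (bump e) h (g a)) \<le> ?c * integral {a..b} (\<lambda>t. moll_grad h e (g t))"
    using integral_unique[OF K] by simp
  then have "cmod (moll h e (g b) - moll h e (g a)) \<le> integral {a..b} (\<lambda>t. moll_grad h e (g t))"
    using c by (simp add: moll_def diff_divide_distrib[symmetric] norm_divide pos_divide_le_eq mult.commute)
  then show ?thesis
    using nn_integral_has_integral_lebesgue'[OF moll_grad_nonneg N] by (simp add: ennreal_leI)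
qed


text \<open>As a function of \<open>w\<close>, \<open>bump e (z - w)\<close> is a test function on
  the unit disk, so the weak derivative applies to it. Differentiating in \<open>w\<close> produces
  \<open>- k (z - w)\<close>, and this sign cancels the one in \<open>weak_partial\<close>. General
  \<open>v\<close> and \<open>k\<close> serve both partial derivatives.\<close>

lemma conv_weak_partial:
  assumes h: "continuous_on UNIV h" and e: "e > 0" and z: "cmod z + e < 1"
    and wp: "weak_partial (ball 0 1) v h g"
    and k: "continuous_on UNIV k" "\<And>w. e \<le> cmod w \<Longrightarrow> k w = 0"
    and kv: "\<And>w. Re v * bump_x e w + Im v * bump_y e w = k w"
  shows "ennreal (cmod (conv k h z)) \<le> (\<integral>\<^sup>+w. ennreal (bump e (z - w)) * (ennreal (cmod (g w)) * indicator (ball 0 1) w) \<partial>lebesgue)"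
proof -
  have off: "e \<le> cmod (z - w)" if "w \<notin> ball 0 1" for w
    using z that norm_triangle_ineq2[of w z] by (simp add: norm_minus_commute)
  have d: "frechet_derivative (\<lambda>w. bump e (z - w)) (at w) v = - k (z - w)" for w
  proof -
    have "((\<lambda>w. z - w) has_derivative (\<lambda>v. - v)) (at w)" by (auto intro!: derivative_eq_intros)
    from has_derivative_compose[OF this bump_has_derivative]
    have "((\<lambda>w. bump e (z - w)) has_derivative (\<lambda>v. Re (- v) * bump_x e (z - w) + Im (- v) * bump_y e (z - w))) (at w)" .
    from frechet_derivative_at[OF this, symmetric] show ?thesis
      using kv[of "z - w"] by simp
  qed
  have c: "continuous_on UNIV (\<lambda>w. of_real (k (z - w)) * h w)"
    by (intro continuous_intros continuous_on_compose2[OF k(1)] h) auto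
  have "conv k h z = (LINT w|lborel. of_real (k (z - w)) * h w)"
    using z e by (intro conv_eq_LINT[OF k h]) auto
  also have "\<dots> = (LINT w|lebesgue. of_real (k (z - w)) * h w)"
    using borel_measurable_continuous_onI[OF c] by (simp add: integral_completion)
  also have "\<dots> = (LINT w:ball 0 1|lebesgue. - (of_real (frechet_derivative (\<lambda>w. bump e (z - w)) (at w) v) * h w))"
    unfolding set_lebesgue_integral_def
  proof (rule Bochner_Integration.integral_cong)
    show "of_real (k (z - w)) * h w = indicator (ball 0 1) w *\<^sub>R - (of_real (frechet_derivative (\<lambda>w. bump e (z - w)) (at w) v) * h w)" for w
      using off[of w] k(2)[of "z - w"] by (cases "w \<in> ball 0 1") (simp_all add: d)
  qed simp
  also have "\<dots> = - (LINT w:ball 0 1|lebesgue. of_real (frechet_derivative (\<lambda>w. bump e (z - w)) (at w) v) * h w)"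
    unfolding set_lebesgue_integral_def by simp
  also have "\<dots> = (LINT w:ball 0 1|lebesgue. of_real (bump e (z - w)) * g w)"
    using wp[unfolded weak_partial_def, rule_format, OF bump_test_fun[OF e z]] by simp
  finally have "ennreal (cmod (conv k h z)) \<le> (\<integral>\<^sup>+w. ennreal (cmod (indicator (ball 0 1) w *\<^sub>R (of_real (bump e (z - w)) * g w))) \<partial>lebesgue)"
    unfolding set_lebesgue_integral_def by (simp only: norm_integral_le_nn_integral)
  also have "\<dots> = (\<integral>\<^sup>+w. ennreal (bump e (z - w)) * (ennreal (cmod (g w)) * indicator (ball 0 1) w) \<partial>lebesgue)"
    by (rule nn_integral_cong) (auto simp: norm_mult ennreal_mult indicator_def)
  finally show ?thesis .
qed

text \<open>Jensen's inequality for the averaging kernel, then Tonelli: the kernel has mass 1 in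
  either variable, so the bound \<open>E\<close>, the energy of the sum of the two weak derivatives,
  does not depend on \<open>e\<close>.\<close>

lemma moll_grad_energy:
  assumes h: "continuous_on UNIV h" and p: "p > 1"
    and gx: "Lp_on p (ball 0 1) gx" "weak_partial (ball 0 1) 1 h gx"
    and gy: "Lp_on p (ball 0 1) gy" "weak_partial (ball 0 1) \<i> h gy"
  shows "\<exists>E<\<infinity>. \<forall>e>0. (\<integral>\<^sup>+z. ennreal (moll_grad h e z powr p) * indicator {z. cmod z + e < 1} z \<partial>lborel) \<le> E"
proof -
  define G where "G w = (cmod (gx w) + cmod (gy w)) * indicator (ball 0 1) w" for w
  have Gn: "G w \<ge> 0" for w by (simp add: G_def)
  have m: "(\<lambda>w. cmod (gx w) * indicator (ball 0 1) w) \<in> borel_measurable lebesgue" "(\<lambda>w. cmod (gy w) * indicator (ball 0 1) w) \<in> borel_measurable lebesgue"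
  proof -
    have eq: "(\<lambda>w. norm (indicator (ball 0 1) w *\<^sub>R g w)) = (\<lambda>w. cmod (g w) * indicator (ball 0 1) w)" for g :: "complex \<Rightarrow> complex"
      by (auto simp: fun_eq_iff indicator_def)
    have mg: "(\<lambda>x. indicator (ball 0 1) x *\<^sub>R g x) \<in> borel_measurable lebesgue" if "Lp_on p (ball 0 1) g" for g
      using that by (simp add: Lp_on_def set_borel_measurable_def)
    show "(\<lambda>w. cmod (gx w) * indicator (ball 0 1) w) \<in> borel_measurable lebesgue" "(\<lambda>w. cmod (gy w) * indicator (ball 0 1) w) \<in> borel_measurable lebesgue"
      using measurable_compose[OF mg[OF gx(1)] borel_measurable_norm] measurable_compose[OF mg[OF gy(1)] borel_measurable_norm] unfolding eq by -
  qed
  then have Gm: "G \<in> borel_measurable lebesgue"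
    unfolding G_def[abs_def] distrib_right by (intro borel_measurable_add)
  \<comment> \<open>The weak derivatives are only Lebesgue measurable, while Tonelli is applied on
    \<open>lborel\<close>; hence the Borel representative \<open>G'\<close>.\<close>
  then obtain G0 where G0: "G0 \<in> borel_measurable lborel" "AE w in lborel. G w = G0 w"
    using completion_ex_borel_measurable_real by blast
  define G' where "G' w = \<bar>G0 w\<bar>" for w
  have [measurable]: "G' \<in> borel_measurable borel" unfolding G'_def[abs_def] using G0(1) by simp
  have G': "AE w in lborel. G w = G' w"
    using G0(2) by eventually_elim (use Gn in \<open>simp add: G'_def, metis abs_of_nonneg\<close>)
  have G'n: "G' w \<ge> 0" for w by (simp add: G'_def)
  define E where "E = (\<integral>\<^sup>+w. ennreal (G' w powr p) \<partial>lborel)"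
  have "E = (\<integral>\<^sup>+w. ennreal (G w powr p) \<partial>lborel)"
    unfolding E_def by (rule nn_integral_cong_AE) (use G' in \<open>eventually_elim, simp\<close>)
  also have "\<dots> = (\<integral>\<^sup>+w. ennreal (G w powr p) \<partial>lebesgue)" by (simp add: nn_integral_completion)
  also have "\<dots> \<le> (\<integral>\<^sup>+w. ennreal (2 powr p) * (ennreal (cmod (gx w) powr p) * indicator (ball 0 1) w) + ennreal (2 powr p) * (ennreal (cmod (gy w) powr p) * indicator (ball 0 1) w) \<partial>lebesgue)"
  proof (rule nn_integral_mono)
    fix w
    have "(x + y) powr p \<le> 2 powr p * x powr p + 2 powr p * y powr p" if "x \<ge> 0" "y \<ge> 0" for x y :: real
    proof (cases "x \<le> y")
      case True
      then have "(x + y) powr p \<le> (2 * y) powr p" using that p by (intro powr_mono2) auto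
      then show ?thesis using that by (simp add: powr_mult add_increasing)
    next
      case False
      then have "(x + y) powr p \<le> (2 * x) powr p" using that p by (intro powr_mono2) auto
      then show ?thesis using that by (simp add: powr_mult add_increasing2)
    qed
    then have "ennreal ((cmod (gx w) + cmod (gy w)) powr p) \<le> ennreal (2 powr p * cmod (gx w) powr p + 2 powr p * cmod (gy w) powr p)"
      by (intro ennreal_leI) simp
    then show "ennreal (G w powr p) \<le> ennreal (2 powr p) * (ennreal (cmod (gx w) powr p) * indicator (ball 0 1) w) + ennreal (2 powr p) * (ennreal (cmod (gy w) powr p) * indicator (ball 0 1) w)"
      using p by (auto simp: G_def indicator_def ennreal_mult)
  qed
  also have "\<dots> = ennreal (2 powr p) * (\<integral>\<^sup>+w\<in>ball 0 1. ennreal (cmod (gx w) powr p) \<partial>lebesgue) + ennreal (2 powr p) * (\<integral>\<^sup>+w\<in>ball 0 1. ennreal (cmod (gy w) powr p) \<partial>lebesgue)"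
  proof -
    have mp: "(\<lambda>w. ennreal (cmod (g w) powr p) * indicator (ball 0 1) w) \<in> borel_measurable lebesgue"
      if "(\<lambda>w. cmod (g w) * indicator (ball 0 1) w) \<in> borel_measurable lebesgue" for g :: "complex \<Rightarrow> complex"
    proof -
      have "(\<lambda>w. ennreal ((cmod (g w) * indicator (ball 0 1) w) powr p)) \<in> borel_measurable lebesgue"
        using that by measurable
      moreover have "(\<lambda>w. ennreal ((cmod (g w) * indicator (ball 0 1) w) powr p)) = (\<lambda>w. ennreal (cmod (g w) powr p) * indicator (ball 0 1) w)"
        using p by (auto simp: indicator_def fun_eq_iff)
      ultimately show ?thesis by simp
    qed
    show ?thesis
      by (simp add: nn_integral_add nn_integral_cmult mp[OF m(1)] mp[OF m(2)] borel_measurable_times_ennreal)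
  qed
  also have "\<dots> < \<infinity>"
    using gx(1) gy(1) by (auto simp: Lp_on_def ennreal_mult_less_top)
  finally have Efin: "E < \<infinity>" .
  have "(\<integral>\<^sup>+z. ennreal (moll_grad h e z powr p) * indicator {z. cmod z + e < 1} z \<partial>lborel) \<le> E" if e: "e > 0" for e
  proof -
    let ?c = "enn2real (bump_mass e)"
    define k where "k z w = ennreal (bump e (z - w) / ?c)" for z w
    have [measurable]: "(\<lambda>x. k (f x) (g x)) \<in> borel_measurable M" if [measurable]: "f \<in> borel_measurable M" "g \<in> borel_measurable M" for f g :: "_ \<Rightarrow> complex" and M
      unfolding k_def by measurable
    have kc: "k z w = ennreal (1 / ?c) * ennreal (bump e (z - w))" for z w
      by (simp add: k_def ennreal_mult[symmetric])
    have one: "ennreal (1 / ?c) * bump_mass e = 1"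
    proof -
      have "ennreal (1 / ?c) * bump_mass e = ennreal (1 / ?c) * ennreal ?c" by (simp only: mass_real(2)[OF e])
      also have "\<dots> = ennreal (1 / ?c * ?c)" by (rule ennreal_mult[symmetric]) auto
      also have "\<dots> = 1" using mass_real(1)[OF e] by simp
      finally show ?thesis .
    qed
    have k1: "(\<integral>\<^sup>+w. k z w \<partial>lborel) = 1" for z
      unfolding kc by (simp add: nn_integral_cmult bump_mass_translate one)
    have k2: "(\<integral>\<^sup>+z. k z w \<partial>lborel) = 1" for w
      unfolding kc by (simp add: nn_integral_cmult bump_mass_translate one)
    have pt: "ennreal (moll_grad h e z powr p) \<le> (\<integral>\<^sup>+w. k z w * ennreal (G' w powr p) \<partial>lborel)" if z: "cmod z + e < 1" for z
    proof (rule jensen_powr)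
      have "ennreal (moll_grad h e z) = ennreal (1 / ?c) * (ennreal (cmod (conv (bump_x e) h z)) + ennreal (cmod (conv (bump_y e) h z)))"
        by (simp add: moll_grad_def ennreal_mult[symmetric] ennreal_plus[symmetric] del: ennreal_plus)
      also have "\<dots> \<le> ennreal (1 / ?c) * ((\<integral>\<^sup>+w. ennreal (bump e (z - w)) * (ennreal (cmod (gx w)) * indicator (ball 0 1) w) \<partial>lebesgue) + (\<integral>\<^sup>+w. ennreal (bump e (z - w)) * (ennreal (cmod (gy w)) * indicator (ball 0 1) w) \<partial>lebesgue))"
        using e by (intro mult_left_mono add_mono conv_weak_partial[OF h e z gx(2)] conv_weak_partial[OF h e z gy(2)] continuous_bump continuous_on_id bump_xy_eq_0) auto
      also have "\<dots> = ennreal (1 / ?c) * (\<integral>\<^sup>+w. ennreal (bump e (z - w)) * (ennreal (cmod (gx w)) * indicator (ball 0 1) w) + ennreal (bump e (z - w)) * (ennreal (cmod (gy w)) * indicator (ball 0 1) w) \<partial>lebesgue)"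
      proof -
        have b: "(\<lambda>w. ennreal (bump e (z - w))) \<in> borel_measurable lebesgue"
          by (rule measurable_completion) simp
        have "(\<lambda>w. ennreal (cmod (gx w)) * indicator (ball 0 1) w) \<in> borel_measurable lebesgue" "(\<lambda>w. ennreal (cmod (gy w)) * indicator (ball 0 1) w) \<in> borel_measurable lebesgue"
          using m[THEN measurable_compose[OF _ measurable_ennreal]] by (simp_all add: ennreal_mult ennreal_indicator)
        then show ?thesis
          by (subst nn_integral_add) (auto intro!: borel_measurable_times_ennreal b)
      qed
      also have "\<dots> = ennreal (1 / ?c) * (\<integral>\<^sup>+w. ennreal (bump e (z - w)) * ennreal (G w) \<partial>lborel)"
        by (auto simp: nn_integral_completion G_def distrib_left indicator_def intro!: arg_cong2[where f="(*)"] nn_integral_cong)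
      also have "\<dots> = ennreal (1 / ?c) * (\<integral>\<^sup>+w. ennreal (bump e (z - w)) * ennreal (G' w) \<partial>lborel)"
        by (rule arg_cong2[where f="(*)"], rule refl, rule nn_integral_cong_AE) (use G' in \<open>eventually_elim, simp\<close>)
      also have "\<dots> = (\<integral>\<^sup>+w. k z w * ennreal (G' w) \<partial>lborel)"
        unfolding kc mult.assoc by (rule nn_integral_cmult[symmetric]) measurable
      finally show "ennreal (moll_grad h e z) \<le> (\<integral>\<^sup>+w. k z w * ennreal (G' w) \<partial>lborel)" .
      show "(\<integral>\<^sup>+w. k z w \<partial>lborel) = 1" by (rule k1)
    qed (use p G'n moll_grad_nonneg in \<open>auto\<close>)
    have "(\<integral>\<^sup>+z. ennreal (moll_grad h e z powr p) * indicator {z. cmod z + e < 1} z \<partial>lborel)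
        \<le> (\<integral>\<^sup>+z. \<integral>\<^sup>+w. k z w * ennreal (G' w powr p) \<partial>lborel \<partial>lborel)"
      by (rule nn_integral_mono) (auto simp: indicator_def pt)
    also have "\<dots> = (\<integral>\<^sup>+w. \<integral>\<^sup>+z. k z w * ennreal (G' w powr p) \<partial>lborel \<partial>lborel)"
      by (rule lborel_pair.Fubini'[symmetric]) (simp add: case_prod_beta')
    also have "\<dots> = E"
      unfolding E_def by (rule nn_integral_cong) (simp add: nn_integral_multc k2)
    finally show ?thesis .
  qed
  then show ?thesis using Efin by blast
qed

text \<open>\<open>moll h e z\<close> is a weighted mean of \<open>h\<close> over the disk of radius
  \<open>e\<close> about \<open>z\<close>, so a bound for \<open>h - c\<close> on that disk is
  inherited.\<close>

lemma moll_approx: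
  assumes h: "continuous_on UNIV h" and e: "e > 0" "e \<le> 1" and z: "cmod z \<le> 1"
    and d: "\<And>w. cmod (z - w) < e \<Longrightarrow> cmod (h w - c) \<le> d"
  shows "cmod (moll h e z - c) \<le> d"
proof -
  let ?m = "enn2real (bump_mass e)"
  have m: "?m > 0" "ennreal ?m = bump_mass e" using mass_real[OF e(1)] by auto
  have d0: "d \<ge> 0" using order_trans[OF norm_ge_zero d[of z]] e by simp
  have i1: "integrable lborel (\<lambda>w. bump e (z - w))"
    by (rule integrableI_nonneg) (auto simp: bump_mass_translate bump_mass_finite[OF e(1), simplified])
  have I: "(LINT w|lborel. bump e (z - w)) = ?m"
    by (rule integral_eq_nn_integral[THEN trans]) (auto simp: bump_mass_translate)
  have i2: "integrable lborel (\<lambda>w. of_real (bump e (z - w)) * (h w - c))"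
  proof (rule Bochner_Integration.integrable_bound[OF integrable_mult_right[OF i1, of d]])
    show "(\<lambda>w. of_real (bump e (z - w)) * (h w - c)) \<in> borel_measurable lborel"
      using borel_measurable_continuous_onI[OF h] by measurable
    show "AE w in lborel. norm (of_real (bump e (z - w)) * (h w - c)) \<le> norm (d * bump e (z - w))"
    proof (rule AE_I2)
      fix w
      show "norm (of_real (bump e (z - w)) * (h w - c)) \<le> norm (d * bump e (z - w))"
        using d[of w] d0 bump_eq_0[of e "z - w"] e mult_right_mono[of "cmod (h w - c)" d "bump e (z - w)"]
        by (cases "cmod (z - w) < e") (auto simp: norm_mult abs_mult mult.commute)
    qed
  qed
  have i3: "integrable lborel (\<lambda>w. of_real (bump e (z - w)) * c)"
    using i1 by (intro integrable_mult_left) auto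
  have "conv (bump e) h z = (LINT w|lborel. of_real (bump e (z - w)) * h w)"
    using z e by (intro conv_eq_LINT[where e=e] continuous_bump continuous_on_id h bump_eq_0) auto
  also have "\<dots> = (LINT w|lborel. of_real (bump e (z - w)) * (h w - c) + of_real (bump e (z - w)) * c)"
    by (rule Bochner_Integration.integral_cong) (simp_all add: algebra_simps)
  also have "\<dots> = (LINT w|lborel. of_real (bump e (z - w)) * (h w - c)) + of_real ?m * c"
    using I by (simp add: Bochner_Integration.integral_add[OF i2 i3])
  finally have "conv (bump e) h z - of_real ?m * c = (LINT w|lborel. of_real (bump e (z - w)) * (h w - c))" by simp
  moreover have "cmod (LINT w|lborel. of_real (bump e (z - w)) * (h w - c)) \<le> (LINT w|lborel. d * bump e (z - w))"
  proof (rule order_trans[OF integral_norm_bound integral_mono[OF integrable_norm[OF i2] integrable_mult_right[OF i1]]])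
    fix w
    show "norm (of_real (bump e (z - w)) * (h w - c)) \<le> d * bump e (z - w)"
      using d[of w] d0 bump_eq_0[of e "z - w"] e mult_right_mono[of "cmod (h w - c)" d "bump e (z - w)"]
      by (cases "cmod (z - w) < e") (auto simp: norm_mult mult.commute)
  qed
  ultimately have "cmod (conv (bump e) h z - of_real ?m * c) \<le> d * ?m" using I by simp
  moreover have "moll h e z - c = (conv (bump e) h z - of_real ?m * c) / of_real ?m"
    using m(1) by (simp add: moll_def diff_divide_distrib)
  ultimately show ?thesis using m(1) by (simp add: norm_divide pos_divide_le_eq)
qed

section \<open>Gagliardo's estimate on circles inside the disk\<close>

lemma nn_integral_periodic_shift:
  fixes F :: "real \<Rightarrow> ennreal"
  assumes [measurable]: "F \<in> borel_measurable borel" and per: "\<And>t. F (t + 2 * pi) = F t"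
  shows "(\<integral>\<^sup>+t\<in>{0..2 * pi}. F (t + c) \<partial>lborel) = (\<integral>\<^sup>+t\<in>{0..2 * pi}. F t \<partial>lborel)"
proof -
  have "(\<integral>\<^sup>+t\<in>{0..2 * pi}. F (t + c) \<partial>lborel) = (\<integral>\<^sup>+t. F (t + c) * indicator {c..c + 2 * pi} (t + c) \<partial>lborel)"
    by (rule nn_integral_cong) (auto simp: indicator_def)
  also have "\<dots> = (\<integral>\<^sup>+t\<in>{c..c + 2 * pi}. F t \<partial>lborel)"
    by (rule nn_integral_real_shift[of "\<lambda>t. F t * indicator {c..c + 2 * pi} t"]) simp
  also have "\<dots> = (\<integral>\<^sup>+t\<in>{0..2 * pi}. F t \<partial>lborel)"
    by (rule nn_integral_periodic) (simp_all add: per)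
  finally show ?thesis .
qed

text \<open>The classical trace estimate: two points of the circle at angular distance \<open>t\<close> are joined by
  two radial segments of length \<open>t\<close> and an arc at depth \<open>t\<close>. Hardy's inequality controls the radial
  segments, Jensen's inequality the arc.\<close>
lemma circle_difference_energy:
  fixes u :: "complex \<Rightarrow> complex" and N :: "complex \<Rightarrow> real"
  assumes u: "continuous_on UNIV u" and N: "continuous_on UNIV N" "\<And>z. N z \<ge> 0" and p: "p > 1"
    and curve: "\<And>g g' a b. (\<And>t. (g has_vector_derivative g' t) (at t)) \<Longrightarrow> continuous_on UNIV g' \<Longrightarrow>
        (\<And>t. a \<le> t \<Longrightarrow> t \<le> b \<Longrightarrow> cmod (g' t) \<le> 1) \<Longrightarrow> a \<le> b \<Longrightarrow>
        ennreal (cmod (u (g b) - u (g a))) \<le> (\<integral>\<^sup>+t\<in>{a..b}. ennreal (N (g t)) \<partial>lborel)"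
    and R: "1 / 2 \<le> R" "R + e < 1" "e > 0"
    and E: "(\<integral>\<^sup>+z. ennreal (N z powr p) * indicator {z. cmod z + e < 1} z \<partial>lborel) \<le> E"
  shows "(\<integral>\<^sup>+s\<in>{0..2 * pi}. (\<integral>\<^sup>+t\<in>{0<..1/4}. ennreal ((cmod (u (of_real R * cis (s + t)) - u (of_real R * cis s)) / t) powr p) \<partial>lborel) \<partial>lborel)
      \<le> ennreal (3 powr p * (2 * (2 powr p / (p - 1)) + 1) * 4) * E"
proof -
  have [measurable]: "u \<in> borel_measurable borel" "N \<in> borel_measurable borel"
    using u N(1) by (auto intro: borel_measurable_continuous_onI)
  let ?I = "indicator {0..2 * pi} :: real \<Rightarrow> ennreal" and ?J = "indicator {0<..1/4} :: real \<Rightarrow> ennreal"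
  let ?H = "ennreal (2 powr p / (p - 1))"
  let ?D = "\<lambda>f. \<integral>\<^sup>+s. (\<integral>\<^sup>+t. f s t * ?J t \<partial>lborel) * ?I s \<partial>lborel"
  let ?P = "\<lambda>r s. ennreal (N (of_real r * cis s) powr p)"
  let ?Q = "\<lambda>s. \<integral>\<^sup>+r. ?P (R - r) s * indicator {0..1/4} r \<partial>lborel"
  let ?W = "\<lambda>s r. (?P r s * indicator {z. cmod z + e < 1} (of_real r * cis s)) * ennreal r * indicator {0<..} r"
  let ?V = "\<lambda>s t. ennreal ((cmod (u (of_real R * cis (s + t)) - u (of_real R * cis s)) / t) powr p)"
  have open_set: "{z :: complex. cmod z + e < 1} \<in> sets borel"
    by (intro borel_open open_Collect_less continuous_intros)
  note [measurable] = open_set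
  \<comment> \<open>For \<open>t\<close> in [0, 1/4] the radius \<open>R - t\<close> is at least 1/4
    because \<open>R >= 1/2\<close>. So \<open>1 <= 4 * r\<close>, and supplying the area factor of
    polar coordinates costs 4.\<close>
  have annulus: "(\<integral>\<^sup>+s. ?Q s * ?I s \<partial>lborel) \<le> 4 * E"
  proof -
    have "?Q s
        \<le> 4 * (\<integral>\<^sup>+r. ?W s r \<partial>lborel)" for s
    proof -
      have "?Q s
          = (\<integral>\<^sup>+r\<in>{R - 1/4..R}. ?P r s \<partial>lborel)"
        by (subst (2) nn_integral_real_affine[where c="-1" and t=R]) (auto intro!: nn_integral_cong simp: indicator_def)
      also have "\<dots> \<le> (\<integral>\<^sup>+r. 4 * (?W s r) \<partial>lborel)"
      proof (rule nn_integral_mono)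
        fix r :: real
        show "?P r s * indicator {R - 1/4..R} r \<le> 4 * (?W s r)"
        proof (cases "r \<in> {R - 1/4..R}")
          case True
          then have r: "1 / 4 \<le> r" "r + e < 1" using R by auto
          have "(1 :: ennreal) \<le> 4 * ennreal r"
            using r ennreal_leI[of 1 "4 * r"] by (simp add: ennreal_mult)
          then have "?P r s * 1 \<le> ?P r s * (4 * ennreal r)"
            by (intro mult_left_mono) auto
          then show ?thesis using r True by (simp add: norm_mult mult_ac)
        qed simp
      qed
      also have "\<dots> = 4 * (\<integral>\<^sup>+r. ?W s r \<partial>lborel)"
        by (rule nn_integral_cmult) measurable
      finally show ?thesis .
    qed
    then have "(\<integral>\<^sup>+s. ?Q s * ?I s \<partial>lborel)
        \<le> (\<integral>\<^sup>+s. 4 * ((\<integral>\<^sup>+r. ?W s r \<partial>lborel) * ?I s) \<partial>lborel)"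
      by (intro nn_integral_mono) (simp add: mult.assoc[symmetric] mult_right_mono)
    also have "\<dots> = 4 * (\<integral>\<^sup>+s. (\<integral>\<^sup>+r. ?W s r \<partial>lborel) * ?I s \<partial>lborel)"
      by (rule nn_integral_cmult) measurable
    also have "\<dots> = 4 * (\<integral>\<^sup>+z. ennreal (N z powr p) * indicator {z. cmod z + e < 1} z \<partial>lborel)"
      by (subst nn_integral_polar) measurable
    also have "\<dots> \<le> 4 * E" by (intro mult_left_mono E) simp
    finally show ?thesis .
  qed
  \<comment> \<open>\<open>X1\<close> is the increment along the radial segment at angle
    \<open>s\<close>, \<open>X2\<close> the one along the arc at depth \<open>t\<close>; the second
    radial segment is \<open>X1 (s + t) t\<close>.\<close>
  define X1 where "X1 s t = cmod (u (of_real R * cis s) - u (of_real (R - t) * cis s))" for s t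
  define X2 where "X2 s t = cmod (u (of_real (R - t) * cis (s + t)) - u (of_real (R - t) * cis s))" for s t
  let ?A = "\<lambda>s t. ennreal ((X1 s t / t) powr p)" and ?A' = "\<lambda>s t. ennreal ((X1 (s + t) t / t) powr p)"
    and ?B = "\<lambda>s t. ennreal ((X2 s t / t) powr p)"
  have X1m [measurable]: "(\<lambda>x. X1 (f x) (g x)) \<in> borel_measurable M" if [measurable]: "f \<in> borel_measurable M" "g \<in> borel_measurable M" for f g :: "_ \<Rightarrow> real" and M
    unfolding X1_def by measurable
  have X2m [measurable]: "(\<lambda>x. X2 (f x) (g x)) \<in> borel_measurable M" if [measurable]: "f \<in> borel_measurable M" "g \<in> borel_measurable M" for f g :: "_ \<Rightarrow> real" and M
    unfolding X2_def by measurable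
  have X1_per: "X1 (s + 2 * pi) t = X1 s t" for s t by (simp add: X1_def cis_2pi)
  have X1_curve: "ennreal (X1 s t) \<le> (\<integral>\<^sup>+r\<in>{0..t}. ennreal (N (of_real (R - r) * cis s)) \<partial>lborel)" if "0 < t" for s t
  proof -
    have d: "((\<lambda>r. of_real (R - r) * cis s) has_vector_derivative - cis s) (at r)" for r
      unfolding has_vector_derivative_def
      by (auto intro!: derivative_eq_intros simp: scaleR_conv_of_real)
    have "ennreal (cmod (u (of_real (R - t) * cis s) - u (of_real (R - 0) * cis s))) \<le> (\<integral>\<^sup>+r\<in>{0..t}. ennreal (N (of_real (R - r) * cis s)) \<partial>lborel)"
      by (rule curve[OF d]) (use that in auto)
    then show ?thesis by (simp add: X1_def norm_minus_commute)
  qed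
  have I1: "?D ?A \<le> ?H * (4 * E)"
  proof -
    have "(\<integral>\<^sup>+t. ?A s t * ?J t \<partial>lborel) \<le> ?H * ?Q s" for s
    proof (rule hardy)
      show "ennreal (X1 s t) \<le> (\<integral>\<^sup>+r\<in>{0..t}. ennreal (N (of_real (R - r) * cis s)) \<partial>lborel)" if "0 < t" for t
        by (rule X1_curve[OF that])
      show "0 \<le> X1 s t" for t by (simp add: X1_def)
    qed (simp_all add: N(2) p)
    then have "?D ?A
       \<le> (\<integral>\<^sup>+s. ?H * (?Q s * ?I s) \<partial>lborel)"
      by (intro nn_integral_mono) (simp add: mult.assoc[symmetric] mult_right_mono)
    also have "\<dots> = ?H * (\<integral>\<^sup>+s. ?Q s * ?I s \<partial>lborel)"
      by (rule nn_integral_cmult) measurable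
    also have "\<dots> \<le> ?H * (4 * E)" by (intro mult_left_mono annulus) simp
    finally show ?thesis .
  qed
  \<comment> \<open>Tonelli with both cut-offs kept in place; with \<open>s\<close> innermost,
    rotations can be removed for fixed \<open>t\<close>.\<close>
  have swap: "?D (\<lambda>s t. f s t) = (\<integral>\<^sup>+t. (\<integral>\<^sup>+s. f s t * ?I s \<partial>lborel) * ?J t \<partial>lborel)"
    if [measurable]: "(\<lambda>x. f (fst x) (snd x)) \<in> borel_measurable (borel \<Otimes>\<^sub>M borel)" for f :: "real \<Rightarrow> real \<Rightarrow> ennreal"
  proof -
    have 1: "f s \<in> borel_measurable borel" for s
      using measurable_compose[OF measurable_Pair1' that] by simp
    have 2: "(\<lambda>s. f s t) \<in> borel_measurable borel" for t
      using measurable_compose[OF measurable_Pair2' that] by simp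
    have "?D (\<lambda>s t. f s t) = (\<integral>\<^sup>+s. \<integral>\<^sup>+t. f s t * ?J t * ?I s \<partial>lborel \<partial>lborel)"
      by (intro nn_integral_cong nn_integral_multc[symmetric]) (use 1 in measurable)
    also have "\<dots> = (\<integral>\<^sup>+t. \<integral>\<^sup>+s. f s t * ?J t * ?I s \<partial>lborel \<partial>lborel)"
      by (rule lborel_pair.Fubini'[symmetric]) (simp add: case_prod_beta')
    also have "\<dots> = (\<integral>\<^sup>+t. \<integral>\<^sup>+s. f s t * ?I s * ?J t \<partial>lborel \<partial>lborel)"
      by (simp only: mult_ac)
    also have "\<dots> = (\<integral>\<^sup>+t. (\<integral>\<^sup>+s. f s t * ?I s \<partial>lborel) * ?J t \<partial>lborel)"
      by (intro nn_integral_cong nn_integral_multc) (use 2 in measurable)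
    finally show ?thesis .
  qed
  \<comment> \<open>For fixed \<open>t\<close> the rotation from \<open>s\<close> to
    \<open>s + t\<close> is absorbed by periodicity, which reduces the second radial segment to the
    first.\<close>
  have I3: "?D ?A' \<le> ?H * (4 * E)"
  proof -
    have "?D ?A'
        = (\<integral>\<^sup>+t. (\<integral>\<^sup>+s. ?A' s t * ?I s \<partial>lborel) * ?J t \<partial>lborel)"
      by (rule swap) measurable
    also have "\<dots> = (\<integral>\<^sup>+t. (\<integral>\<^sup>+s. ?A s t * ?I s \<partial>lborel) * ?J t \<partial>lborel)"
    proof (rule nn_integral_cong)
      fix t :: real
      have "(\<integral>\<^sup>+s. ?A' s t * ?I s \<partial>lborel) = (\<integral>\<^sup>+s. ?A s t * ?I s \<partial>lborel)"
        by (rule nn_integral_periodic_shift[of "\<lambda>s. ?A s t"]) (auto simp: X1_per)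
      then show "(\<integral>\<^sup>+s. ?A' s t * ?I s \<partial>lborel) * ?J t = (\<integral>\<^sup>+s. ?A s t * ?I s \<partial>lborel) * ?J t"
        by simp
    qed
    also have "\<dots> = ?D ?A"
      by (rule swap[symmetric]) measurable
    finally show ?thesis using I1 by simp
  qed
  have I2: "?D ?B \<le> 4 * E"
  proof -
    \<comment> \<open>Uniform density on [0, t]. On the arc the depth is constantly
      \<open>t\<close>, so a plain average suffices, and the rotation by \<open>r\<close> disappears
      in the integral over \<open>s\<close>.\<close>
    define k where "k t r = (if 0 \<le> r \<and> r \<le> t then ennreal (1 / t) else 0)" for t r :: real
    have [measurable]: "(\<lambda>x. k (f x) (g x)) \<in> borel_measurable M" if [measurable]: "f \<in> borel_measurable M" "g \<in> borel_measurable M" for f g :: "_ \<Rightarrow> real" and M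
      unfolding k_def by measurable
    have k_ind: "k t r = ennreal (1 / t) * indicator {0..t} r" for t r by (simp add: k_def indicator_def)
    have k1: "(\<integral>\<^sup>+r. k t r \<partial>lborel) = 1" if "t > 0" for t
      unfolding k_ind using that by (simp add: nn_integral_cmult_indicator ennreal_mult[symmetric])
    have pt: "?B s t \<le> (\<integral>\<^sup>+r. k t r * ?P (R - t) (s + r) \<partial>lborel)"
      if t: "0 < t" "t \<le> 1/4" for s t
    proof (rule jensen_powr)
      have "ennreal (X2 s t) \<le> (\<integral>\<^sup>+r\<in>{0..t}. ennreal (N (of_real (R - t) * cis (s + r))) \<partial>lborel)"
      proof -
        have d: "((\<lambda>r. of_real (R - t) * cis (s + r)) has_vector_derivative of_real (R - t) * (\<i> * cis (s + r))) (at r)" for r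
        proof -
          have "((\<lambda>r. cis (s + r)) has_vector_derivative \<i> * cis (s + r)) (at r)"
          proof -
            have "((\<lambda>z. exp (\<i> * (of_real s + z))) has_field_derivative \<i> * exp (\<i> * (of_real s + of_real r))) (at (of_real r))"
              by (auto intro!: derivative_eq_intros)
            from has_vector_derivative_real_field[OF this] show ?thesis
              by (simp add: cis_conv_exp)
          qed
          then show ?thesis by (rule has_vector_derivative_mult_right)
        qed
        have "ennreal (cmod (u (of_real (R - t) * cis (s + t)) - u (of_real (R - t) * cis (s + 0)))) \<le> (\<integral>\<^sup>+r\<in>{0..t}. ennreal (N (of_real (R - t) * cis (s + r))) \<partial>lborel)"
        proof (rule curve[OF d])
          have "cmod (of_real (R - t)) \<le> 1" unfolding norm_of_real using t R by auto
          then show "cmod (of_real (R - t) * (\<i> * cis (s + r))) \<le> 1" for r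
            by (simp add: norm_mult del: of_real_diff)
        qed (use t in \<open>auto intro!: continuous_intros\<close>)
        then show ?thesis by (simp add: X2_def)
      qed
      then have "ennreal (1 / t) * ennreal (X2 s t) \<le> ennreal (1 / t) * (\<integral>\<^sup>+r\<in>{0..t}. ennreal (N (of_real (R - t) * cis (s + r))) \<partial>lborel)"
        by (intro mult_left_mono) auto
      also have "\<dots> = (\<integral>\<^sup>+r. ennreal (1 / t) * (ennreal (N (of_real (R - t) * cis (s + r))) * indicator {0..t} r) \<partial>lborel)"
        by (rule nn_integral_cmult[symmetric]) measurable
      also have "\<dots> = (\<integral>\<^sup>+r. k t r * ennreal (N (of_real (R - t) * cis (s + r))) \<partial>lborel)"
        unfolding k_ind by (simp only: mult_ac)
      finally show "ennreal (X2 s t / t) \<le> (\<integral>\<^sup>+r. k t r * ennreal (N (of_real (R - t) * cis (s + r))) \<partial>lborel)"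
        using t by (simp add: ennreal_mult[symmetric] X2_def)
      show "(\<integral>\<^sup>+r. k t r \<partial>lborel) = 1" by (rule k1[OF t(1)])
      show "0 \<le> X2 s t / t" using t by (simp add: X2_def)
    qed (auto simp: N p)
    have "?D ?B = (\<integral>\<^sup>+t. (\<integral>\<^sup>+s. ?B s t * ?I s \<partial>lborel) * ?J t \<partial>lborel)"
      by (rule swap) measurable
    also have "\<dots> \<le> (\<integral>\<^sup>+t. (\<integral>\<^sup>+s. ?P (R - t) s * ?I s \<partial>lborel) * ?J t \<partial>lborel)"
    proof (rule nn_integral_mono)
      fix t :: real
      show "(\<integral>\<^sup>+s. ?B s t * ?I s \<partial>lborel) * ?J t \<le> (\<integral>\<^sup>+s. ?P (R - t) s * ?I s \<partial>lborel) * ?J t"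
      proof (cases "t \<in> {0<..1/4}")
        case True
        have "(\<integral>\<^sup>+s. ?B s t * ?I s \<partial>lborel) \<le> (\<integral>\<^sup>+s. (\<integral>\<^sup>+r. k t r * ?P (R - t) (s + r) \<partial>lborel) * ?I s \<partial>lborel)"
          using True by (intro nn_integral_mono mult_right_mono pt) auto
        also have "\<dots> = (\<integral>\<^sup>+s. \<integral>\<^sup>+r. k t r * ?P (R - t) (s + r) * ?I s \<partial>lborel \<partial>lborel)"
          by (intro nn_integral_cong nn_integral_multc[symmetric]) measurable
        also have "\<dots> = (\<integral>\<^sup>+r. \<integral>\<^sup>+s. k t r * ?P (R - t) (s + r) * ?I s \<partial>lborel \<partial>lborel)"
          by (rule lborel_pair.Fubini'[symmetric]) (simp add: case_prod_beta')
        also have "\<dots> = (\<integral>\<^sup>+r. k t r * (\<integral>\<^sup>+s. ?P (R - t) s * ?I s \<partial>lborel) \<partial>lborel)"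
        proof (rule nn_integral_cong)
          fix r :: real
          have "(\<integral>\<^sup>+s. k t r * ?P (R - t) (s + r) * ?I s \<partial>lborel) = k t r * (\<integral>\<^sup>+s. ?P (R - t) (s + r) * ?I s \<partial>lborel)"
            unfolding mult.assoc by (rule nn_integral_cmult) measurable
          also have "(\<integral>\<^sup>+s. ?P (R - t) (s + r) * ?I s \<partial>lborel) = (\<integral>\<^sup>+s. ?P (R - t) s * ?I s \<partial>lborel)"
            by (rule nn_integral_periodic_shift[of "\<lambda>s. ?P (R - t) s"]) (auto simp: cis_2pi)
          finally show "(\<integral>\<^sup>+s. k t r * ?P (R - t) (s + r) * ?I s \<partial>lborel) = k t r * (\<integral>\<^sup>+s. ?P (R - t) s * ?I s \<partial>lborel)" .
        qed
        also have "\<dots> = (\<integral>\<^sup>+s. ?P (R - t) s * ?I s \<partial>lborel)"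
          using True by (subst nn_integral_multc) (auto simp: k1)
        finally show ?thesis by (rule mult_right_mono) simp
      qed simp
    qed
    also have "\<dots> = ?D (\<lambda>s t. ?P (R - t) s)"
      by (rule swap[symmetric]) measurable
    also have "\<dots> \<le> (\<integral>\<^sup>+s. (\<integral>\<^sup>+t\<in>{0..1/4}. ?P (R - t) s \<partial>lborel) * ?I s \<partial>lborel)"
      by (rule nn_integral_mono, rule mult_right_mono, rule nn_integral_mono) (auto simp: indicator_def)
    finally show ?thesis using annulus by simp
  qed
  have three: "(x + y + z) powr p \<le> 3 powr p * (x powr p + y powr p + z powr p)" if "x \<ge> 0" "y \<ge> 0" "z \<ge> 0" for x y z :: real
  proof -
    define m where "m = max x (max y z)"
    have "(x + y + z) powr p \<le> (3 * m) powr p"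
      using that p by (intro powr_mono2) (auto simp: m_def)
    also have "\<dots> = 3 powr p * m powr p" by (rule powr_mult)
    also have "m powr p \<le> x powr p + y powr p + z powr p" by (auto simp: m_def max_def)
    finally show ?thesis by simp
  qed
  have tri: "?V s t
      \<le> ennreal (3 powr p) * (?A s t + ?B s t + ?A' s t)" if t: "t > 0" for s t
  proof -
    have "cmod (u (of_real R * cis (s + t)) - u (of_real R * cis s)) \<le> X1 s t + X2 s t + X1 (s + t) t"
    proof -
      let ?A = "u (of_real R * cis (s + t))" and ?B = "u (of_real (R - t) * cis (s + t))" and ?C = "u (of_real (R - t) * cis s)" and ?D = "u (of_real R * cis s)"
      have "cmod (?A - ?D) \<le> cmod (?A - ?B) + cmod (?B - ?C) + cmod (?C - ?D)"
        using norm_triangle_ineq[of "(?A - ?B) + (?B - ?C)" "?C - ?D"] norm_triangle_ineq[of "?A - ?B" "?B - ?C"] by simp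
      then show ?thesis by (simp add: X1_def X2_def norm_minus_commute)
    qed
    then have "cmod (u (of_real R * cis (s + t)) - u (of_real R * cis s)) / t \<le> X1 s t / t + X2 s t / t + X1 (s + t) t / t"
      using t by (simp add: add_divide_distrib[symmetric] divide_right_mono)
    then have "(cmod (u (of_real R * cis (s + t)) - u (of_real R * cis s)) / t) powr p \<le> (X1 s t / t + X2 s t / t + X1 (s + t) t / t) powr p"
      using t p by (intro powr_mono2) auto
    also have "\<dots> \<le> 3 powr p * ((X1 s t / t) powr p + (X2 s t / t) powr p + (X1 (s + t) t / t) powr p)"
      using t by (intro three) (auto simp: X1_def X2_def)
    finally have "?V s t \<le> ennreal (3 powr p * ((X1 s t / t) powr p + (X2 s t / t) powr p + (X1 (s + t) t / t) powr p))"
      by (rule ennreal_leI)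
    then show ?thesis by (simp add: ennreal_mult)
  qed
  have "?D ?V
     \<le> (\<integral>\<^sup>+s. (\<integral>\<^sup>+t. ennreal (3 powr p) * ((?A s t * ?J t + ?B s t * ?J t) + ?A' s t * ?J t) \<partial>lborel) * ?I s \<partial>lborel)"
  proof (rule nn_integral_mono, rule mult_right_mono, rule nn_integral_mono)
    fix s t :: real
    show "?V s t * ?J t \<le> ennreal (3 powr p) * ((?A s t * ?J t + ?B s t * ?J t) + ?A' s t * ?J t)"
      using tri[of t s] by (cases "t \<in> {0<..1/4}") simp_all
  qed simp
  also have "\<dots> = ennreal (3 powr p) * (?D ?A
      + ?D ?B
      + ?D ?A')"
    by (simp add: nn_integral_cmult nn_integral_add distrib_right mult.assoc)
  also have "\<dots> \<le> ennreal (3 powr p) * (?H * (4 * E) + 4 * E + ?H * (4 * E))"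
    by (intro mult_left_mono add_mono I1 I2 I3) simp
  also have "\<dots> = (ennreal (3 powr p) * (2 * ?H + 1) * 4) * E"
    by (simp add: algebra_simps mult_2)
  also have "ennreal (3 powr p) * (2 * ?H + 1) * 4 = ennreal (3 powr p * (2 * (2 powr p / (p - 1)) + 1) * 4)"
  proof -
    define h where "h = 2 powr p / (p - 1)"
    have "h \<ge> 0" using p by (simp add: h_def)
    then show ?thesis unfolding h_def[symmetric] by (simp add: ennreal_mult)
  qed
  finally show ?thesis .
qed

section \<open>The Douglas condition for Sobolev boundary values\<close>

text \<open>Periodicity centres the increments in [-pi, pi] and symmetry of the quotient leaves the
  positive ones. There the chord is at least \<open>2 * t / pi\<close> by Jordan's inequality, and
  increments above 1/4 contribute only a bounded integrand.\<close>

lemma douglas_of_differences: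
  assumes m: "(\<lambda>s. \<psi> (cis s)) \<in> borel_measurable borel" and p: "p > 0"
    and bounded: "\<And>s. cmod (\<psi> (cis s)) \<le> 1"
    and fin: "(\<integral>\<^sup>+s\<in>{0..2 * pi}. (\<integral>\<^sup>+t\<in>{0<..1/4}. ennreal ((cmod (\<psi> (cis (s + t)) - \<psi> (cis s)) / t) powr p) \<partial>lborel) \<partial>lborel) < \<infinity>"
  shows "douglas p \<psi>"
proof -
  note [measurable] = borel_measurable_dquot[OF m]
  have m' [measurable]: "(\<lambda>x. \<psi> (cis (f x))) \<in> borel_measurable M" if "f \<in> borel_measurable M" for f :: "_ \<Rightarrow> real" and M
    using measurable_compose[OF that m] .
  let ?I = "indicator {0..2 * pi} :: real \<Rightarrow> ennreal" and ?J = "indicator {0..pi} :: real \<Rightarrow> ennreal"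
  let ?D = "\<lambda>f. \<integral>\<^sup>+s. (\<integral>\<^sup>+t. f s t * ?J t \<partial>lborel) * ?I s \<partial>lborel"
  let ?G = "\<lambda>s t. ennreal ((cmod (\<psi> (cis (s + t)) - \<psi> (cis s)) / t) powr p)"
  have "(\<integral>\<^sup>+t. dquot p \<psi> s t * ?I t \<partial>lborel) \<le> (\<integral>\<^sup>+t. dquot p \<psi> s (s + t) * ?J t \<partial>lborel) + (\<integral>\<^sup>+t. dquot p \<psi> s (s - t) * ?J t \<partial>lborel)" for s
  proof -
    have "(\<integral>\<^sup>+t. dquot p \<psi> s t * ?I t \<partial>lborel) = (\<integral>\<^sup>+t\<in>{s - pi..s - pi + 2 * pi}. dquot p \<psi> s t \<partial>lborel)"
      by (rule nn_integral_periodic[symmetric]) (simp_all add: dquot_periodic)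
    also have "\<dots> = (\<integral>\<^sup>+t\<in>{- pi..pi}. dquot p \<psi> s (s + t) \<partial>lborel)"
    proof -
      have "(\<integral>\<^sup>+t\<in>{s - pi..s - pi + 2 * pi}. dquot p \<psi> s t \<partial>lborel)
          = (\<integral>\<^sup>+t. dquot p \<psi> s (t + s) * indicator {s - pi..s - pi + 2 * pi} (t + s) \<partial>lborel)"
        by (rule nn_integral_real_shift[symmetric]) measurable
      also have "\<dots> = (\<integral>\<^sup>+t\<in>{- pi..pi}. dquot p \<psi> s (s + t) \<partial>lborel)"
        by (rule nn_integral_cong) (simp add: indicator_def add.commute)
      finally show ?thesis .
    qed
    also have "\<dots> \<le> (\<integral>\<^sup>+t. dquot p \<psi> s (s + t) * ?J t + dquot p \<psi> s (s + t) * ?J (- t) \<partial>lborel)"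
      by (rule nn_integral_mono) (auto simp: indicator_def)
    also have "\<dots> = (\<integral>\<^sup>+t. dquot p \<psi> s (s + t) * ?J t \<partial>lborel) + (\<integral>\<^sup>+t. dquot p \<psi> s (s + t) * ?J (- t) \<partial>lborel)"
      by (rule nn_integral_add) measurable
    also have "(\<integral>\<^sup>+t. dquot p \<psi> s (s + t) * ?J (- t) \<partial>lborel) = (\<integral>\<^sup>+t. dquot p \<psi> s (s - t) * ?J t \<partial>lborel)"
    proof -
      have "(\<lambda>t. dquot p \<psi> s (s + t) * ?J (- t)) \<in> borel_measurable borel" by measurable
      from nn_integral_real_affine[OF this, of "-1" 0]
      have "(\<integral>\<^sup>+t. dquot p \<psi> s (s + t) * ?J (- t) \<partial>lborel) = ennreal \<bar>-1\<bar> * (\<integral>\<^sup>+t. dquot p \<psi> s (s + (0 + -1 * t)) * ?J (- (0 + -1 * t)) \<partial>lborel)"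
        by (simp only: neg_equal_0_iff_equal one_neq_zero not_False_eq_True simp_thms)
      also have "\<dots> = (\<integral>\<^sup>+t. dquot p \<psi> s (s - t) * ?J t \<partial>lborel)" by simp
      finally show ?thesis .
    qed
    finally show ?thesis .
  qed
  then have "(\<integral>\<^sup>+s. (\<integral>\<^sup>+t. dquot p \<psi> s t * ?I t \<partial>lborel) * ?I s \<partial>lborel)
      \<le> (\<integral>\<^sup>+s. (\<integral>\<^sup>+t. dquot p \<psi> s (s + t) * ?J t \<partial>lborel) * ?I s + (\<integral>\<^sup>+t. dquot p \<psi> s (s - t) * ?J t \<partial>lborel) * ?I s \<partial>lborel)"
    by (intro nn_integral_mono) (simp add: distrib_right[symmetric] mult_right_mono)
  also have "\<dots> = ?D (\<lambda>s t. dquot p \<psi> s (s + t)) + ?D (\<lambda>s t. dquot p \<psi> s (s - t))"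
    by (rule nn_integral_add) measurable
  finally have le1: "(\<integral>\<^sup>+s. (\<integral>\<^sup>+t. dquot p \<psi> s t * ?I t \<partial>lborel) * ?I s \<partial>lborel)
      \<le> ?D (\<lambda>s t. dquot p \<psi> s (s + t)) + ?D (\<lambda>s t. dquot p \<psi> s (s - t))" .
  \<comment> \<open>For fixed \<open>t\<close> rotate \<open>s\<close> to \<open>s + t\<close>, then
    exchange the two arguments of the symmetric quotient.\<close>
  have reflect: "?D (\<lambda>s t. dquot p \<psi> s (s - t)) = ?D (\<lambda>s t. dquot p \<psi> s (s + t))"
  proof -
    have "?D (\<lambda>s t. dquot p \<psi> s (s - t)) = (\<integral>\<^sup>+s. \<integral>\<^sup>+t. dquot p \<psi> s (s - t) * ?J t * ?I s \<partial>lborel \<partial>lborel)"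
      by (intro nn_integral_cong nn_integral_multc[symmetric]) measurable
    also have "\<dots> = (\<integral>\<^sup>+t. \<integral>\<^sup>+s. dquot p \<psi> s (s - t) * ?J t * ?I s \<partial>lborel \<partial>lborel)"
      by (rule lborel_pair.Fubini'[symmetric]) (simp add: case_prod_beta')
    also have "\<dots> = (\<integral>\<^sup>+t. \<integral>\<^sup>+s. dquot p \<psi> s (s + t) * ?J t * ?I s \<partial>lborel \<partial>lborel)"
    proof (rule nn_integral_cong)
      fix t :: real
      have "(\<integral>\<^sup>+s. dquot p \<psi> s (s - t) * ?J t * ?I s \<partial>lborel) = (\<integral>\<^sup>+s. dquot p \<psi> (s + t) (s + t - t) * ?J t * ?I s \<partial>lborel)"
      proof (rule nn_integral_periodic_shift[of "\<lambda>s. dquot p \<psi> s (s - t) * ?J t", symmetric])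
        fix s :: real
        have "s + 2 * pi - t = (s - t) + 2 * pi" by simp
        then show "dquot p \<psi> (s + 2 * pi) (s + 2 * pi - t) * ?J t = dquot p \<psi> s (s - t) * ?J t"
          by (simp only: dquot_periodic)
      qed measurable
      also have "\<dots> = (\<integral>\<^sup>+s. dquot p \<psi> s (s + t) * ?J t * ?I s \<partial>lborel)"
      proof (rule nn_integral_cong)
        fix s :: real
        have "dquot p \<psi> (s + t) (s + t - t) = dquot p \<psi> s (s + t)" by (subst dquot_sym) simp
        then show "dquot p \<psi> (s + t) (s + t - t) * ?J t * ?I s = dquot p \<psi> s (s + t) * ?J t * ?I s" by (simp only:)
      qed
      finally show "(\<integral>\<^sup>+s. dquot p \<psi> s (s - t) * ?J t * ?I s \<partial>lborel) = (\<integral>\<^sup>+s. dquot p \<psi> s (s + t) * ?J t * ?I s \<partial>lborel)" .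
    qed
    also have "\<dots> = (\<integral>\<^sup>+s. \<integral>\<^sup>+t. dquot p \<psi> s (s + t) * ?J t * ?I s \<partial>lborel \<partial>lborel)"
      by (rule lborel_pair.Fubini') (simp add: case_prod_beta')
    also have "\<dots> = ?D (\<lambda>s t. dquot p \<psi> s (s + t))"
      by (intro nn_integral_cong nn_integral_multc) measurable
    finally show ?thesis .
  qed
  have le: "(\<integral>\<^sup>+s. (\<integral>\<^sup>+t. dquot p \<psi> s t * ?I t \<partial>lborel) * ?I s \<partial>lborel) \<le> 2 * ?D (\<lambda>s t. dquot p \<psi> s (s + t))"
    using le1 unfolding reflect by (simp only: mult_2)
  define A where "A = (pi / 2) powr p"
  \<comment> \<open>\<open>A\<close> is the \<open>p\<close>-th power of the factor
    \<open>pi / 2\<close> between chord and angle. For \<open>t > 1/4\<close> the numerator is at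
    most 2, so the difference quotient is at most 8.\<close>
  have pt: "dquot p \<psi> s (s + t) * ?J t \<le> ennreal (A * 8 powr p) * ?J t + ennreal A * (?G s t * indicator {0<..1/4} t)" for s t
  proof (cases "0 < t \<and> t \<le> pi")
    case True
    define X where "X = cmod (\<psi> (cis (s + t)) - \<psi> (cis s)) / t"
    have "2 / pi * (t / 2) \<le> sin (t / 2)" using True by (intro jordan_sin) auto
    then have low: "2 * t / pi \<le> cmod (cis s - cis (s + t))"
      using sin_ge_zero[of "t / 2"] True unfolding cis_dist by (simp add: minus_divide_left[symmetric] del: minus_divide_left)
    have "0 < 2 * t / pi" using True by simp
    then have "cmod (\<psi> (cis s) - \<psi> (cis (s + t))) / cmod (cis s - cis (s + t)) \<le> cmod (\<psi> (cis s) - \<psi> (cis (s + t))) / (2 * t / pi)"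
      using low less_le_trans[OF _ low] by (intro divide_left_mono mult_pos_pos) auto
    also have "\<dots> = pi / 2 * X" by (simp add: X_def norm_minus_commute)
    finally have "norm ((\<psi> (cis s) - \<psi> (cis (s + t))) / (cis s - cis (s + t))) powr p \<le> (pi / 2 * X) powr p"
      using p by (intro powr_mono2) (auto simp: norm_divide)
    also have "\<dots> = A * X powr p" by (simp only: A_def powr_mult)
    finally have q: "dquot p \<psi> s (s + t) \<le> ennreal (A * X powr p)"
      unfolding dquot_def by (rule ennreal_leI)
    show ?thesis
    proof (cases "t \<le> 1 / 4")
      case True': True
      then show ?thesis using q True by (simp add: A_def X_def ennreal_mult add_increasing)
    next
      case False
      have "cmod (\<psi> (cis (s + t)) - \<psi> (cis s)) \<le> 2"
        using norm_triangle_ineq4[of "\<psi> (cis (s + t))" "\<psi> (cis s)"] bounded[of s] bounded[of "s + t"] by linarith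
      then have "X \<le> 8" using False True by (simp add: X_def pos_divide_le_eq)
      then have "X powr p \<le> 8 powr p" using p True by (intro powr_mono2) (auto simp: X_def)
      then have "ennreal (A * X powr p) \<le> ennreal (A * 8 powr p)" by (intro ennreal_leI mult_left_mono) (auto simp: A_def)
      then show ?thesis using q True False by simp
    qed
  next
    case False
    then show ?thesis using p by (cases "t = 0") (auto simp: dquot_def indicator_def)
  qed
  have "?D (\<lambda>s t. dquot p \<psi> s (s + t))
     \<le> (\<integral>\<^sup>+s. (\<integral>\<^sup>+t. ennreal (A * 8 powr p) * ?J t + ennreal A * (?G s t * indicator {0<..1/4} t) \<partial>lborel) * ?I s \<partial>lborel)"
    by (rule nn_integral_mono, rule mult_right_mono, rule nn_integral_mono, rule pt) simp
  also have "\<dots> = ennreal (A * 8 powr p) * emeasure lborel {0..pi} * emeasure lborel {0..2 * pi}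
     + ennreal A * (\<integral>\<^sup>+s. (\<integral>\<^sup>+t\<in>{0<..1/4}. ?G s t \<partial>lborel) * ?I s \<partial>lborel)"
    by (simp add: nn_integral_add nn_integral_cmult nn_integral_cmult_indicator distrib_right mult.assoc)
  also have "\<dots> < \<infinity>" using fin by (auto simp: ennreal_mult_less_top ennreal_add_less_top)
  finally have "2 * ?D (\<lambda>s t. dquot p \<psi> s (s + t)) < \<infinity>"
    by (simp add: ennreal_mult_less_top)
  then show ?thesis using le douglas_iterated[OF m] by (simp add: le_less_trans)
qed

text \<open>The mollifications satisfy \<open>circle_difference_energy\<close> on the circles of
  radius \<open>R n\<close> with one common bound \<open>K\<close>. They converge pointwise to the
  boundary values because \<open>h\<close> is continuous up to the circle, so Fatou's lemma
  preserves the bound.\<close>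

lemma douglas_of_sobolev:
  fixes h :: "complex \<Rightarrow> complex"
  assumes cont: "continuous_on (cball 0 1) h" and bounded: "\<And>z. cmod z \<le> 1 \<Longrightarrow> cmod (h z) \<le> 1"
    and sob: "sobolev_W1 p (ball 0 1) h" and p: "p > 1"
  shows "douglas p h"
proof -
  \<comment> \<open>Mollification uses values on a whole box, so \<open>h\<close> is extended
    continuously by the closest point projection; inside the disk nothing changes.\<close>
  define hc where "hc z = h (closest_point (cball 0 1) z)" for z
  have hc: "continuous_on UNIV hc"
    unfolding hc_def
    by (intro continuous_on_compose2[OF cont] continuous_on_closest_point) (auto intro: closest_point_in_set)
  have eq: "hc z = h z" if "cmod z \<le> 1" for z
    using that by (simp add: hc_def closest_point_self)
  obtain gx gy where g: "Lp_on p (ball 0 1) gx" "Lp_on p (ball 0 1) gy"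
    "weak_partial (ball 0 1) 1 h gx" "weak_partial (ball 0 1) \<i> h gy"
    using sob by (auto simp: sobolev_W1_def)
  have wp: "weak_partial (ball 0 1) v hc g" if "weak_partial (ball 0 1) v h g" for v g
  proof -
    have "(LINT z:ball 0 1|lebesgue. of_real (frechet_derivative \<phi> (at z) v) * hc z) = (LINT z:ball 0 1|lebesgue. of_real (frechet_derivative \<phi> (at z) v) * h z)" for \<phi> :: "complex \<Rightarrow> real"
      unfolding set_lebesgue_integral_def
      by (rule Bochner_Integration.integral_cong) (auto simp: indicator_def eq)
    then show ?thesis using that by (simp add: weak_partial_def)
  qed
  obtain E where E: "E < \<infinity>" "\<And>e. e > 0 \<Longrightarrow> (\<integral>\<^sup>+z. ennreal (moll_grad hc e z powr p) * indicator {z. cmod z + e < 1} z \<partial>lborel) \<le> E"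
    using moll_grad_energy[OF hc p g(1) wp[OF g(3)] g(2) wp[OF g(4)]] by blast
  define K where "K = ennreal (3 powr p * (2 * (2 powr p / (p - 1)) + 1) * 4) * E"
  \<comment> \<open>The offset 4 ensures \<open>R n >= 1/2\<close>; the factor 2 in
    \<open>R n\<close> leaves room for the averaging disk, that is,
    \<open>R n + e n < 1\<close>.\<close>
  define e where "e n = 1 / (real n + 4)" for n
  define R where "R n = 1 - 2 * e n" for n
  let ?m = "\<lambda>n s. moll hc (e n) (of_real (R n) * cis s)"
  let ?I = "indicator {0..2 * pi} :: real \<Rightarrow> ennreal" and ?J = "indicator {0<..1/4} :: real \<Rightarrow> ennreal"
  define f where "f n s t = ennreal ((cmod (?m n (s + t) - ?m n s) / t) powr p)" for n s t
  have e: "e n > 0" "e n \<le> 1" "1 / 2 \<le> R n" "R n + e n < 1" for n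
    by (auto simp: e_def R_def field_simps)
  have e0: "e \<longlonglongrightarrow> 0"
    using LIMSEQ_ignore_initial_segment[OF LIMSEQ_inverse_real_of_nat, of 3]
    unfolding e_def by (simp add: inverse_eq_divide add.commute)
  have K: "(\<integral>\<^sup>+s. (\<integral>\<^sup>+t. f n s t * ?J t \<partial>lborel) * ?I s \<partial>lborel) \<le> K" for n
    unfolding f_def K_def
    by (rule circle_difference_energy[OF continuous_moll[OF hc] continuous_moll_grad[OF hc] moll_grad_nonneg p _ e(3,4,1) E(2)[OF e(1)]])
       (rule moll_curve[OF hc e(1)])
  have lim: "(\<lambda>n. ?m n s) \<longlonglongrightarrow> h (cis s)" for s
  proof (rule LIMSEQ_I)
    fix d :: real assume d: "d > 0"
    have "isCont hc (cis s)" using hc by (simp add: continuous_on_eq_continuous_at)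
    then obtain r where r: "r > 0" "\<And>w. dist w (cis s) < r \<Longrightarrow> dist (hc w) (hc (cis s)) < d / 2"
      using half_gt_zero[OF d] unfolding continuous_at_eps_delta by blast
    \<comment> \<open>The averaging disk has radius \<open>e n\<close> about a point at distance
      \<open>2 * e n\<close> from \<open>cis s\<close>; hence the third.\<close>
    have "\<forall>\<^sub>F n in sequentially. e n < r / 3" using r(1) by (intro order_tendstoD(2)[OF e0]) simp
    then obtain n0 where n0: "\<And>n. n \<ge> n0 \<Longrightarrow> e n < r / 3" by (auto simp: eventually_sequentially)
    have "norm (?m n s - h (cis s)) < d" if n: "n \<ge> n0" for n
    proof -
      have "cmod (?m n s - hc (cis s)) \<le> d / 2"
      proof (rule moll_approx[OF hc e(1,2)])
        show "cmod (of_real (R n) * cis s) \<le> 1" using e[of n] by (simp add: norm_mult)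
        fix w assume w: "cmod (of_real (R n) * cis s - w) < e n"
        have "of_real (R n) * cis s - cis s = of_real (R n - 1) * cis s" by (simp add: algebra_simps)
        then have "cmod (of_real (R n) * cis s - cis s) = \<bar>R n - 1\<bar>" by (simp only: norm_mult norm_of_real norm_cis mult_1_right)
        also have "\<dots> = 2 * e n" using e(1)[of n] by (simp add: R_def)
        finally have "cmod (w - cis s) < 3 * e n"
          using w norm_triangle_ineq[of "w - of_real (R n) * cis s" "of_real (R n) * cis s - cis s"] by (simp add: norm_minus_commute)
        then have "dist w (cis s) < r" using n0[OF n] by (simp add: dist_norm)
        then show "cmod (hc w - hc (cis s)) \<le> d / 2" using r(2)[of w] by (simp add: dist_norm)
      qed
      then show ?thesis using d eq[of "cis s"] by simp
    qed
    then show "\<exists>no. \<forall>n\<ge>no. norm (?m n s - h (cis s)) < d" by blast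
  qed
  let ?F = "\<lambda>s t. ennreal ((cmod (h (cis (s + t)) - h (cis s)) / t) powr p)"
  have flim: "(\<lambda>n. f n s t) \<longlonglongrightarrow> ?F s t" if "t > 0" for s t
    unfolding f_def using p that
    by (intro tendsto_ennrealI tendsto_powr' tendsto_divide tendsto_norm tendsto_diff lim tendsto_const) auto
  have mm [measurable]: "moll hc e \<in> borel_measurable borel" for e
    using continuous_moll[OF hc] by (rule borel_measurable_continuous_onI)
  have fm [measurable]: "(\<lambda>x. f n (u x) (v x)) \<in> borel_measurable M" if [measurable]: "u \<in> borel_measurable M" "v \<in> borel_measurable M" for u v :: "_ \<Rightarrow> real" and M n
    unfolding f_def by measurable
  have "(\<integral>\<^sup>+s. (\<integral>\<^sup>+t. ?F s t * ?J t \<partial>lborel) * ?I s \<partial>lborel)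
      = (\<integral>\<^sup>+s. (\<integral>\<^sup>+t. liminf (\<lambda>n. f n s t * ?J t) \<partial>lborel) * ?I s \<partial>lborel)"
  proof (rule nn_integral_cong)
    fix s :: real
    have "?F s t * ?J t = liminf (\<lambda>n. f n s t * ?J t)" for t
    proof (cases "t \<in> {0<..1/4}")
      case True
      then show ?thesis using lim_imp_Liminf[OF _ flim[of t s]] by simp
    qed (simp add: Liminf_const)
    then show "(\<integral>\<^sup>+t. ?F s t * ?J t \<partial>lborel) * ?I s = (\<integral>\<^sup>+t. liminf (\<lambda>n. f n s t * ?J t) \<partial>lborel) * ?I s"
      by simp
  qed
  \<comment> \<open>Fatou's lemma, first in the increment \<open>t\<close>, then in the angle
    \<open>s\<close>.\<close>
  also have "\<dots> \<le> (\<integral>\<^sup>+s. liminf (\<lambda>n. (\<integral>\<^sup>+t. f n s t * ?J t \<partial>lborel) * ?I s) \<partial>lborel)"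
  proof (rule nn_integral_mono)
    fix s :: real
    have "(\<integral>\<^sup>+t. liminf (\<lambda>n. f n s t * ?J t) \<partial>lborel) \<le> liminf (\<lambda>n. \<integral>\<^sup>+t. f n s t * ?J t \<partial>lborel)"
      by (rule nn_integral_liminf) measurable
    then show "(\<integral>\<^sup>+t. liminf (\<lambda>n. f n s t * ?J t) \<partial>lborel) * ?I s \<le> liminf (\<lambda>n. (\<integral>\<^sup>+t. f n s t * ?J t \<partial>lborel) * ?I s)"
      by (cases "s \<in> {0..2 * pi}") (simp_all add: Liminf_const)
  qed
  also have "\<dots> \<le> liminf (\<lambda>n. \<integral>\<^sup>+s. (\<integral>\<^sup>+t. f n s t * ?J t \<partial>lborel) * ?I s \<partial>lborel)"
    by (rule nn_integral_liminf) measurable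
  also have "\<dots> \<le> liminf (\<lambda>n. K)" by (rule Liminf_mono) (simp add: K)
  also have "\<dots> = K" by (simp add: Liminf_const)
  also have "\<dots> < \<infinity>" using E(1) by (simp add: K_def ennreal_mult_less_top)
  finally have fin: "(\<integral>\<^sup>+s. (\<integral>\<^sup>+t. ?F s t * ?J t \<partial>lborel) * ?I s \<partial>lborel) < \<infinity>" .
  show ?thesis
  proof (rule douglas_of_differences[OF _ _ _ fin])
    have "continuous_on UNIV (\<lambda>s. h (cis s))"
      by (rule continuous_on_compose2[OF cont]) (auto intro: continuous_intros)
    then show "(\<lambda>s. h (cis s)) \<in> borel_measurable borel" by (rule borel_measurable_continuous_onI)
    show "cmod (h (cis s)) \<le> 1" for s by (rule bounded) simp
  qed (use p in auto)
qed

lemma douglas_cong: "(\<And>z. z \<in> sphere 0 1 \<Longrightarrow> \<phi> z = \<psi> z) \<Longrightarrow> douglas r \<phi> = douglas r \<psi>"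
  by (simp add: douglas_def)

theorem theorem1p5:
  fixes \<phi> \<phi>inv :: "complex \<Rightarrow> complex" and p q :: real
  assumes "homeomorphism (sphere 0 1) (sphere 0 1) \<phi> \<phi>inv"
    and "p > 1" and "q > 1"
  shows "(douglas p \<phi> \<and> douglas q \<phi>inv) \<longleftrightarrow>
    (\<exists>h hinv. homeomorphism (cball 0 1) (cball 0 1) h hinv \<and>
       (\<forall>z\<in>sphere 0 1. h z = \<phi> z) \<and>
       sobolev_W1 p (ball 0 1) h \<and> sobolev_W1 q (ball 0 1) hinv)"
proof
  assume "douglas p \<phi> \<and> douglas q \<phi>inv"
  then show "\<exists>h hinv. homeomorphism (cball 0 1) (cball 0 1) h hinv \<and> (\<forall>z\<in>sphere 0 1. h z = \<phi> z) \<and>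
       sobolev_W1 p (ball 0 1) h \<and> sobolev_W1 q (ball 0 1) hinv"
    using extension_exists[OF assms(1)] assms(2,3) by auto
next
  assume "\<exists>h hinv. homeomorphism (cball 0 1) (cball 0 1) h hinv \<and> (\<forall>z\<in>sphere 0 1. h z = \<phi> z) \<and>
       sobolev_W1 p (ball 0 1) h \<and> sobolev_W1 q (ball 0 1) hinv"
  then obtain h hinv where hom: "homeomorphism (cball 0 1) (cball 0 1) h hinv"
    and h: "\<And>z. z \<in> sphere 0 1 \<Longrightarrow> h z = \<phi> z"
    and sob: "sobolev_W1 p (ball 0 1) h" "sobolev_W1 q (ball 0 1) hinv" by blast
  have maps: "cmod (h z) \<le> 1" "cmod (hinv z) \<le> 1" if "cmod z \<le> 1" for z
  proof -
    have "h ` cball 0 1 \<subseteq> cball 0 1" "hinv ` cball 0 1 \<subseteq> cball 0 1"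
      using hom by (simp_all add: homeomorphism_def)
    moreover have "z \<in> cball 0 1" using that by simp
    ultimately have "h z \<in> cball 0 1" "hinv z \<in> cball 0 1" by blast+
    then show "cmod (h z) \<le> 1" "cmod (hinv z) \<le> 1" by simp_all
  qed
  \<comment> \<open>The point \<open>\<phi>inv z\<close> lies on the circle, where \<open>h\<close>
    is \<open>\<phi>\<close>, so \<open>h\<close> sends it to \<open>z\<close>.\<close>
  have "hinv z = \<phi>inv z" if z: "z \<in> sphere 0 1" for z
  proof -
    have w: "\<phi>inv z \<in> sphere 0 1" "\<phi> (\<phi>inv z) = z"
      using assms(1) z unfolding homeomorphism_def by auto
    then have "hinv (h (\<phi>inv z)) = \<phi>inv z"
      using hom unfolding homeomorphism_def by auto
    then show ?thesis using h[OF w(1)] w(2) by simp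
  qed
  then have "douglas q hinv = douglas q \<phi>inv" by (rule douglas_cong)
  moreover have "douglas p h = douglas p \<phi>" by (rule douglas_cong) (rule h)
  moreover have "douglas p h"
    by (rule douglas_of_sobolev[OF homeomorphism_cont1[OF hom] maps(1) sob(1) assms(2)])
  moreover have "douglas q hinv"
    by (rule douglas_of_sobolev[OF homeomorphism_cont2[OF hom] maps(2) sob(2) assms(3)])
  ultimately show "douglas p \<phi> \<and> douglas q \<phi>inv" by simp
qed

end
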